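(* Let $0<\alpha<2$ and let $M$ be the maximal displacement of a critical branching symmetric $\alpha$-stable process started from a single particle at $0\in\mathbb{R}$. Then $$P\{M\ge x\}\sim \sqrt{\frac{2}{\alpha}}\,\frac{1}{x^{\alpha/2}}\qquad\text{as } x\to\infty,$$ i.e. the ratio of the two sides tends to $1$.
   Context: Symmetric $\alpha$-stable process ($0<\alpha<2$): the real-valued symmetric pure-jump Lévy process $\{X_t\}_{t\ge0}$ satisfying $X_t/t^{1/\alpha}\overset{\mathscr D}{=}X_1$ for all $t>0$, with characteristic function $E e^{i\theta X_t}=\exp(-\gamma t|\theta|^\alpha)$ for some $\gamma>0$, with time scaled so that its Lévy (jump) measure is $\lambda(dy)=|y|^{-1-\alpha}\,dy$ on $\mathbb{R}$. Critical branching symmetric $\alpha$-stable process (CBSS process): a continuous-time particle system on $\mathbb{R}$ initiated by a single particle at $0$ at time $0$, such that (A) each particle, independently of all others and of the past, waits an exponentially distributed time with parameter $1$ and then either splits into two identical particles (located at its current position) or dies, each with probability $1/2$; (B) while not branching, each particle moves in $\mathbb{R}$, from its birth point, according to a symmetric $\alpha$-stable process, independently of the reproduction process and of the other particles. Let $Y_t$ be the number of particles alive at time $t$ and $\zeta_{t,i}$ ($i=1,\dots,Y_t$) their locations. The maximal displacement is $M=\max_{t\ge0}M_t$, where $M_t=\max_{1\le i\le Y_t}\zeta_{t,i}$, with the convention that the maximum of the empty set is $-\infty$. (The process dies out in finite time almost surely.) *)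

theory Defs
  imports "HOL-Probability.Probability" "HOL-Library.Landau_Symbols"
begin

definition cadlag :: "(real \<Rightarrow> real) \<Rightarrow> bool" where
  "cadlag f \<longleftrightarrow> (\<forall>t\<ge>0. (f \<longlongrightarrow> f t) (at_right t)) \<and> (\<forall>t>0. \<exists>l. (f \<longlongrightarrow> l) (at_left t))"

(* The random variable at time t is "X t"; only times t >= 0 matter. Paths are cadlag for every
   sample point, so that suprema over time are measurable although M need not be complete.
   Stochastic continuity follows from right-continuity and stationarity of the increments. *)
locale levy_process = prob_space M for M :: "'w measure" +
  fixes X :: "real \<Rightarrow> 'w \<Rightarrow> real"
  assumes measurable_process: "\<And>t. 0 \<le> t \<Longrightarrow> random_variable borel (X t)"
    and starts_at_0: "AE \<omega> in M. X 0 \<omega> = 0"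
    and indep_increments: "\<And>(s :: nat \<Rightarrow> real) n. 0 \<le> s 0 \<Longrightarrow> mono s \<Longrightarrow>
          indep_vars (\<lambda>_. borel) (\<lambda>i \<omega>. X (s (Suc i)) \<omega> - X (s i) \<omega>) {..<n}"
    and stationary_increments: "\<And>s h. 0 \<le> s \<Longrightarrow> 0 \<le> h \<Longrightarrow>
          distr M borel (\<lambda>\<omega>. X (s + h) \<omega> - X s \<omega>) = distr M borel (X h)"
    and cadlag_paths: "\<And>\<omega>. \<omega> \<in> space M \<Longrightarrow> cadlag (\<lambda>t. X t \<omega>)"

(* X has Levy-Khintchine triplet (b, s, nu): drift b (with respect to the truncation |y| < 1),
   Gaussian variance s, and Levy (jump) measure nu. *)
definition has_levy_triplet ::
    "'w measure \<Rightarrow> (real \<Rightarrow> 'w \<Rightarrow> real) \<Rightarrow> real \<Rightarrow> real \<Rightarrow> real measure \<Rightarrow> bool" where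
  "has_levy_triplet M X b s \<nu> \<longleftrightarrow>
     0 \<le> s \<and> sets \<nu> = sets borel \<and> emeasure \<nu> {0} = 0 \<and> integrable \<nu> (\<lambda>y. min 1 (y\<^sup>2)) \<and>
     (\<forall>t\<ge>0. \<forall>\<theta>. char (distr M borel (X t)) \<theta> =
        exp (of_real t * (\<i> * of_real (b * \<theta>) - of_real (s * \<theta>\<^sup>2 / 2) +
          (CLINT y|\<nu>. iexp (\<theta> * y) - 1 - \<i> * of_real (\<theta> * y * indicator {-1<..<1} y)))))"

definition stable_levy_measure :: "real \<Rightarrow> real measure" where
  "stable_levy_measure \<alpha> = density lborel (\<lambda>y. ennreal (\<bar>y\<bar> powr (- 1 - \<alpha>)))"

(* The triplet (0, 0, nu) says that the process is pure-jump, without compensating drift. It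
   also determines the constant gamma, i.e. it fixes the time scale. *)
locale symmetric_stable_process = levy_process M X
  for M :: "'w measure" and \<alpha> :: real and X :: "real \<Rightarrow> 'w \<Rightarrow> real" +
  assumes symmetric: "\<And>t. 0 \<le> t \<Longrightarrow> distr M borel (\<lambda>\<omega>. - X t \<omega>) = distr M borel (X t)"
    and self_similar: "\<And>t. 0 < t \<Longrightarrow>
          distr M borel (\<lambda>\<omega>. X t \<omega> / t powr (1 / \<alpha>)) = distr M borel (X 1)"
    and stable_char: "\<exists>\<gamma>>0. \<forall>t\<ge>0. \<forall>\<theta>.
          char (distr M borel (X t)) \<theta> = of_real (exp (- \<gamma> * t * \<bar>\<theta>\<bar> powr \<alpha>))"
    and levy_triplet: "has_levy_triplet M X 0 0 (stable_levy_measure \<alpha>)"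

(* Particles are labelled by the nodes of the binary tree: the root is [], and the children of u
   are True # u and False # u, so "tl" is the mother. For a label u and a sample point w,
     T u w   is the lifetime of u,
     B u w   tells whether u splits (rather than dies) at the end of its life,
     X u r w is the displacement of u from its birth point at age r.
   These are given for all labels, including those of particles that are never born. *)

primrec birth_time :: "(bool list \<Rightarrow> 'w \<Rightarrow> real) \<Rightarrow> 'w \<Rightarrow> bool list \<Rightarrow> real" where
  "birth_time T \<omega> [] = 0"
| "birth_time T \<omega> (b # u) = birth_time T \<omega> u + T u \<omega>"

primrec born :: "(bool list \<Rightarrow> 'w \<Rightarrow> bool) \<Rightarrow> 'w \<Rightarrow> bool list \<Rightarrow> bool" where
  "born B \<omega> [] \<longleftrightarrow> True"
| "born B \<omega> (b # u) \<longleftrightarrow> born B \<omega> u \<and> B u \<omega>"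

primrec birth_place ::
    "(bool list \<Rightarrow> 'w \<Rightarrow> real) \<Rightarrow> (bool list \<Rightarrow> real \<Rightarrow> 'w \<Rightarrow> real) \<Rightarrow> 'w \<Rightarrow> bool list \<Rightarrow> real" where
  "birth_place T X \<omega> [] = 0"
| "birth_place T X \<omega> (b # u) = birth_place T X \<omega> u + X u (T u \<omega>) \<omega>"

definition alive ::
    "(bool list \<Rightarrow> 'w \<Rightarrow> real) \<Rightarrow> (bool list \<Rightarrow> 'w \<Rightarrow> bool) \<Rightarrow> real \<Rightarrow> 'w \<Rightarrow> bool list set" where
  "alive T B t \<omega> =
     {u. born B \<omega> u \<and> birth_time T \<omega> u \<le> t \<and> t < birth_time T \<omega> u + T u \<omega>}"

definition location ::
    "(bool list \<Rightarrow> 'w \<Rightarrow> real) \<Rightarrow> (bool list \<Rightarrow> real \<Rightarrow> 'w \<Rightarrow> real) \<Rightarrow> real \<Rightarrow> 'w \<Rightarrow> bool list \<Rightarrow> real" where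
  "location T X t \<omega> u = birth_place T X \<omega> u + X u (t - birth_time T \<omega> u) \<omega>"

(* Extended-real suprema: the supremum over the empty set is -\<infinity>. *)
definition rightmost ::
    "(bool list \<Rightarrow> 'w \<Rightarrow> real) \<Rightarrow> (bool list \<Rightarrow> 'w \<Rightarrow> bool) \<Rightarrow> (bool list \<Rightarrow> real \<Rightarrow> 'w \<Rightarrow> real) \<Rightarrow>
     real \<Rightarrow> 'w \<Rightarrow> ereal" where
  "rightmost T B X t \<omega> = (SUP u\<in>alive T B t \<omega>. ereal (location T X t \<omega> u))"

definition maximal_displacement ::
    "(bool list \<Rightarrow> 'w \<Rightarrow> real) \<Rightarrow> (bool list \<Rightarrow> 'w \<Rightarrow> bool) \<Rightarrow> (bool list \<Rightarrow> real \<Rightarrow> 'w \<Rightarrow> real) \<Rightarrow>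
     'w \<Rightarrow> ereal" where
  "maximal_displacement T B X \<omega> = (SUP t\<in>{0..}. rightmost T B X t \<omega>)"

(* The library's independence of variables needs one common range type, hence independence is
   stated for the generated sigma-algebras. *)
datatype source = Lifetime "bool list" | Branching "bool list" | Motion "bool list"

primrec generated_events ::
    "'w measure \<Rightarrow> (bool list \<Rightarrow> 'w \<Rightarrow> real) \<Rightarrow> (bool list \<Rightarrow> 'w \<Rightarrow> bool) \<Rightarrow>
     (bool list \<Rightarrow> real \<Rightarrow> 'w \<Rightarrow> real) \<Rightarrow> source \<Rightarrow> 'w set set" where
  "generated_events M T B X (Lifetime u) = {T u -` A \<inter> space M |A. A \<in> sets borel}"
| "generated_events M T B X (Branching u) = {B u -` A \<inter> space M |A. A \<in> sets (count_space UNIV)}"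
| "generated_events M T B X (Motion u) =
     {(\<lambda>\<omega>. \<lambda>t\<in>{0..}. X u t \<omega>) -` A \<inter> space M |A. A \<in> sets (\<Pi>\<^sub>M t\<in>{0..}. borel)}"

(* Positivity of the lifetimes is required for every sample point, as regularity of the paths is,
   to avoid non-measurable null sets. *)
locale cbss_process = prob_space M for M :: "'w measure" +
  fixes \<alpha> :: real
    and T :: "bool list \<Rightarrow> 'w \<Rightarrow> real"
    and B :: "bool list \<Rightarrow> 'w \<Rightarrow> bool"
    and X :: "bool list \<Rightarrow> real \<Rightarrow> 'w \<Rightarrow> real"
  assumes lifetime_pos: "\<And>u \<omega>. \<omega> \<in> space M \<Longrightarrow> 0 < T u \<omega>"
    and lifetime: "\<And>u. distributed M lborel (T u) (exponential_density 1)"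
    and branching_measurable: "\<And>u. random_variable (count_space UNIV) (B u)"
    and branching: "\<And>u. distr M (count_space UNIV) (B u) = measure_pmf (bernoulli_pmf (1 / 2))"
    and motion: "\<And>u. symmetric_stable_process M \<alpha> (X u)"
    and independence: "indep_sets (generated_events M T B X) UNIV"

end

theory Submission
  imports Defs
begin

text \<open>Let \<open>w x = P(M > x)\<close>, and for the founding particle let \<open>\<xi>\<close> be its displacement over its
  lifetime and \<open>R\<close> the supremum of its path. Conditioning on the founder gives the recursion
  \<open>w x = P(R > x) + E(\<psi> (w (x - \<xi>)); R \<le> x)\<close> with \<open>\<psi> w = w - w\<^sup>2/2\<close>, whose right-hand side is
  monotone in \<open>w\<close>, so that sub- and supersolutions bound \<open>w\<close>. Take \<open>a x\<^sup>-\<^sup>\<alpha>\<^sup>/\<^sup>2 \<plusminus> b x\<^sup>-\<^sup>\<alpha>\<close>.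
  Since \<open>\<xi>\<close> is symmetric, the first order term of the shift by a moderate \<open>\<xi>\<close> cancels, and the second
  order term as well as all jumps short of \<open>x\<close> contribute only \<open>O(x\<^sup>-\<^sup>3\<^sup>\<alpha>\<^sup>/\<^sup>2)\<close>, which a large \<open>b\<close> absorbs.
  What remains is the single large jump, \<open>P(R > x) ~ x\<^sup>-\<^sup>\<alpha>/\<alpha>\<close>, against the branching term
  \<open>w\<^sup>2/2 ~ a\<^sup>2 x\<^sup>-\<^sup>\<alpha>/2\<close>; these balance exactly for \<open>a\<^sup>2 = 2/\<alpha>\<close>.\<close>

section \<open>Power-law barriers for a symmetric step\<close>

text \<open>In the estimates \<open>R\<close> is not the supremum itself. From above it is the
  maximum over a dyadic grid of fractions of the lifetime; from below it is the position at age
  \<open>\<rho> * T\<close> with a fixed \<open>\<rho> < 1\<close>, since a particle no longer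
  counts at age exactly \<open>T\<close>. Ottaviani's inequality compares a grid maximum with the
  endpoint at the cost of a factor that is close to 1 and does not see the mesh, and the single
  position loses only the factor \<rho>. As \<open>T\<close> has mean 1, both inherit the constant
  of the tail of the stable law at time 1, which is 1/\<alpha>: the mass that the jump measure gives
  to the half-line beyond 1. Self-similarity converts small-time convergence to the jump measure
  into this large-distance statement. The comparison runs over generations. A supersolution
  dominates every truncated tree at once; a subsolution does so only up to the probability that the
  critical binary tree survives n generations, which tends to 0. For small \<alpha> the step has no
  mean, so its symmetry can be used only after truncation at a fraction \<delta> of x. All losses
  (\<delta>, \<rho>, the Ottaviani parameter \<epsilon>) are paid from a strict inequality between
  \<open>a\<^sup>2 / 2\<close> and 1/\<alpha>.\<close>

lemma powr_taylor_quadratic: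
  fixes \<beta> s :: real
  assumes "0 < \<beta>" "\<beta> \<le> 2" "\<bar>s\<bar> \<le> 1/2"
  shows "\<bar>(1 - s) powr (-\<beta>) - 1 - \<beta> * s\<bar> \<le> 48 * s\<^sup>2"
proof (cases "s = 0")
  case False
  \<comment> \<open>\<open>d\<close> lists the derivatives of order 0, 1, 2. For \<beta> at most 2
    and arguments at most 1/2 in modulus, the second one is at most 2 * 3 * 2^4 = 96; half of it is
    the 48.\<close>
  define d where "d = (\<lambda>m::nat. \<lambda>s::real. if m = 0 then (1 - s) powr (-\<beta>)
     else if m = 1 then \<beta> * (1 - s) powr (-\<beta> - 1)
     else \<beta> * (\<beta> + 1) * (1 - s) powr (-\<beta> - 2))"
  have D0: "DERIV (d 0) t :> d 1 t" and D1: "DERIV (d 1) t :> d 2 t" if "t \<le> 1/2" for t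
    using that unfolding d_def by (auto intro!: derivative_eq_intros simp: algebra_simps)
  have d0: "d 0 = (\<lambda>s. (1 - s) powr (-\<beta>))" by (simp add: d_def)
  have "DERIV (d m) t :> d (Suc m) t" if "m < 2 \<and> -1/2 \<le> t \<and> t \<le> 1/2" for m t
    using that D0[of t] D1[of t] by (auto simp: less_Suc_eq numeral_2_eq_2)
  then obtain t where t: "if s < 0 then s < t \<and> t < 0 else 0 < t \<and> t < s"
    and eq: "(1 - s) powr (-\<beta>) = (\<Sum>m<2. (d m 0 / fact m) * (s - 0)^m) + (d 2 t / fact 2) * (s - 0)^2"
    using Taylor[of 2 d "\<lambda>s. (1 - s) powr (-\<beta>)" "-1/2" "1/2" 0 s] False assms(3)
    by (fastforce simp: d0)
  have "\<bar>t\<bar> \<le> 1/2" using t assms(3) by (auto split: if_splits)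
  then have t2: "1/2 \<le> 1 - t" by auto
  have "(1 - t) powr (-\<beta> - 2) \<le> (1/2) powr (-\<beta> - 2)"
    using t2 assms by (intro powr_mono2') auto
  also have "\<dots> \<le> (1/2) powr (-4)"
    using assms by (intro powr_mono') auto
  also have "(1/2::real) powr (-4) = 16"
    by (simp add: powr_minus powr_numeral power_divide)
  finally have P: "(1 - t) powr (-\<beta> - 2) \<le> 16" .
  have "\<beta> * (\<beta> + 1) \<le> 2 * 3" using assms by (intro mult_mono) auto
  then have "\<beta> * (\<beta> + 1) * (1 - t) powr (-\<beta> - 2) \<le> 6 * 16"
    using P assms by (intro mult_mono) auto
  then have D: "0 \<le> d 2 t" "d 2 t \<le> 96" using assms by (auto simp: d_def)
  have "(1 - s) powr (-\<beta>) - 1 - \<beta> * s = d 2 t / 2 * s^2"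
    unfolding eq by (simp add: d_def lessThan_Suc numeral_2_eq_2)
  moreover have "d 2 t / 2 * s^2 \<le> 48 * s^2" using D by (intro mult_right_mono) auto
  moreover have "0 \<le> d 2 t / 2 * s^2" using D by auto
  ultimately show ?thesis by simp
qed simp

text \<open>Scaling by x reduces this to the shift \<open>z / x\<close>. The range of \<beta> covers
  both exponents of the barriers, \<alpha>/2 and \<alpha>. The linear term is isolated because it
  has mean zero for a symmetric truncated step.\<close>

lemma powr_shift_quadratic:
  fixes \<beta> x z :: real
  assumes "0 < \<beta>" "\<beta> \<le> 2" "0 < x" "\<bar>z\<bar> \<le> x / 2"
  shows "\<bar>(x - z) powr (-\<beta>) - x powr (-\<beta>) - \<beta> * x powr (-\<beta>) / x * z\<bar>
           \<le> 48 * x powr (-\<beta>) / x\<^sup>2 * z\<^sup>2"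
proof -
  define s where "s = z / x"
  have s: "\<bar>s\<bar> \<le> 1/2" "z = s * x" using assms by (auto simp: s_def field_simps abs_mult)
  have "x - z = x * (1 - s)" by (simp add: s algebra_simps)
  then have "(x - z) powr (-\<beta>) = x powr (-\<beta>) * (1 - s) powr (-\<beta>)"
    using assms s(1) by (simp add: powr_mult)
  then have "(x - z) powr (-\<beta>) - x powr (-\<beta>) - \<beta> * x powr (-\<beta>) / x * z
      = x powr (-\<beta>) * ((1 - s) powr (-\<beta>) - 1 - \<beta> * s)"
    using assms by (simp add: s(2) algebra_simps)
  also have "\<bar>\<dots>\<bar> \<le> x powr (-\<beta>) * (48 * s\<^sup>2)"
    unfolding abs_mult using powr_taylor_quadratic[OF assms(1,2) s(1)]
    by (intro mult_mono) auto
  finally show ?thesis using assms by (simp add: s(2) power2_eq_square field_simps)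
qed

text \<open>The recursion evaluates the barrier at \<open>x - \<xi>\<close>, which may be any real,
  and needs values in [0,1] so that squaring 1 - w respects order. The powers blow up near 0 and are
  therefore cut off at the trivial bound 1; the lower barrier is cut off at 0 in the same
  way.\<close>

definition upper_barrier :: "real \<Rightarrow> real \<Rightarrow> real \<Rightarrow> real \<Rightarrow> real" where
  "upper_barrier \<alpha> a b x =
     (if x \<le> 0 then 1 else min 1 (a * x powr (-\<alpha>/2) + b * x powr (-\<alpha>)))"

definition lower_barrier :: "real \<Rightarrow> real \<Rightarrow> real \<Rightarrow> real \<Rightarrow> real" where
  "lower_barrier \<alpha> a b x =
     (if x \<le> 0 then 0 else max 0 (a * x powr (-\<alpha>/2) - b * x powr (-\<alpha>)))"

lemma upper_barrier_measurable [measurable]: "upper_barrier \<alpha> a b \<in> borel_measurable borel"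
  unfolding upper_barrier_def[abs_def] by measurable

lemma lower_barrier_measurable [measurable]: "lower_barrier \<alpha> a b \<in> borel_measurable borel"
  unfolding lower_barrier_def[abs_def] by measurable

lemma upper_barrier_bounds:
  assumes "0 < a" "0 < b"
  shows "0 \<le> upper_barrier \<alpha> a b x" "upper_barrier \<alpha> a b x \<le> 1"
  using assms by (auto simp: upper_barrier_def)

text \<open>As a quadratic in \<open>x powr (-\<alpha>/2)\<close> the uncut barrier peaks at
  \<open>a\<^sup>2 / (4 * b)\<close>, so that a large \<open>b\<close> keeps it below 1.\<close>

lemma lower_barrier_bounds:
  assumes "0 < a" "2 * a\<^sup>2 \<le> b"
  shows "0 \<le> lower_barrier \<alpha> a b x" "lower_barrier \<alpha> a b x \<le> 1"
proof -
  show "0 \<le> lower_barrier \<alpha> a b x" by (auto simp: lower_barrier_def)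
  have b: "0 < b" using assms zero_less_power[of a 2] by linarith
  have "a * x powr (-\<alpha>/2) - b * x powr (-\<alpha>) \<le> 1"
  proof -
    define p where "p = x powr (-\<alpha>/2)"
    have psq: "x powr (-\<alpha>) = p\<^sup>2" by (simp add: p_def power2_eq_square flip: powr_add)
    have "2 * a\<^sup>2 * p\<^sup>2 \<le> b * p\<^sup>2" using assms by (intro mult_right_mono) auto
    moreover have "0 \<le> (2 * a * p - 1)\<^sup>2" "0 \<le> (a * p)\<^sup>2" by simp_all
    ultimately have "a * p - b * p\<^sup>2 \<le> 1" by (simp add: power2_eq_square algebra_simps)
    then show ?thesis by (simp add: psq p_def)
  qed
  then show "lower_barrier \<alpha> a b x \<le> 1" by (simp add: lower_barrier_def)
qed

text \<open>Collects what the barrier computation uses about the displacement of a particle over its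
  life: symmetry in truncated form, which makes sense even when the step is not integrable, and the
  two moment bounds of an \<alpha>-stable scale. One constant \<open>C\<close> serves both
  bounds.\<close>

locale symmetric_step = prob_space M for M :: "'w measure" +
  fixes \<xi> :: "'w \<Rightarrow> real" and \<alpha> C :: real
  assumes \<alpha>: "0 < \<alpha>" "\<alpha> < 2"
    and step_measurable [measurable]: "\<xi> \<in> borel_measurable M"
    and truncated_mean: "\<And>y. 0 < y \<Longrightarrow> expectation (\<lambda>\<omega>. \<xi> \<omega> * indicator {-y..y} (\<xi> \<omega>)) = 0"
    and truncated_variance: "\<And>y. 0 < y \<Longrightarrow>
          expectation (\<lambda>\<omega>. (\<xi> \<omega>)\<^sup>2 * indicator {-y..y} (\<xi> \<omega>)) \<le> C * y powr (2 - \<alpha>)"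
    and tail: "\<And>y. 0 < y \<Longrightarrow> prob {\<omega>\<in>space M. y < \<bar>\<xi> \<omega>\<bar>} \<le> C * y powr (-\<alpha>)"
begin

lemma C_nonneg: "0 \<le> C"
proof -
  have "0 \<le> prob {\<omega>\<in>space M. 1 < \<bar>\<xi> \<omega>\<bar>}" by simp
  also have "\<dots> \<le> C" using tail[of 1] by simp
  finally show ?thesis .
qed

lemma integrable_truncated:
  "integrable M (\<lambda>\<omega>. \<xi> \<omega> * indicator {-y..y} (\<xi> \<omega>))"
  "integrable M (\<lambda>\<omega>. (\<xi> \<omega>)\<^sup>2 * indicator {-y..y} (\<xi> \<omega>))"
proof -
  have "\<bar>\<xi> \<omega> * indicator {-y..y} (\<xi> \<omega>)\<bar> \<le> \<bar>y\<bar>" for \<omega> by (auto simp: indicator_def)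
  then show "integrable M (\<lambda>\<omega>. \<xi> \<omega> * indicator {-y..y} (\<xi> \<omega>))"
    by (intro integrable_const_bound[where B="\<bar>y\<bar>"]) auto
  have "\<bar>(\<xi> \<omega>)\<^sup>2 * indicator {-y..y} (\<xi> \<omega>)\<bar> \<le> y\<^sup>2" for \<omega>
    by (auto simp: indicator_def abs_le_square_iff[symmetric])
  then show "integrable M (\<lambda>\<omega>. (\<xi> \<omega>)\<^sup>2 * indicator {-y..y} (\<xi> \<omega>))"
    by (intro integrable_const_bound[where B="y\<^sup>2"]) auto
qed

text \<open>The linear term vanishes whatever \<open>c\<close> is. The truncated second moment at
  scale x grows like x^(2-\<alpha>), so after division by x^2 the quadratic Taylor term has the
  order x^-\<alpha> of the probability of one jump of size x.\<close>

lemma truncated_quadratic_expectation: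
  assumes "0 < x" "0 < \<delta>" "\<delta> \<le> 1"
  shows "\<bar>expectation (\<lambda>\<omega>. c * (\<xi> \<omega> * indicator {-(\<delta>*x)..\<delta>*x} (\<xi> \<omega>))
            + d / x\<^sup>2 * ((\<xi> \<omega>)\<^sup>2 * indicator {-(\<delta>*x)..\<delta>*x} (\<xi> \<omega>)))\<bar> \<le> \<bar>d\<bar> * C * x powr (-\<alpha>)"
proof -
  let ?V = "expectation (\<lambda>\<omega>. (\<xi> \<omega>)\<^sup>2 * indicator {-(\<delta>*x)..\<delta>*x} (\<xi> \<omega>))"
  have pos: "0 < \<delta> * x" using assms by simp
  have V0: "0 \<le> ?V" by (intro Bochner_Integration.integral_nonneg) auto
  have "?V \<le> C * (\<delta>*x) powr (2 - \<alpha>)" by (rule truncated_variance[OF pos])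
  also have "\<dots> \<le> C * x powr (2 - \<alpha>)"
    using C_nonneg assms \<alpha> by (intro mult_left_mono powr_mono2) (auto simp: mult_left_le_one_le)
  also have "x powr (2 - \<alpha>) = x\<^sup>2 * x powr (-\<alpha>)"
    using assms by (simp add: powr_diff powr_minus divide_simps powr_numeral)
  finally have V: "?V \<le> x\<^sup>2 * (C * x powr (-\<alpha>))" by (simp add: algebra_simps)
  have "expectation (\<lambda>\<omega>. c * (\<xi> \<omega> * indicator {-(\<delta>*x)..\<delta>*x} (\<xi> \<omega>))
            + d / x\<^sup>2 * ((\<xi> \<omega>)\<^sup>2 * indicator {-(\<delta>*x)..\<delta>*x} (\<xi> \<omega>))) = d / x\<^sup>2 * ?V"
    using truncated_mean[OF pos] integrable_truncated
    by (subst Bochner_Integration.integral_add) auto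
  also have "\<bar>\<dots>\<bar> = \<bar>d\<bar> / x\<^sup>2 * ?V" using V0 by (simp add: abs_mult)
  also have "\<dots> \<le> \<bar>d\<bar> / x\<^sup>2 * (x\<^sup>2 * (C * x powr (-\<alpha>)))" using V by (intro mult_left_mono) auto
  also have "\<dots> = \<bar>d\<bar> * C * x powr (-\<alpha>)" using assms by simp
  finally show ?thesis .
qed


text \<open>The recursion for \<open>w\<close> is used in the form for \<open>1 - w\<close>: note \<open>(1 + (1 - w)\<^sup>2) / 2 = 1 - \<psi> w\<close>.\<close>

lemma supersolution:
  fixes R :: "'w \<Rightarrow> real"
  assumes R [measurable]: "R \<in> borel_measurable M"
    and step_le: "\<And>\<omega>. \<omega> \<in> space M \<Longrightarrow> \<xi> \<omega> \<le> R \<omega>"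
    and tail_R: "\<And>y. x\<^sub>0 \<le> y \<Longrightarrow> prob {\<omega>\<in>space M. y < R \<omega>} \<le> L * y powr (-\<alpha>)"
    and pos: "0 < x\<^sub>0" "0 < a" "0 < b"
    and \<delta>: "0 < \<delta>" "\<delta> \<le> 1/2"
    and a: "L * (1 - \<delta>) powr (-\<alpha>) \<le> (1 - \<delta>) * (1 + \<delta>) powr (-2*\<alpha>) * (a\<^sup>2 / 2)"
    and b: "48 * C + \<delta> powr (-2*\<alpha>) * C + \<delta> powr (-\<alpha>) * C / 2 \<le> \<delta> * (1 + \<delta>) powr (-2*\<alpha>) * (b / 2)"
    and b_large: "(2 * x\<^sub>0) powr \<alpha> \<le> b"
  shows "1 - upper_barrier \<alpha> a b x \<le>
    expectation (\<lambda>\<omega>. indicator {..x} (R \<omega>) * ((1 + (1 - upper_barrier \<alpha> a b (x - \<xi> \<omega>))\<^sup>2) / 2))"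
    (is "1 - ?h x \<le> expectation ?I")
proof -
  have I01: "0 \<le> ?I \<omega>" "?I \<omega> \<le> 1" for \<omega>
  proof -
    have "\<bar>1 - ?h (x - \<xi> \<omega>)\<bar> \<le> 1" using upper_barrier_bounds[of a b \<alpha> "x - \<xi> \<omega>"] pos by auto
    then have "(1 - ?h (x - \<xi> \<omega>))\<^sup>2 \<le> 1" by (simp add: abs_square_le_1)
    then show "0 \<le> ?I \<omega>" "?I \<omega> \<le> 1" by (auto simp: indicator_def)
  qed
  have intI: "integrable M ?I"
    using I01 by (intro integrable_const_bound[where B=1]) auto
  show ?thesis
  proof (cases "?h x < 1")
    case False
    then have "1 - ?h x \<le> 0" by simp
    also have "0 \<le> expectation ?I" using I01 by (intro Bochner_Integration.integral_nonneg) auto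
    finally show ?thesis .
  next
    case True
    define g where "g y = a * y powr (-\<alpha>/2) + b * y powr (-\<alpha>)" for y
    define q where "q = x powr (-\<alpha>)"
    have x0: "0 < x" and hx: "?h x = g x" and g1: "g x < 1"
      using True by (auto simp: upper_barrier_def g_def split: if_splits)
    have h_le_g: "?h y \<le> g y" if "0 < y" for y
      using that by (auto simp: upper_barrier_def g_def)
    have g_pos: "0 < g y" if "0 < y" for y
      using that pos by (auto simp: g_def intro!: add_pos_pos)
    have g_anti: "g z \<le> g y" if "0 < y" "y \<le> z" for y z
      unfolding g_def using that pos \<alpha> by (intro add_mono mult_left_mono powr_mono2') auto
    have q: "0 < q" using x0 by (simp add: q_def)
    have psq: "(x powr (-\<alpha>/2))\<^sup>2 = q"
      using x0 by (simp add: q_def power2_eq_square flip: powr_add)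
    have gb: "b * q \<le> g x" using pos by (auto simp: g_def q_def)
    have "a * x powr (-\<alpha>/2) \<le> g x" using pos by (auto simp: g_def)
    then have "(a * x powr (-\<alpha>/2))\<^sup>2 \<le> (g x)\<^sup>2" using pos by (intro power_mono) auto
    then have ga: "a\<^sup>2 * q \<le> (g x)\<^sup>2" unfolding power_mult_distrib psq .
    \<comment> \<open>Where the barrier is below 1, so is its \<open>b\<close> term. With
      \<open>b_large\<close> this forces \<open>2 * x\<^sub>0 < x\<close>, so that even
      \<open>(1 - \<delta>) * x\<close> lies in the range of \<open>tail_R\<close>.\<close>
    have "b * q < 1" using gb g1 by simp
    then have "b < x powr \<alpha>" using x0 by (simp add: q_def powr_minus field_simps)
    then have "(2 * x\<^sub>0) powr \<alpha> < x powr \<alpha>" using b_large by simp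
    then have x_large: "2 * x\<^sub>0 < x"
      using powr_mono2[of \<alpha> x "2 * x\<^sub>0"] x0 \<alpha> by (auto simp: not_less[symmetric])
    \<comment> \<open>Moving from x to (1 + \<delta>) * x lowers \<open>g\<close> by at most the
      factor \<open>(1 + \<delta>) powr (-\<alpha>)\<close>, hence its square by at most
      \<open>e\<close>. So \<open>D\<close> is the gain from branching that is guaranteed for all
      steps of size at most \<delta> * x.\<close>
    define e where "e = (1 + \<delta>) powr (-2*\<alpha>)"
    have e: "0 < e" "e \<le> 1" using \<delta> \<alpha> by (auto simp: e_def powr_minus field_simps ge_one_powr_ge_zero)
    define D where "D = e * ((g x)\<^sup>2 / 2)"
    \<comment> \<open>This is minus the derivative of \<open>g\<close> at x.\<close>
    define c where "c = \<alpha>/2 * (a * x powr (-\<alpha>/2)) / x + \<alpha> * (b * x powr (-\<alpha>)) / x"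
    define S where "S = {\<omega>\<in>space M. \<delta> * x < \<bar>\<xi> \<omega>\<bar>}"
    define U where "U = {\<omega>\<in>space M. (1 - \<delta>) * x < R \<omega>}"
    define Q where "Q \<omega> = c * (\<xi> \<omega> * indicator {-(\<delta>*x)..\<delta>*x} (\<xi> \<omega>))
            + 48 * g x / x\<^sup>2 * ((\<xi> \<omega>)\<^sup>2 * indicator {-(\<delta>*x)..\<delta>*x} (\<xi> \<omega>))" for \<omega>
    \<comment> \<open>A majorant of \<psi> (h (x - \<xi>)) as long as \<xi> is at most (1 -
      \<delta>) * x. For small steps it is the Taylor bound minus the gain \<open>D\<close>. On
      \<open>S\<close> the part \<open>Q\<close> vanishes and \<open>D\<close> is given back, which
      leaves the crude \<open>g x + \<delta> powr (-\<alpha>) * g x\<close>; it costs little because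
      it is weighted by the probability of \<open>S\<close>.\<close>
    define J where "J \<omega> = g x + Q \<omega> - D + (D + \<delta> powr (-\<alpha>) * g x) * indicator S \<omega>" for \<omega>
    have inner: "indicator {-(\<delta>*x)..\<delta>*x} (\<xi> \<omega>) = (1::real)" "indicator S \<omega> = (0::real)"
      if "\<bar>\<xi> \<omega>\<bar> \<le> \<delta> * x" for \<omega>
      using that by (auto simp: S_def indicator_def abs_le_iff)
    have outer: "indicator {-(\<delta>*x)..\<delta>*x} (\<xi> \<omega>) = (0::real)" "indicator S \<omega> = (1::real)"
      if "\<not> \<bar>\<xi> \<omega>\<bar> \<le> \<delta> * x" "\<omega> \<in> space M" for \<omega>
      using that by (auto simp: S_def indicator_def abs_if split: if_splits)
    have [measurable]: "S \<in> sets M" "U \<in> sets M" unfolding S_def U_def by measurable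
    have intSU: "integrable M (indicator S :: 'w \<Rightarrow> real)" "integrable M (indicator U :: 'w \<Rightarrow> real)"
      by (simp_all add: integrable_indicator_iff emeasure_eq_measure)
    have intQ: "integrable M Q" unfolding Q_def
      using integrable_truncated by (intro Bochner_Integration.integrable_add integrable_mult_right)
    have D0: "0 \<le> D" using e by (auto simp: D_def)
    have "D \<le> 1 * ((g x)\<^sup>2 / 2)" unfolding D_def using e by (intro mult_right_mono) auto
    also have "\<dots> \<le> g x / 2" using g1 g_pos[OF x0] by (auto simp: power2_eq_square mult_left_le)
    finally have Dg: "D \<le> g x / 2" .
    have near: "1 - (1 + (1 - ?h (x - z))\<^sup>2) / 2 \<le> g x + c * z + 48 * g x / x\<^sup>2 * z\<^sup>2 - D"
      if z: "\<bar>z\<bar> \<le> \<delta> * x" for z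
    proof -
      have z2: "\<bar>z\<bar> \<le> x / 2" using z mult_right_mono[OF \<delta>(2), of x] x0 by linarith
      then have y: "0 < x - z" "x - z \<le> (1 + \<delta>) * x" using x0 z by (auto simp: algebra_simps)
      have "\<bar>(x - z) powr (-(\<alpha>/2)) - x powr (-(\<alpha>/2)) - \<alpha>/2 * x powr (-(\<alpha>/2)) / x * z\<bar>
           \<le> 48 * x powr (-(\<alpha>/2)) / x\<^sup>2 * z\<^sup>2"
        using \<alpha> x0 z2 by (intro powr_shift_quadratic) auto
      then have 1: "(x - z) powr (-\<alpha>/2) \<le> x powr (-\<alpha>/2) + \<alpha>/2 * x powr (-\<alpha>/2) / x * z + 48 * x powr (-\<alpha>/2) / x\<^sup>2 * z\<^sup>2"
        by (simp add: abs_le_iff)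
      have "\<bar>(x - z) powr (-\<alpha>) - x powr (-\<alpha>) - \<alpha> * x powr (-\<alpha>) / x * z\<bar>
           \<le> 48 * x powr (-\<alpha>) / x\<^sup>2 * z\<^sup>2"
        using \<alpha> x0 z2 by (intro powr_shift_quadratic) auto
      then have 2: "(x - z) powr (-\<alpha>) \<le> x powr (-\<alpha>) + \<alpha> * x powr (-\<alpha>) / x * z + 48 * x powr (-\<alpha>) / x\<^sup>2 * z\<^sup>2"
        by (simp add: abs_le_iff)
      have "?h (x - z) \<le> g (x - z)" using y by (intro h_le_g)
      also have "\<dots> \<le> a * (x powr (-\<alpha>/2) + \<alpha>/2 * x powr (-\<alpha>/2) / x * z + 48 * x powr (-\<alpha>/2) / x\<^sup>2 * z\<^sup>2)
           + b * (x powr (-\<alpha>) + \<alpha> * x powr (-\<alpha>) / x * z + 48 * x powr (-\<alpha>) / x\<^sup>2 * z\<^sup>2)"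
        unfolding g_def using pos 1 2 by (intro add_mono mult_left_mono) auto
      also have "\<dots> = g x + c * z + 48 * g x / x\<^sup>2 * z\<^sup>2"
        unfolding g_def c_def by (simp add: algebra_simps add_divide_distrib)
      finally have A: "?h (x - z) \<le> g x + c * z + 48 * g x / x\<^sup>2 * z\<^sup>2" .
      have "(1 + \<delta>) powr (-\<alpha>) * g x \<le> g ((1 + \<delta>) * x)"
      proof -
        have "(1 + \<delta>) powr (-\<alpha>) \<le> (1 + \<delta>) powr (-\<alpha>/2)" using \<delta> \<alpha> by (intro powr_mono) auto
        then have "(1 + \<delta>) powr (-\<alpha>) * x powr (-\<alpha>/2) \<le> (1 + \<delta>) powr (-\<alpha>/2) * x powr (-\<alpha>/2)"
          by (intro mult_right_mono) auto
        then have "a * ((1 + \<delta>) powr (-\<alpha>) * x powr (-\<alpha>/2)) \<le> a * ((1 + \<delta>) powr (-\<alpha>/2) * x powr (-\<alpha>/2))"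
          using pos by (intro mult_left_mono) auto
        then show ?thesis using \<delta> x0
          unfolding g_def by (simp add: powr_mult distrib_left mult.left_commute)
      qed
      also have "\<dots> \<le> g (x - z)" using y by (intro g_anti) auto
      finally have "(1 + \<delta>) powr (-\<alpha>) * g x \<le> g (x - z)" .
      moreover have "(1 + \<delta>) powr (-\<alpha>) * g x \<le> 1 * 1"
        using \<delta> \<alpha> g1 g_pos[OF x0] by (intro mult_mono) (auto simp: powr_minus field_simps ge_one_powr_ge_zero)
      ultimately have "(1 + \<delta>) powr (-\<alpha>) * g x \<le> ?h (x - z)"
        using y by (auto simp: upper_barrier_def g_def)
      then have "((1 + \<delta>) powr (-\<alpha>) * g x)\<^sup>2 \<le> (?h (x - z))\<^sup>2"
        using g_pos[OF x0] by (intro power_mono) auto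
      moreover have "((1 + \<delta>) powr (-\<alpha>))\<^sup>2 = e"
        using \<delta> by (simp add: e_def power2_eq_square flip: powr_add)
      ultimately have B: "D \<le> (?h (x - z))\<^sup>2 / 2"
        by (simp add: D_def power_mult_distrib)
      have "1 - (1 + (1 - ?h (x - z))\<^sup>2) / 2 = ?h (x - z) - (?h (x - z))\<^sup>2 / 2"
        by (simp add: power2_eq_square field_simps)
      then show ?thesis using A B by linarith
    qed
    have g_scale: "g (\<delta> * x) \<le> \<delta> powr (-\<alpha>) * g x"
    proof -
      have "\<delta> powr (-\<alpha>/2) \<le> \<delta> powr (-\<alpha>)" using \<delta> \<alpha> by (intro powr_mono') auto
      then have "\<delta> powr (-\<alpha>/2) * x powr (-\<alpha>/2) \<le> \<delta> powr (-\<alpha>) * x powr (-\<alpha>/2)"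
        by (intro mult_right_mono) auto
      then have "a * (\<delta> powr (-\<alpha>/2) * x powr (-\<alpha>/2)) \<le> a * (\<delta> powr (-\<alpha>) * x powr (-\<alpha>/2))"
        using pos by (intro mult_left_mono) auto
      then show ?thesis using \<delta> x0
        unfolding g_def by (simp add: powr_mult distrib_left mult.left_commute)
    qed
    have J_ge: "1 - (1 + (1 - ?h (x - \<xi> \<omega>))\<^sup>2) / 2 \<le> J \<omega>" if "\<omega> \<in> space M" "\<xi> \<omega> \<le> (1 - \<delta>) * x" for \<omega>
    proof (cases "\<bar>\<xi> \<omega>\<bar> \<le> \<delta> * x")
      case True
      then show ?thesis using near[OF True] inner[OF True] by (simp add: J_def Q_def)
    next
      case False
      have "?h (x - \<xi> \<omega>) \<le> g (\<delta> * x) \<or> ?h (x - \<xi> \<omega>) \<le> g x"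
      proof (cases "\<xi> \<omega> \<le> 0")
        case True
        then have "?h (x - \<xi> \<omega>) \<le> g (x - \<xi> \<omega>)" using x0 by (intro h_le_g) auto
        also have "\<dots> \<le> g x" using x0 True by (intro g_anti) auto
        finally show ?thesis ..
      next
        case F: False
        have "\<delta> * x \<le> x - \<xi> \<omega>" using that by (simp add: algebra_simps)
        then have "0 < x - \<xi> \<omega>" using mult_pos_pos[OF \<delta>(1) x0] by linarith
        then have "?h (x - \<xi> \<omega>) \<le> g (x - \<xi> \<omega>)" by (intro h_le_g) auto
        also have "\<dots> \<le> g (\<delta> * x)" using \<open>\<delta> * x \<le> x - \<xi> \<omega>\<close> \<delta> x0 by (intro g_anti) auto
        finally show ?thesis ..
      qed
      moreover have nn: "0 \<le> \<delta> powr (-\<alpha>) * g x" using g_pos[OF x0] by simp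
      ultimately have "?h (x - \<xi> \<omega>) \<le> g x + \<delta> powr (-\<alpha>) * g x"
        using g_scale less_imp_le[OF g_pos[OF x0]] nn by arith
      moreover have "1 - (1 + (1 - ?h (x - \<xi> \<omega>))\<^sup>2) / 2 \<le> ?h (x - \<xi> \<omega>)"
        by (simp add: power2_eq_square field_simps)
      moreover have "J \<omega> = g x + \<delta> powr (-\<alpha>) * g x"
        using outer[OF False that(1)] by (simp add: J_def Q_def)
      ultimately show ?thesis by linarith
    qed
    have J_nonneg: "0 \<le> J \<omega>" if "\<omega> \<in> space M" for \<omega>
    proof (cases "\<bar>\<xi> \<omega>\<bar> \<le> \<delta> * x")
      case True
      moreover have "\<delta> * x \<le> (1 - \<delta>) * x" using \<delta> x0 by (intro mult_right_mono) auto
      ultimately have J: "1 - (1 + (1 - ?h (x - \<xi> \<omega>))\<^sup>2) / 2 \<le> J \<omega>" using that by (intro J_ge) auto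
      have "(1 - ?h (x - \<xi> \<omega>))\<^sup>2 \<le> 1"
        using upper_barrier_bounds[of a b \<alpha> "x - \<xi> \<omega>"] pos by (auto simp: abs_square_le_1)
      then have "0 \<le> 1 - (1 + (1 - ?h (x - \<xi> \<omega>))\<^sup>2) / 2" by simp
      then show ?thesis using J by (rule order.trans)
    next
      case False
      then show ?thesis using outer[OF False that] g_pos[OF x0] by (simp add: J_def Q_def)
    qed
    \<comment> \<open>The whole event R > (1 - \<delta>) * x is charged the full value 1, not only R
      > x. Since \<xi> is at most \<open>R\<close>, this also disposes of the steps that end within
      \<delta> * x of x, where the barrier at \<open>x - \<xi>\<close> is not small.\<close>
    have "1 - ?I \<omega> \<le> indicator U \<omega> + J \<omega>" if w: "\<omega> \<in> space M" for \<omega>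
    proof (cases "(1 - \<delta>) * x < R \<omega>")
      case True
      then have U1: "indicator U \<omega> = (1::real)" using w by (simp add: U_def)
      have "1 - r \<le> 1 + j" if "0 \<le> r" "0 \<le> j" for r j :: real using that by simp
      from this[OF I01(1) J_nonneg[OF w]] show ?thesis unfolding U1 .
    next
      case False
      have "(1 - \<delta>) * x \<le> 1 * x" using \<delta> x0 by (intro mult_right_mono) auto
      then have "R \<omega> \<le> x" using False by simp
      then show ?thesis using False J_ge[OF w] step_le[OF w] by (auto simp: U_def)
    qed
    then have "expectation (\<lambda>\<omega>. 1 - ?I \<omega>) \<le> expectation (\<lambda>\<omega>. indicator U \<omega> + J \<omega>)"
      using intI intQ intSU unfolding J_def
      by (intro integral_mono) (auto intro!: Bochner_Integration.integrable_add Bochner_Integration.integrable_diff)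
    also have "\<dots> = prob U + (g x + expectation Q - D + (D + \<delta> powr (-\<alpha>) * g x) * prob S)"
      using intQ intSU unfolding J_def by (simp add: prob_space)
    also have "\<dots> \<le> L * (1 - \<delta>) powr (-\<alpha>) * q + (g x + 48 * g x * C * q - D
        + (g x / 2 + \<delta> powr (-\<alpha>) * g x) * (C * \<delta> powr (-\<alpha>) * q))"
    proof (intro add_mono diff_mono mult_mono order.refl)
      have "(1 - \<delta>) * x \<ge> 1/2 * x" using \<delta> x0 by (intro mult_right_mono) auto
      then have "prob U \<le> L * ((1 - \<delta>) * x) powr (-\<alpha>)"
        unfolding U_def using x_large by (intro tail_R) auto
      then show "prob U \<le> L * (1 - \<delta>) powr (-\<alpha>) * q"
        using \<delta> x0 by (simp add: powr_mult q_def)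
      show "expectation Q \<le> 48 * g x * C * q"
        using truncated_quadratic_expectation[of x \<delta> c "48 * g x"] x0 \<delta> g_pos[OF x0]
        unfolding Q_def q_def by (simp add: abs_le_iff)
      show "prob S \<le> C * \<delta> powr (-\<alpha>) * q"
        using tail[of "\<delta> * x"] \<delta> x0 unfolding S_def q_def by (simp add: powr_mult)
    qed (use Dg g_pos[OF x0] D0 in auto)
    also have "\<dots> = g x + L * (1 - \<delta>) powr (-\<alpha>) * q
        + (48 * C + \<delta> powr (-\<alpha>) * \<delta> powr (-\<alpha>) * C + \<delta> powr (-\<alpha>) * C / 2) * (g x * q) - D"
      by (simp add: algebra_simps)
    also have "\<delta> powr (-\<alpha>) * \<delta> powr (-\<alpha>) = \<delta> powr (-2*\<alpha>)"
      by (simp flip: powr_add)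
    also have "g x + L * (1 - \<delta>) powr (-\<alpha>) * q
        + (48 * C + \<delta> powr (-2*\<alpha>) * C + \<delta> powr (-\<alpha>) * C / 2) * (g x * q) - D
      \<le> g x + (1 - \<delta>) * e * (a\<^sup>2 / 2) * q + \<delta> * e * (b / 2) * (g x * q) - D"
      using a b q g_pos[OF x0] unfolding e_def by (intro add_mono diff_mono mult_right_mono) auto
    \<comment> \<open>The gain \<open>D\<close> is spent in the shares 1 - \<delta> and \<delta>.
      The first, through \<open>a\<^sup>2 * q \<le> (g x)\<^sup>2\<close>, pays for the large jumps;
      the second, through \<open>b * q \<le> g x\<close>, pays for all errors of order
      \<open>g x * q\<close>.\<close>
    also have "\<dots> \<le> g x"
    proof -
      have "(1 - \<delta>) * e / 2 * (a\<^sup>2 * q) \<le> (1 - \<delta>) * e / 2 * (g x)\<^sup>2"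
        using ga e \<delta> by (intro mult_left_mono) auto
      moreover have "\<delta> * e / 2 * (b * q * g x) \<le> \<delta> * e / 2 * (g x * g x)"
        using gb e \<delta> g_pos[OF x0] by (intro mult_left_mono mult_right_mono) auto
      moreover have "D = (1 - \<delta>) * e / 2 * (g x)\<^sup>2 + \<delta> * e / 2 * (g x * g x)"
        by (simp add: D_def power2_eq_square diff_divide_distrib add_divide_distrib left_diff_distrib)
      moreover have "(1 - \<delta>) * e * (a\<^sup>2 / 2) * q = (1 - \<delta>) * e / 2 * (a\<^sup>2 * q)"
        "\<delta> * e * (b / 2) * (g x * q) = \<delta> * e / 2 * (b * q * g x)" by simp_all
      ultimately show ?thesis by linarith
    qed
    finally have "expectation (\<lambda>\<omega>. 1 - ?I \<omega>) \<le> g x" .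
    then show ?thesis using intI hx by (simp add: prob_space)
  qed
qed


text \<open>Here \<open>b\<close> acts differently from the upper case: the barrier is positive only
  where \<open>x powr (-\<alpha>/2) < a / b\<close>, so a large \<open>b\<close> restricts the claim
  to large x. There every error is at most \<open>a / b\<close> times a multiple of
  \<open>x powr (-\<alpha>)\<close> and fits into the gap between \<open>L\<close> and
  \<open>a\<^sup>2 / 2\<close>, slightly enlarged by \<delta>.\<close>

lemma subsolution:
  fixes R :: "'w \<Rightarrow> real"
  assumes R [measurable]: "R \<in> borel_measurable M"
    and tail_R: "\<And>y. x\<^sub>0 \<le> y \<Longrightarrow> L * y powr (-\<alpha>) \<le> prob {\<omega>\<in>space M. y < R \<omega>}"
    and pos: "0 < x\<^sub>0" "0 < a" "0 < b" "0 \<le> L"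
    and \<delta>: "0 < \<delta>" "\<delta> \<le> 1/2"
    and b: "a\<^sup>2 * (1 - \<delta>) powr (-\<alpha>) / 2
        + a\<^sup>2 / b * (2 * L + \<delta> powr (-\<alpha>) * C + 96 * C) \<le> L"
    and b_large: "a * x\<^sub>0 powr (\<alpha>/2) \<le> b" "2 * a\<^sup>2 \<le> b"
  shows "expectation (\<lambda>\<omega>. indicator {..x} (R \<omega>) * ((1 + (1 - lower_barrier \<alpha> a b (x - \<xi> \<omega>))\<^sup>2) / 2))
    \<le> 1 - lower_barrier \<alpha> a b x"
    (is "expectation ?I \<le> 1 - ?h x")
proof -
  have h01: "0 \<le> ?h y" "?h y \<le> 1" for y
    using lower_barrier_bounds[of a b \<alpha> y] b_large pos by auto
  have I01: "0 \<le> ?I \<omega>" "?I \<omega> \<le> 1" for \<omega>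
  proof -
    have "\<bar>1 - ?h (x - \<xi> \<omega>)\<bar> \<le> 1" using h01[of "x - \<xi> \<omega>"] by auto
    then have "(1 - ?h (x - \<xi> \<omega>))\<^sup>2 \<le> 1" by (simp add: abs_square_le_1)
    then show "0 \<le> ?I \<omega>" "?I \<omega> \<le> 1" by (auto simp: indicator_def)
  qed
  have intI: "integrable M ?I"
    using I01 by (intro integrable_const_bound[where B=1]) auto
  show ?thesis
  proof (cases "0 < ?h x")
    case False
    then have "?h x = 0" using h01[of x] by simp
    moreover have "expectation ?I \<le> expectation (\<lambda>_. 1)"
      using I01 intI by (intro integral_mono) auto
    ultimately show ?thesis by (simp add: prob_space)
  next
    case True
    define f where "f y = a * y powr (-\<alpha>/2) - b * y powr (-\<alpha>)" for y
    define p where "p = x powr (-\<alpha>/2)"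
    define q where "q = x powr (-\<alpha>)"
    have x0: "0 < x" and hx: "?h x = f x" and f0: "0 < f x"
      using True by (auto simp: lower_barrier_def f_def split: if_splits)
    have f_le_h: "f y \<le> ?h y" if "0 < y" for y
      using that by (auto simp: lower_barrier_def f_def)
    have h_le: "?h y \<le> a * y powr (-\<alpha>/2)" if "0 < y" for y
      using that pos by (auto simp: lower_barrier_def)
    have p: "0 < p" and q: "0 < q" using x0 by (auto simp: p_def q_def)
    have psq: "p * p = q"
      using x0 by (simp add: p_def q_def flip: powr_add)
    have "b * (p * p) < a * p" using f0 unfolding psq by (simp add: f_def p_def q_def)
    then have pb: "p < a / b" using p pos by (simp add: field_simps)
    then have "b / a < x powr (\<alpha>/2)" using x0 pos by (simp add: p_def powr_minus field_simps)
    moreover have "x\<^sub>0 powr (\<alpha>/2) \<le> b / a" using b_large pos by (simp add: field_simps)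
    ultimately have "x\<^sub>0 powr (\<alpha>/2) < x powr (\<alpha>/2)" by simp
    then have x_large: "x\<^sub>0 < x"
      using powr_mono2[of "\<alpha>/2" x x\<^sub>0] x0 \<alpha> by (auto simp: not_less[symmetric])
    have ap: "2 * a * p \<le> 1"
    proof -
      have "2 * a * p \<le> 2 * a * (a / b)" using pb pos by (intro mult_left_mono) auto
      also have "\<dots> \<le> 1" using b_large pos by (simp add: field_simps power2_eq_square)
      finally show ?thesis .
    qed
    have bq: "b * q \<le> a * p" using \<open>b * (p * p) < a * p\<close> psq by simp
    define c where "c = \<alpha>/2 * (a * p) / x - \<alpha> * (b * q) / x"
    define E where "E = a\<^sup>2 * (1 - \<delta>) powr (-\<alpha>) / 2 * q"
    define S where "S = {\<omega>\<in>space M. \<delta> * x < \<bar>\<xi> \<omega>\<bar>}"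
    define U where "U = {\<omega>\<in>space M. x < R \<omega>}"
    define Q where "Q \<omega> = c * (\<xi> \<omega> * indicator {-(\<delta>*x)..\<delta>*x} (\<xi> \<omega>))
            + (-(96 * a * p)) / x\<^sup>2 * ((\<xi> \<omega>)\<^sup>2 * indicator {-(\<delta>*x)..\<delta>*x} (\<xi> \<omega>))" for \<omega>
    \<comment> \<open>A minorant of \<open>1 - ?I\<close>. A large jump of \<open>R\<close> may
      occur together with a small \<xi>; the weight \<open>1 - 2 * a * p\<close> on \<open>U\<close>
      leaves room for the small-step part, which \<open>near_le\<close> bounds by
      \<open>2 * a * p\<close>, so the sum never exceeds 1. On \<open>S\<close> the main term is
      removed and only -\<open>E\<close> remains.\<close>
    define J where "J \<omega> = f x + Q \<omega> - E - f x * indicator S \<omega> + (1 - 2 * a * p) * indicator U \<omega>" for \<omega>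
    have inner: "indicator {-(\<delta>*x)..\<delta>*x} (\<xi> \<omega>) = (1::real)" "indicator S \<omega> = (0::real)"
      if "\<bar>\<xi> \<omega>\<bar> \<le> \<delta> * x" for \<omega>
      using that by (auto simp: S_def indicator_def abs_le_iff)
    have outer: "indicator {-(\<delta>*x)..\<delta>*x} (\<xi> \<omega>) = (0::real)" "indicator S \<omega> = (1::real)"
      if "\<not> \<bar>\<xi> \<omega>\<bar> \<le> \<delta> * x" "\<omega> \<in> space M" for \<omega>
      using that by (auto simp: S_def indicator_def abs_if split: if_splits)
    have [measurable]: "S \<in> sets M" "U \<in> sets M" unfolding S_def U_def by measurable
    have intSU: "integrable M (indicator S :: 'w \<Rightarrow> real)" "integrable M (indicator U :: 'w \<Rightarrow> real)"
      by (simp_all add: integrable_indicator_iff emeasure_eq_measure)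
    have intQ: "integrable M Q" unfolding Q_def
      using integrable_truncated by (intro Bochner_Integration.integrable_add integrable_mult_right)
    have E0: "0 \<le> E" using q by (auto simp: E_def)
    have psi: "1 - (1 + (1 - w)\<^sup>2) / 2 = w - w\<^sup>2 / 2" for w :: real
      by (simp add: power2_eq_square field_simps)
    have near: "f x + c * z + (-(96 * a * p)) / x\<^sup>2 * z\<^sup>2 - E \<le> ?h (x - z) - (?h (x - z))\<^sup>2 / 2"
       and near_le: "f x + c * z + (-(96 * a * p)) / x\<^sup>2 * z\<^sup>2 - E \<le> 2 * a * p"
      if z: "\<bar>z\<bar> \<le> \<delta> * x" for z
    proof -
      have z2: "\<bar>z\<bar> \<le> x / 2" using z mult_right_mono[OF \<delta>(2), of x] x0 by linarith
      then have y: "0 < x - z" "(1 - \<delta>) * x \<le> x - z" using x0 z by (auto simp: algebra_simps)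
      have "\<bar>(x - z) powr (-(\<alpha>/2)) - x powr (-(\<alpha>/2)) - \<alpha>/2 * x powr (-(\<alpha>/2)) / x * z\<bar>
           \<le> 48 * x powr (-(\<alpha>/2)) / x\<^sup>2 * z\<^sup>2"
        using \<alpha> x0 z2 by (intro powr_shift_quadratic) auto
      then have 1: "p + \<alpha>/2 * p / x * z - 48 * p / x\<^sup>2 * z\<^sup>2 \<le> (x - z) powr (-\<alpha>/2)"
        by (simp add: p_def abs_le_iff)
      have "\<bar>(x - z) powr (-\<alpha>) - x powr (-\<alpha>) - \<alpha> * x powr (-\<alpha>) / x * z\<bar>
           \<le> 48 * x powr (-\<alpha>) / x\<^sup>2 * z\<^sup>2"
        using \<alpha> x0 z2 by (intro powr_shift_quadratic) auto
      then have 2: "(x - z) powr (-\<alpha>) \<le> q + \<alpha> * q / x * z + 48 * q / x\<^sup>2 * z\<^sup>2"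
        by (simp add: q_def abs_le_iff)
      \<comment> \<open>The remainders of the two powers add up, because the subtracted power has to
        be bounded from above. Positivity of \<open>f x\<close> gives
        \<open>b * q \<le> a * p\<close>, which turns 48 on both terms into 96 on the larger
        one.\<close>
      have "f x + c * z + (-(96 * a * p)) / x\<^sup>2 * z\<^sup>2 \<le> f x + c * z - 48 * (a * p + b * q) / x\<^sup>2 * z\<^sup>2"
      proof -
        have "48 * (a * p + b * q) / x\<^sup>2 * z\<^sup>2 \<le> 96 * a * p / x\<^sup>2 * z\<^sup>2"
          using bq by (intro mult_right_mono divide_right_mono) auto
        then show ?thesis by simp
      qed
      also have "\<dots> = a * (p + \<alpha>/2 * p / x * z - 48 * p / x\<^sup>2 * z\<^sup>2)
           - b * (q + \<alpha> * q / x * z + 48 * q / x\<^sup>2 * z\<^sup>2)"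
        unfolding f_def c_def p_def[symmetric] q_def[symmetric] by (simp add: algebra_simps add_divide_distrib)
      also have "\<dots> \<le> f (x - z)"
        unfolding f_def using pos 1 2 by (intro diff_mono mult_left_mono) auto
      also have "\<dots> \<le> ?h (x - z)" using y by (intro f_le_h)
      finally have A: "f x + c * z + (-(96 * a * p)) / x\<^sup>2 * z\<^sup>2 \<le> ?h (x - z)" .
      have "?h (x - z) \<le> a * (x - z) powr (-\<alpha>/2)" using y by (intro h_le)
      also have "\<dots> \<le> a * ((1 - \<delta>) * x) powr (-\<alpha>/2)"
        using y \<delta> x0 pos \<alpha> by (intro mult_left_mono powr_mono2') auto
      also have "\<dots> = a * (1 - \<delta>) powr (-\<alpha>/2) * p" using \<delta> x0 by (simp add: powr_mult p_def)
      finally have hle: "?h (x - z) \<le> a * (1 - \<delta>) powr (-\<alpha>/2) * p" .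
      then have "(?h (x - z))\<^sup>2 \<le> (a * (1 - \<delta>) powr (-\<alpha>/2) * p)\<^sup>2" using h01 by (intro power_mono)
      also have "\<dots> = a\<^sup>2 * ((1 - \<delta>) powr (-\<alpha>/2) * (1 - \<delta>) powr (-\<alpha>/2)) * (p * p)"
        by (simp add: power2_eq_square)
      also have "\<dots> = 2 * E" unfolding psq E_def by (simp flip: powr_add)
      finally have B: "(?h (x - z))\<^sup>2 / 2 \<le> E" by simp
      show "f x + c * z + (-(96 * a * p)) / x\<^sup>2 * z\<^sup>2 - E \<le> ?h (x - z) - (?h (x - z))\<^sup>2 / 2"
        using A B by linarith
      have "(1 - \<delta>) powr (-\<alpha>/2) \<le> (1/2) powr (-\<alpha>/2)"
        using \<delta> \<alpha> by (intro powr_mono2') auto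
      also have "\<dots> \<le> (1/2) powr (-1)" using \<alpha> by (intro powr_mono') auto
      finally have "(1 - \<delta>) powr (-\<alpha>/2) \<le> 2" by (simp add: powr_minus)
      then have "a * (1 - \<delta>) powr (-\<alpha>/2) * p \<le> a * 2 * p" using pos p by (intro mult_mono) auto
      then show "f x + c * z + (-(96 * a * p)) / x\<^sup>2 * z\<^sup>2 - E \<le> 2 * a * p"
        using hle A E0 by linarith
    qed
    have "J \<omega> \<le> 1 - ?I \<omega>" if w: "\<omega> \<in> space M" for \<omega>
    proof (cases "\<bar>\<xi> \<omega>\<bar> \<le> \<delta> * x")
      case True
      have J: "J \<omega> = f x + c * \<xi> \<omega> + (-(96 * a * p)) / x\<^sup>2 * (\<xi> \<omega>)\<^sup>2 - E + (1 - 2 * a * p) * indicator U \<omega>"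
        using inner[OF True] by (simp add: J_def Q_def)
      show ?thesis
      proof (cases "x < R \<omega>")
        case True
        then show ?thesis using near_le[OF \<open>\<bar>\<xi> \<omega>\<bar> \<le> \<delta> * x\<close>] w J by (simp add: U_def)
      next
        case F: False
        then show ?thesis using near[OF True] psi[of "?h (x - \<xi> \<omega>)"] w J by (simp add: U_def)
      qed
    next
      case False
      have J: "J \<omega> = (1 - 2 * a * p) * indicator U \<omega> - E"
        using outer[OF False w] by (simp add: J_def Q_def)
      show ?thesis
      proof (cases "x < R \<omega>")
        case True
        then have "?I \<omega> = 0" "J \<omega> = 1 - 2 * a * p - E" using J w by (auto simp: U_def)
        moreover have "0 \<le> 2 * a * p" using pos p by simp
        ultimately show ?thesis using E0 by linarith
      next
        case F: False
        then have "J \<omega> = - E" using J F by (simp add: U_def)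
        then show ?thesis using E0 I01(2)[of \<omega>] by linarith
      qed
    qed
    then have "expectation J \<le> expectation (\<lambda>\<omega>. 1 - ?I \<omega>)"
      using intI intQ intSU unfolding J_def
      by (intro integral_mono) (auto intro!: Bochner_Integration.integrable_add Bochner_Integration.integrable_diff)
    moreover have "expectation J = f x + expectation Q - E - f x * prob S + (1 - 2 * a * p) * prob U"
      using intQ intSU unfolding J_def by (simp add: prob_space)
    moreover have "f x \<le> f x + expectation Q - E - f x * prob S + (1 - 2 * a * p) * prob U"
    proof -
      have 1: "- (96 * a * p * C * q) \<le> expectation Q"
        using truncated_quadratic_expectation[of x \<delta> c "- (96 * a * p)"] x0 \<delta> pos p
        unfolding Q_def q_def by (simp add: abs_le_iff)
      have "f x \<le> a * p" using pos by (simp add: f_def p_def)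
      moreover have "prob S \<le> C * \<delta> powr (-\<alpha>) * q"
        using tail[of "\<delta> * x"] \<delta> x0 unfolding S_def q_def by (simp add: powr_mult)
      ultimately have 2: "f x * prob S \<le> a * p * (C * \<delta> powr (-\<alpha>) * q)"
        using pos p by (intro mult_mono) auto
      have "L * q \<le> prob U" using tail_R[of x] x_large unfolding U_def q_def by simp
      then have 3: "(1 - 2 * a * p) * (L * q) \<le> (1 - 2 * a * p) * prob U"
        using ap by (intro mult_left_mono) auto
      have "p * (a * (2 * L + \<delta> powr (-\<alpha>) * C + 96 * C)) \<le> a / b * (a * (2 * L + \<delta> powr (-\<alpha>) * C + 96 * C))"
        using pb pos C_nonneg by (intro mult_right_mono) auto
      then have "a\<^sup>2 * (1 - \<delta>) powr (-\<alpha>) / 2 + p * (a * (2 * L + \<delta> powr (-\<alpha>) * C + 96 * C)) \<le> L"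
        using b by (simp add: power2_eq_square)
      then have "(a\<^sup>2 * (1 - \<delta>) powr (-\<alpha>) / 2 + p * (a * (2 * L + \<delta> powr (-\<alpha>) * C + 96 * C))) * q \<le> L * q"
        using q by (intro mult_right_mono) auto
      then show ?thesis using 1 2 3 unfolding E_def by (simp add: algebra_simps)
    qed
    ultimately show ?thesis using intI hx by (simp add: prob_space)
  qed
qed

end

section \<open>The recursion on the binary tree\<close>

(* The library predicate indep_var requires a common range type. *)
definition (in prob_space) indep_pair ::
    "'b measure \<Rightarrow> ('a \<Rightarrow> 'b) \<Rightarrow> 'c measure \<Rightarrow> ('a \<Rightarrow> 'c) \<Rightarrow> bool" where
  "indep_pair S Z T W \<longleftrightarrow> random_variable S Z \<and> random_variable T W \<and>
     (\<forall>A\<in>sets S. \<forall>B\<in>sets T. prob {\<omega>\<in>space M. Z \<omega> \<in> A \<and> W \<omega> \<in> B}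
        = prob {\<omega>\<in>space M. Z \<omega> \<in> A} * prob {\<omega>\<in>space M. W \<omega> \<in> B})"

lemma (in prob_space) indep_pairD:
  assumes "indep_pair S Z T W" "A \<in> sets S" "B \<in> sets T"
  shows "prob {\<omega>\<in>space M. Z \<omega> \<in> A \<and> W \<omega> \<in> B}
        = prob {\<omega>\<in>space M. Z \<omega> \<in> A} * prob {\<omega>\<in>space M. W \<omega> \<in> B}"
  using assms by (auto simp: indep_pair_def)

lemma (in prob_space) distr_indep_pair:
  assumes "indep_pair S Z T W"
  shows "distr M S Z \<Otimes>\<^sub>M distr M T W = distr M (S \<Otimes>\<^sub>M T) (\<lambda>\<omega>. (Z \<omega>, W \<omega>))"
proof -
  have [measurable]: "Z \<in> measurable M S" "W \<in> measurable M T"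
    using assms by (auto simp: indep_pair_def)
  interpret Zd: prob_space "distr M S Z" by (rule prob_space_distr) simp
  interpret Wd: prob_space "distr M T W" by (rule prob_space_distr) simp
  show ?thesis
  proof (rule pair_measure_eqI)
    fix A B assume A: "A \<in> sets (distr M S Z)" and B: "B \<in> sets (distr M T W)"
    have "emeasure (distr M (S \<Otimes>\<^sub>M T) (\<lambda>\<omega>. (Z \<omega>, W \<omega>))) (A \<times> B) = emeasure M {\<omega>\<in>space M. Z \<omega> \<in> A \<and> W \<omega> \<in> B}"
      using A B by (subst emeasure_distr) (auto intro!: arg_cong[where f="emeasure M"])
    moreover have "emeasure (distr M S Z) A = emeasure M {\<omega>\<in>space M. Z \<omega> \<in> A}"
      using A by (subst emeasure_distr) (auto intro!: arg_cong[where f="emeasure M"])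
    moreover have "emeasure (distr M T W) B = emeasure M {\<omega>\<in>space M. W \<omega> \<in> B}"
      using B by (subst emeasure_distr) (auto intro!: arg_cong[where f="emeasure M"])
    ultimately show "emeasure (distr M S Z) A * emeasure (distr M T W) B
        = emeasure (distr M (S \<Otimes>\<^sub>M T) (\<lambda>\<omega>. (Z \<omega>, W \<omega>))) (A \<times> B)"
      using assms A B by (simp add: indep_pair_def emeasure_eq_measure ennreal_mult)
  qed (use Zd.sigma_finite_measure_axioms Wd.sigma_finite_measure_axioms in auto)
qed

text \<open>Fubini for the product law, pulled back to the sample space: the inner integral runs
  over a second sample point with \<open>Z \<omega>\<close> frozen. It is used to freeze a lifetime
  while the motion is averaged.\<close>

lemma (in prob_space) nn_integral_indep_pair:
  assumes ind: "indep_pair S Z T W" and f: "f \<in> borel_measurable (S \<Otimes>\<^sub>M T)"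
  shows "(\<integral>\<^sup>+\<omega>. f (Z \<omega>, W \<omega>) \<partial>M) = (\<integral>\<^sup>+\<omega>. \<integral>\<^sup>+\<omega>'. f (Z \<omega>, W \<omega>') \<partial>M \<partial>M)"
proof -
  have [measurable]: "Z \<in> measurable M S" "W \<in> measurable M T"
    using ind by (auto simp: indep_pair_def)
  interpret Wd: prob_space "distr M T W" by (rule prob_space_distr) simp
  have f': "f \<in> borel_measurable (S \<Otimes>\<^sub>M distr M T W)"
    using f by (simp cong: measurable_cong_sets sets_pair_measure_cong)
  have f'': "f \<in> borel_measurable (distr M S Z \<Otimes>\<^sub>M distr M T W)"
    using f by (simp cong: measurable_cong_sets sets_pair_measure_cong)
  have "(\<integral>\<^sup>+\<omega>. f (Z \<omega>, W \<omega>) \<partial>M) = (\<integral>\<^sup>+p. f p \<partial>distr M (S \<Otimes>\<^sub>M T) (\<lambda>\<omega>. (Z \<omega>, W \<omega>)))"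
    using f by (subst nn_integral_distr) auto
  also have "\<dots> = (\<integral>\<^sup>+z. \<integral>\<^sup>+w. f (z, w) \<partial>distr M T W \<partial>distr M S Z)"
    unfolding distr_indep_pair[OF ind, symmetric] by (rule Wd.nn_integral_fst[OF f'', symmetric])
  also have "\<dots> = (\<integral>\<^sup>+\<omega>. \<integral>\<^sup>+w. f (Z \<omega>, w) \<partial>distr M T W \<partial>M)"
    using Wd.borel_measurable_nn_integral_fst[OF f'] by (intro nn_integral_distr) auto
  also have "\<dots> = (\<integral>\<^sup>+\<omega>. \<integral>\<^sup>+\<omega>'. f (Z \<omega>, W \<omega>') \<partial>M \<partial>M)"
  proof (rule nn_integral_cong)
    fix \<omega> assume "\<omega> \<in> space M"
    then have "Z \<omega> \<in> space S" by (rule measurable_space[rotated]) simp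
    then have "(\<lambda>w. f (Z \<omega>, w)) \<in> borel_measurable T" using f by measurable
    then show "(\<integral>\<^sup>+w. f (Z \<omega>, w) \<partial>distr M T W) = (\<integral>\<^sup>+\<omega>'. f (Z \<omega>, W \<omega>') \<partial>M)"
      by (intro nn_integral_distr) (simp_all cong: measurable_cong_sets)
  qed
  finally show ?thesis .
qed

lemma (in prob_space) nn_integral_indicator_of:
  assumes "{\<omega>\<in>space M. f \<omega> \<in> A} \<in> sets M"
  shows "(\<integral>\<^sup>+\<omega>. indicator A (f \<omega>) \<partial>M) = ennreal (prob {\<omega>\<in>space M. f \<omega> \<in> A})"
proof -
  have "(\<integral>\<^sup>+\<omega>. indicator A (f \<omega>) \<partial>M) = (\<integral>\<^sup>+\<omega>. indicator {\<omega>\<in>space M. f \<omega> \<in> A} \<omega> \<partial>M)"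
    by (intro nn_integral_cong) (auto simp: indicator_def)
  then show ?thesis using assms by (simp add: emeasure_eq_measure)
qed

lemma (in prob_space) prob_indep_pair:
  assumes ind: "indep_pair S Z T W" and A [measurable]: "A \<in> sets (S \<Otimes>\<^sub>M T)"
  shows "prob {\<omega>\<in>space M. (Z \<omega>, W \<omega>) \<in> A}
       = expectation (\<lambda>\<omega>. prob {\<omega>'\<in>space M. (Z \<omega>, W \<omega>') \<in> A})" (is "_ = expectation ?p")
proof -
  have [measurable]: "Z \<in> measurable M S" "W \<in> measurable M T"
    using ind by (auto simp: indep_pair_def)
  have sec: "(\<integral>\<^sup>+\<omega>'. indicator A (Z \<omega>, W \<omega>') \<partial>M) = ennreal (?p \<omega>)" if [simp]: "\<omega> \<in> space M" for \<omega>
  proof (rule nn_integral_indicator_of)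
    have "Z \<omega> \<in> space S" by (rule measurable_space[of Z M]) simp_all
    then show "{\<omega>'\<in>space M. (Z \<omega>, W \<omega>') \<in> A} \<in> sets M" by measurable
  qed
  have "(\<lambda>\<omega>. enn2real (\<integral>\<^sup>+\<omega>'. indicator A (Z \<omega>, W \<omega>') \<partial>M)) \<in> borel_measurable M"
    by measurable
  then have [measurable]: "?p \<in> borel_measurable M"
    by (rule measurable_cong[THEN iffD1, rotated]) (simp add: sec)
  have "ennreal (prob {\<omega>\<in>space M. (Z \<omega>, W \<omega>) \<in> A}) = (\<integral>\<^sup>+\<omega>. indicator A (Z \<omega>, W \<omega>) \<partial>M)"
    by (rule nn_integral_indicator_of[symmetric]) measurable
  also have "\<dots> = (\<integral>\<^sup>+\<omega>. ennreal (?p \<omega>) \<partial>M)"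
    using sec by (subst nn_integral_indep_pair[OF ind]) (auto intro!: nn_integral_cong)
  also have "\<dots> = ennreal (expectation ?p)"
    by (intro nn_integral_eq_integral integrable_const_bound[where B=1]) auto
  finally show ?thesis by (subst (asm) ennreal_inj) (auto intro!: Bochner_Integration.integral_nonneg)
qed

section \<open>Independence through disjoint sets of sources\<close>

definition sources_algebra :: "'w set \<Rightarrow> ('i \<Rightarrow> 'w set set) \<Rightarrow> 'i set \<Rightarrow> 'w measure" where
  "sources_algebra \<Omega> E I = sigma \<Omega> (\<Union>i\<in>I. E i)"

lemma space_sources_algebra [simp]: "space (sources_algebra \<Omega> E I) = \<Omega>"
  by (simp add: sources_algebra_def space_measure_of_conv)

lemma (in prob_space) sets_sources_algebra:
  assumes "indep_sets E UNIV"
  shows "sets (sources_algebra (space M) E I) = sigma_sets (space M) (\<Union>i\<in>I. E i)"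
proof -
  have "(\<Union>i\<in>I. E i) \<subseteq> Pow (space M)"
    using assms sets.sets_into_space unfolding indep_sets_def by auto
  then show ?thesis by (simp add: sources_algebra_def sets_measure_of)
qed

lemma (in prob_space) measurable_sources_mono:
  assumes "indep_sets E UNIV" "Z \<in> measurable (sources_algebra (space M) E I) S" "I \<subseteq> J"
  shows "Z \<in> measurable (sources_algebra (space M) E J) S"
proof -
  have "sigma_sets (space M) (\<Union>i\<in>I. E i) \<subseteq> sigma_sets (space M) (\<Union>i\<in>J. E i)"
    using assms(3) by (intro sigma_sets_mono') auto
  then show ?thesis
    using assms(2) by (auto simp: measurable_def sets_sources_algebra[OF assms(1)])
qed

lemma (in prob_space) measurable_sources:
  assumes "indep_sets E UNIV" "Z \<in> measurable (sources_algebra (space M) E I) S"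
  shows "Z \<in> measurable M S"
proof -
  have "(\<Union>i\<in>I. E i) \<subseteq> sets M" using assms(1) unfolding indep_sets_def by auto
  then have "sigma_sets (space M) (\<Union>i\<in>I. E i) \<subseteq> sets M" by (rule sets.sigma_sets_subset)
  then show ?thesis
    using assms(2) by (auto simp: measurable_def sets_sources_algebra[OF assms(1)])
qed

text \<open>Grouping independent intersection-stable generators into disjoint blocks preserves
  independence. With it every independence claim about particles becomes a disjointness of label
  sets, and no variable has to be written as a function of its sources: measurability with respect
  to \<open>sources_algebra\<close> is enough.\<close>

lemma (in prob_space) indep_pair_sources:
  assumes ind: "indep_sets E UNIV" and stable: "\<And>i. Int_stable (E i)" and disj: "I \<inter> J = {}"
    and Z: "Z \<in> measurable (sources_algebra (space M) E I) S"
    and W: "W \<in> measurable (sources_algebra (space M) E J) T"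
  shows "indep_pair S Z T W"
  unfolding indep_pair_def
proof (intro conjI ballI)
  have "indep_sets (\<lambda>b. sigma_sets (space M) (\<Union>i\<in>case_bool I J b. E i)) UNIV"
    using disj by (intro indep_sets_collect_sigma indep_sets_mono_index[OF _ ind] stable)
       (auto simp: disjoint_family_on_def split: bool.splits)
  moreover have "(\<lambda>b. sigma_sets (space M) (\<Union>i\<in>case_bool I J b. E i))
     = case_bool (sets (sources_algebra (space M) E I)) (sets (sources_algebra (space M) E J))"
    by (auto simp: fun_eq_iff sets_sources_algebra[OF ind] split: bool.splits)
  ultimately have IJ: "indep_set (sets (sources_algebra (space M) E I)) (sets (sources_algebra (space M) E J))"
    unfolding indep_set_def by simp
  fix A B assume "A \<in> sets S" "B \<in> sets T"
  then have "Z -` A \<inter> space M \<in> sets (sources_algebra (space M) E I)"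
    "W -` B \<inter> space M \<in> sets (sources_algebra (space M) E J)"
    using measurable_sets[OF Z] measurable_sets[OF W] by auto
  from indep_setD[OF IJ this]
  show "prob {\<omega>\<in>space M. Z \<omega> \<in> A \<and> W \<omega> \<in> B}
      = prob {\<omega>\<in>space M. Z \<omega> \<in> A} * prob {\<omega>\<in>space M. W \<omega> \<in> B}"
    by (simp add: vimage_def Int_def conj_commute conj_left_commute)
qed (use measurable_sources[OF ind] Z W in blast)+

text \<open>The largest \<open>R\<close>-value, relative to the birth place of \<open>v\<close>, among the born descendants of \<open>v\<close> of
  generation at most \<open>n\<close>. The tail estimates are uniform over the particles, so the laws of the
  pairs \<open>(R v, \<xi> v)\<close> are never required to agree.\<close>

primrec tree_max :: "(bool list \<Rightarrow> 'w \<Rightarrow> bool) \<Rightarrow> (bool list \<Rightarrow> 'w \<Rightarrow> real) \<Rightarrow> (bool list \<Rightarrow> 'w \<Rightarrow> real) \<Rightarrow>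
    nat \<Rightarrow> bool list \<Rightarrow> 'w \<Rightarrow> real" where
  "tree_max B R \<xi> 0 v \<omega> = R v \<omega>"
| "tree_max B R \<xi> (Suc n) v \<omega> = (if B v \<omega>
     then max (R v \<omega>) (\<xi> v \<omega> + max (tree_max B R \<xi> n (True # v) \<omega>) (tree_max B R \<xi> n (False # v) \<omega>))
     else R v \<omega>)"

text \<open>Labels grow at the front, so \<open>w @ v\<close> runs over v and all its
  descendants.\<close>

definition sources_below :: "bool list \<Rightarrow> source set" where
  "sources_below v = (\<Union>w. {Lifetime (w @ v), Branching (w @ v), Motion (w @ v)})"

lemma sources_below_Cons: "sources_below (b # v) \<subseteq> sources_below v - {Lifetime v, Branching v, Motion v}"
proof -
  have "\<exists>w'. w @ b # v = w' @ v" for w by (rule exI[of _ "w @ [b]"]) simp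
  then show ?thesis unfolding sources_below_def by auto
qed

lemma sources_below_self: "{Lifetime v, Branching v, Motion v} \<subseteq> sources_below v"
  unfolding sources_below_def by (auto intro: exI[of _ "[]"])

lemma sources_below_disjoint: "sources_below (True # v) \<inter> sources_below (False # v) = {}"
  unfolding sources_below_def by (auto simp: append_eq_append_conv2 Cons_eq_append_conv append_eq_Cons_conv)

text \<open>The probability that the critical binary Galton-Watson tree reaches generation n,
  obtained by iterating \<psi> from 1.\<close>

primrec quadratic_iterate :: "nat \<Rightarrow> real" where
  "quadratic_iterate 0 = 1"
| "quadratic_iterate (Suc n) = quadratic_iterate n - (quadratic_iterate n)\<^sup>2 / 2"

lemma quadratic_iterate_bounds: "0 \<le> quadratic_iterate n" "quadratic_iterate n \<le> 1"
proof -
  have "0 \<le> quadratic_iterate n \<and> quadratic_iterate n \<le> 1"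
  proof (induction n)
    case (Suc n)
    define d where "d = quadratic_iterate n"
    have d: "0 \<le> d" "d \<le> 1" using Suc by (auto simp: d_def)
    then have "d\<^sup>2 \<le> d" by (simp add: power2_eq_square mult_left_le)
    then have "0 \<le> d - d\<^sup>2 / 2" "d - d\<^sup>2 / 2 \<le> 1" using d zero_le_power2[of d] by linarith+
    then show ?case by (simp add: d_def)
  qed simp
  then show "0 \<le> quadratic_iterate n" "quadratic_iterate n \<le> 1" by auto
qed

lemma quadratic_iterate_tendsto: "quadratic_iterate \<longlonglongrightarrow> 0"
proof -
  let ?d = quadratic_iterate
  have "decseq ?d" by (intro decseq_SucI) simp
  then obtain l where l: "?d \<longlonglongrightarrow> l"
    using decseq_convergent[of ?d 0] quadratic_iterate_bounds(1) by metis
  have "(\<lambda>n. ?d n - (?d n)\<^sup>2 / 2) \<longlonglongrightarrow> l - l\<^sup>2 / 2" by (intro tendsto_intros l) auto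
  moreover have "(\<lambda>n. ?d n - (?d n)\<^sup>2 / 2) \<longlonglongrightarrow> l" using LIMSEQ_Suc[OF l] by simp
  ultimately have "l - l\<^sup>2 / 2 = l" by (rule LIMSEQ_unique)
  then show ?thesis using l by simp
qed

text \<open>\<open>R v\<close> and \<open>\<xi> v\<close> may depend on each other, as both come
  from the lifetime and motion of v; only the branching decision and the other particles are
  separated from them. Leaving \<open>R\<close> open lets the same recursion serve the grid maximum
  and the single position.\<close>

locale branching_tree = prob_space M for M :: "'w measure" +
  fixes E :: "source \<Rightarrow> 'w set set"
    and B :: "bool list \<Rightarrow> 'w \<Rightarrow> bool" and R \<xi> :: "bool list \<Rightarrow> 'w \<Rightarrow> real"
  assumes indep: "indep_sets E UNIV" and Int_stable: "\<And>i. Int_stable (E i)"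
    and R_sources: "\<And>v. R v \<in> borel_measurable (sources_algebra (space M) E {Lifetime v, Motion v})"
    and \<xi>_sources: "\<And>v. \<xi> v \<in> borel_measurable (sources_algebra (space M) E {Lifetime v, Motion v})"
    and B_sources: "\<And>v. B v \<in> measurable (sources_algebra (space M) E {Branching v}) (count_space UNIV)"
    and prob_B: "\<And>v. prob {\<omega>\<in>space M. B v \<omega>} = 1/2"
begin

abbreviation "\<MM> \<equiv> tree_max B R \<xi>"

lemma tree_max_sources: "\<MM> n v \<in> borel_measurable (sources_algebra (space M) E (sources_below v))"
proof (induction n arbitrary: v)
  case 0
  have "R v \<in> borel_measurable (sources_algebra (space M) E (sources_below v))"
    by (rule measurable_sources_mono[OF indep R_sources]) (use sources_below_self in auto)
  then show ?case by (simp cong: measurable_cong)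
next
  case (Suc n)
  let ?N = "sources_algebra (space M) E (sources_below v)"
  have [measurable]: "R v \<in> borel_measurable ?N"
    by (rule measurable_sources_mono[OF indep R_sources]) (use sources_below_self in auto)
  have [measurable]: "\<xi> v \<in> borel_measurable ?N"
    by (rule measurable_sources_mono[OF indep \<xi>_sources]) (use sources_below_self in auto)
  have [measurable]: "B v \<in> measurable ?N (count_space UNIV)"
    by (rule measurable_sources_mono[OF indep B_sources]) (use sources_below_self in auto)
  have [measurable]: "\<MM> n (b # v) \<in> borel_measurable ?N" for b
    by (rule measurable_sources_mono[OF indep Suc.IH]) (use sources_below_Cons in blast)
  show ?case by simp
qed

lemma [measurable]:
  shows tree_max_measurable: "\<MM> n v \<in> borel_measurable M"
    and R_measurable: "R v \<in> borel_measurable M"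
    and \<xi>_measurable: "\<xi> v \<in> borel_measurable M"
    and B_measurable: "B v \<in> measurable M (count_space UNIV)"
  using measurable_sources[OF indep] tree_max_sources R_sources \<xi>_sources B_sources by blast+

text \<open>A particle that dies imposes no constraint, which accounts for the 1; the product comes
  from the disjoint subtrees of the two children.\<close>

lemma offspring_cdf:
  "prob {\<omega>\<in>space M. B v \<omega> \<longrightarrow> max (\<MM> n (True # v) \<omega>) (\<MM> n (False # v) \<omega>) \<le> y} =
     (1 + prob {\<omega>\<in>space M. \<MM> n (True # v) \<omega> \<le> y} * prob {\<omega>\<in>space M. \<MM> n (False # v) \<omega> \<le> y}) / 2"
proof -
  let ?W = "\<lambda>\<omega>. max (\<MM> n (True # v) \<omega>) (\<MM> n (False # v) \<omega>)"
  let ?J = "sources_below (True # v) \<union> sources_below (False # v)"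
  have "indep_pair borel (\<MM> n (True # v)) borel (\<MM> n (False # v))"
    by (rule indep_pair_sources[OF indep Int_stable sources_below_disjoint tree_max_sources tree_max_sources])
  from indep_pairD[OF this, of "{..y}" "{..y}"]
  have W: "prob {\<omega>\<in>space M. ?W \<omega> \<le> y} = prob {\<omega>\<in>space M. \<MM> n (True # v) \<omega> \<le> y} * prob {\<omega>\<in>space M. \<MM> n (False # v) \<omega> \<le> y}"
    by simp
  have "\<MM> n (b # v) \<in> borel_measurable (sources_algebra (space M) E ?J)" for b
    by (rule measurable_sources_mono[OF indep tree_max_sources]) (cases b, auto)
  then have "?W \<in> borel_measurable (sources_algebra (space M) E ?J)"
    by measurable
  moreover have "{Branching v} \<inter> ?J = {}" using sources_below_Cons by blast
  ultimately have "indep_pair (count_space UNIV) (B v) borel ?W"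
    by (intro indep_pair_sources[OF indep Int_stable _ B_sources])
  from indep_pairD[OF this, of "{True}" "{y<..}"]
  have BW: "prob {\<omega>\<in>space M. B v \<omega> \<and> y < ?W \<omega>} = prob {\<omega>\<in>space M. y < ?W \<omega>} / 2"
    using prob_B[of v] by simp
  have "prob {\<omega>\<in>space M. B v \<omega> \<longrightarrow> ?W \<omega> \<le> y} = 1 - prob {\<omega>\<in>space M. B v \<omega> \<and> y < ?W \<omega>}"
    by (subst prob_neg[symmetric]) (auto intro!: arg_cong[where f=prob])
  moreover have "prob {\<omega>\<in>space M. y < ?W \<omega>} = 1 - prob {\<omega>\<in>space M. ?W \<omega> \<le> y}"
    by (subst prob_neg[symmetric]) (auto intro!: arg_cong[where f=prob])
  ultimately show ?thesis using BW W by (simp add: field_simps)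
qed

text \<open>Conditioning on the pair \<open>(R v, \<xi> v)\<close>: the branching decision and the
  two subtrees use sources disjoint from those of the pair, so the inner probability is
  \<open>offspring_cdf\<close> at \<open>x - \<xi> v \<omega>\<close>.\<close>

lemma tree_max_cdf_Suc:
  "prob {\<omega>\<in>space M. \<MM> (Suc n) v \<omega> \<le> x} = expectation (\<lambda>\<omega>. indicator {..x} (R v \<omega>) *
     ((1 + prob {\<omega>'\<in>space M. \<MM> n (True # v) \<omega>' \<le> x - \<xi> v \<omega>}
         * prob {\<omega>'\<in>space M. \<MM> n (False # v) \<omega>' \<le> x - \<xi> v \<omega>}) / 2))"
proof -
  let ?J = "{Branching v} \<union> sources_below (True # v) \<union> sources_below (False # v)"
  let ?Z = "\<lambda>\<omega>. (R v \<omega>, \<xi> v \<omega>)"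
  let ?W = "\<lambda>\<omega>. (B v \<omega>, max (\<MM> n (True # v) \<omega>) (\<MM> n (False # v) \<omega>))"
  have [measurable]: "\<MM> n (b # v) \<in> borel_measurable (sources_algebra (space M) E ?J)" for b
    by (rule measurable_sources_mono[OF indep tree_max_sources]) (cases b, auto)
  have [measurable]: "B v \<in> measurable (sources_algebra (space M) E ?J) (count_space UNIV)"
    by (rule measurable_sources_mono[OF indep B_sources]) auto
  have "?W \<in> measurable (sources_algebra (space M) E ?J) (count_space UNIV \<Otimes>\<^sub>M borel)"
    by measurable
  moreover have "?Z \<in> measurable (sources_algebra (space M) E {Lifetime v, Motion v}) (borel \<Otimes>\<^sub>M borel)"
    using R_sources \<xi>_sources by (intro measurable_Pair)
  moreover have "{Lifetime v, Motion v} \<inter> ?J = {}" using sources_below_Cons by blast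
  ultimately have ind: "indep_pair (borel \<Otimes>\<^sub>M borel) ?Z (count_space UNIV \<Otimes>\<^sub>M borel) ?W"
    by (intro indep_pair_sources[OF indep Int_stable])
  let ?N = "(borel \<Otimes>\<^sub>M borel) \<Otimes>\<^sub>M (count_space UNIV \<Otimes>\<^sub>M borel) :: ((real \<times> real) \<times> bool \<times> real) measure"
  let ?A = "{p. fst (fst p) \<le> x \<and> (fst (snd p) \<longrightarrow> snd (snd p) \<le> x - snd (fst p))}"
  have "?A \<in> sets ?N"
  proof -
    have "{p\<in>space ?N. fst (fst p) \<le> x \<and> (fst (snd p) \<longrightarrow> snd (snd p) \<le> x - snd (fst p))} \<in> sets ?N"
      by measurable
    then show ?thesis by (simp add: space_pair_measure)
  qed
  from prob_indep_pair[OF ind this]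
  have "prob {\<omega>\<in>space M. R v \<omega> \<le> x \<and> (B v \<omega> \<longrightarrow> max (\<MM> n (True # v) \<omega>) (\<MM> n (False # v) \<omega>) \<le> x - \<xi> v \<omega>)}
    = expectation (\<lambda>\<omega>. prob {\<omega>'\<in>space M. R v \<omega> \<le> x \<and> (B v \<omega>' \<longrightarrow> max (\<MM> n (True # v) \<omega>') (\<MM> n (False # v) \<omega>') \<le> x - \<xi> v \<omega>)})"
    by simp
  also have "\<dots> = expectation (\<lambda>\<omega>. indicator {..x} (R v \<omega>) *
     ((1 + prob {\<omega>'\<in>space M. \<MM> n (True # v) \<omega>' \<le> x - \<xi> v \<omega>}
         * prob {\<omega>'\<in>space M. \<MM> n (False # v) \<omega>' \<le> x - \<xi> v \<omega>}) / 2))"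
    by (intro Bochner_Integration.integral_cong refl)
       (auto simp flip: offspring_cdf simp: indicator_def)
  also have "{\<omega>\<in>space M. R v \<omega> \<le> x \<and> (B v \<omega> \<longrightarrow> max (\<MM> n (True # v) \<omega>) (\<MM> n (False # v) \<omega>) \<le> x - \<xi> v \<omega>)}
      = {\<omega>\<in>space M. \<MM> (Suc n) v \<omega> \<le> x}"
    by auto
  finally show ?thesis .
qed

text \<open>Induction on the generation, carried out for distribution functions, where the recursion
  is increasing. The start is free: the bracket is at most 1, so the supersolution inequality
  already bounds the distribution function of \<open>R\<close>. Hence the bound does not depend on
  n.\<close>

lemma tree_max_le_supersolution:
  assumes [measurable]: "h \<in> borel_measurable borel" and h: "\<And>x. 0 \<le> h x" "\<And>x. h x \<le> 1"
    and super: "\<And>v x. 1 - h x \<le>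
      expectation (\<lambda>\<omega>. indicator {..x} (R v \<omega>) * ((1 + (1 - h (x - \<xi> v \<omega>))\<^sup>2) / 2))"
  shows "prob {\<omega>\<in>space M. x < \<MM> n v \<omega>} \<le> h x"
proof -
  have h2: "(1 - h x)\<^sup>2 \<le> 1" for x using h[of x] by (simp add: abs_square_le_1)
  have "1 - h x \<le> prob {\<omega>\<in>space M. \<MM> n v \<omega> \<le> x}"
  proof (induction n arbitrary: v x)
    case 0
    have "1 - h x \<le> expectation (\<lambda>\<omega>. indicator {..x} (R v \<omega>) * ((1 + (1 - h (x - \<xi> v \<omega>))\<^sup>2) / 2))"
      by (rule super)
    also have "\<dots> \<le> expectation (\<lambda>\<omega>. indicator {\<omega>\<in>space M. R v \<omega> \<le> x} \<omega>)"
      using h2 by (intro integral_mono integrable_const_bound[where B=1]) (auto simp: indicator_def)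
    also have "\<dots> = prob {\<omega>\<in>space M. \<MM> 0 v \<omega> \<le> x}" by simp
    finally show ?case .
  next
    case (Suc n)
    define F where "F b y = prob {\<omega>\<in>space M. \<MM> n (b # v) \<omega> \<le> y}" for b y
    have F_mono: "mono (F b)" for b unfolding F_def by (intro monoI finite_measure_mono) auto
    have [measurable]: "F b \<in> borel_measurable borel" for b
      by (rule borel_measurable_mono) (use F_mono in \<open>simp add: mono_def\<close>)
    have F01: "0 \<le> F b y" "F b y \<le> 1" for b y by (auto simp: F_def)
    have FF: "F b y * F b' y' \<le> 1" for b b' y y' using F01 by (intro mult_le_one)
    have "1 - h x \<le> expectation (\<lambda>\<omega>. indicator {..x} (R v \<omega>) * ((1 + (1 - h (x - \<xi> v \<omega>))\<^sup>2) / 2))"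
      by (rule super)
    also have "\<dots> \<le> expectation (\<lambda>\<omega>. indicator {..x} (R v \<omega>) * ((1 + F True (x - \<xi> v \<omega>) * F False (x - \<xi> v \<omega>)) / 2))"
    proof (intro integral_mono integrable_const_bound[where B=1] AE_I2)
      fix \<omega>
      have "(1 - h (x - \<xi> v \<omega>))\<^sup>2 \<le> F True (x - \<xi> v \<omega>) * F False (x - \<xi> v \<omega>)"
        unfolding power2_eq_square F_def using h Suc.IH by (intro mult_mono) auto
      then show "indicator {..x} (R v \<omega>) * ((1 + (1 - h (x - \<xi> v \<omega>))\<^sup>2) / 2)
        \<le> indicator {..x} (R v \<omega>) * ((1 + F True (x - \<xi> v \<omega>) * F False (x - \<xi> v \<omega>)) / 2)"
        by (intro mult_left_mono) auto
      show "norm (indicator {..x} (R v \<omega>) * ((1 + (1 - h (x - \<xi> v \<omega>))\<^sup>2) / 2)) \<le> 1"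
        using h2 by (auto simp: indicator_def)
      show "norm (indicator {..x} (R v \<omega>) * ((1 + F True (x - \<xi> v \<omega>) * F False (x - \<xi> v \<omega>)) / 2)) \<le> 1"
        using FF F01 by (auto simp: indicator_def)
    qed measurable
    also have "\<dots> = prob {\<omega>\<in>space M. \<MM> (Suc n) v \<omega> \<le> x}"
      unfolding tree_max_cdf_Suc F_def ..
    finally show ?case .
  qed
  moreover have "prob {\<omega>\<in>space M. x < \<MM> n v \<omega>} = 1 - prob {\<omega>\<in>space M. \<MM> n v \<omega> \<le> x}"
    by (subst prob_neg[symmetric]) (auto intro!: arg_cong[where f=prob])
  ultimately show ?thesis by simp
qed

text \<open>A tree cut at generation n need not reach the subsolution, so the induction carries a
  slack. It starts at the trivial value 1 and is transported by \<psi>, which makes it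
  \<open>quadratic_iterate\<close>.\<close>

lemma tree_max_ge_subsolution:
  assumes [measurable]: "h \<in> borel_measurable borel" and h: "\<And>x. 0 \<le> h x" "\<And>x. h x \<le> 1"
    and sub: "\<And>v x. expectation (\<lambda>\<omega>. indicator {..x} (R v \<omega>) * ((1 + (1 - h (x - \<xi> v \<omega>))\<^sup>2) / 2))
      \<le> 1 - h x"
  shows "h x - quadratic_iterate n \<le> prob {\<omega>\<in>space M. x < \<MM> n v \<omega>}"
proof -
  let ?d = quadratic_iterate
  have "prob {\<omega>\<in>space M. \<MM> n v \<omega> \<le> x} \<le> 1 - h x + ?d n"
  proof (induction n arbitrary: v x)
    case 0
    have "prob {\<omega>\<in>space M. \<MM> 0 v \<omega> \<le> x} \<le> 1" by (rule prob_le_1)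
    also have "\<dots> \<le> 1 - h x + quadratic_iterate 0" using h[of x] by simp
    finally show ?case .
  next
    case (Suc n)
    define F where "F b y = prob {\<omega>\<in>space M. \<MM> n (b # v) \<omega> \<le> y}" for b y
    define d where "d = ?d n"
    have d: "0 \<le> d" "d \<le> 1" using quadratic_iterate_bounds[of n] by (auto simp: d_def)
    have F_mono: "mono (F b)" for b unfolding F_def by (intro monoI finite_measure_mono) auto
    have [measurable]: "F b \<in> borel_measurable borel" for b
      by (rule borel_measurable_mono) (use F_mono in \<open>simp add: mono_def\<close>)
    have F01: "0 \<le> F b y" "F b y \<le> 1" for b y by (auto simp: F_def)
    have FF: "F b y * F b' y' \<le> 1" for b b' y y' using F01 by (intro mult_le_one)
    have h2: "(1 - h x)\<^sup>2 \<le> 1" for x using h[of x] by (simp add: abs_square_le_1)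
    let ?S = "\<lambda>\<omega>. indicator {..x} (R v \<omega>) * ((1 + (1 - h (x - \<xi> v \<omega>))\<^sup>2) / 2)"
    have intS: "integrable M ?S"
      by (intro integrable_const_bound[where B=1] AE_I2) (use h2 in \<open>auto simp: indicator_def\<close>)
    have "prob {\<omega>\<in>space M. \<MM> (Suc n) v \<omega> \<le> x} =
       expectation (\<lambda>\<omega>. indicator {..x} (R v \<omega>) * ((1 + F True (x - \<xi> v \<omega>) * F False (x - \<xi> v \<omega>)) / 2))"
      unfolding tree_max_cdf_Suc F_def ..
    also have "\<dots> \<le> expectation (\<lambda>\<omega>. ?S \<omega> + (d - d\<^sup>2 / 2))"
    proof (intro integral_mono AE_I2)
      fix \<omega>
      define w where "w = h (x - \<xi> v \<omega>)"
      have w: "0 \<le> w" "w \<le> 1" using h by (auto simp: w_def)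
      have Fb: "F b (x - \<xi> v \<omega>) \<le> min 1 (1 - w + d)" for b
        using Suc.IH[of "b # v" "x - \<xi> v \<omega>"] F01(2)[of b] unfolding F_def w_def d_def by simp
      have "F True (x - \<xi> v \<omega>) * F False (x - \<xi> v \<omega>) \<le> min 1 (1 - w + d) * min 1 (1 - w + d)"
        using F01 w d by (intro mult_mono Fb) auto
      \<comment> \<open>Subadditivity of \<psi>, which is concave with \<psi> 0 = 0: \<psi> w <=
        \<psi> (w - d) + \<psi> d, where w - d is cut off at 0.\<close>
      also have "\<dots> \<le> (1 - w)\<^sup>2 + 2 * d - d\<^sup>2"
      proof (cases "d \<le> w")
        case True
        then have "min 1 (1 - w + d) = 1 - w + d" by simp
        moreover have "0 \<le> 2 * d * (w - d)" using True d by simp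
        ultimately show ?thesis by (simp add: power2_eq_square algebra_simps)
      next
        case False
        then have "min 1 (1 - w + d) = 1" by simp
        moreover have "(1 - d)\<^sup>2 \<le> (1 - w)\<^sup>2" using False d w by (intro power_mono) auto
        ultimately show ?thesis by (simp add: power2_eq_square algebra_simps)
      qed
      finally have "(1 + F True (x - \<xi> v \<omega>) * F False (x - \<xi> v \<omega>)) / 2
          \<le> (1 + (1 - w)\<^sup>2) / 2 + (d - d\<^sup>2 / 2)" by (simp add: field_simps)
      moreover have "0 \<le> d - d\<^sup>2 / 2" using d mult_mono[of d 2 d d] by (simp add: power2_eq_square algebra_simps)
      moreover have "indicator {..x} (R v \<omega>) * r \<le> indicator {..x} (R v \<omega>) * r' + e" if "r \<le> r' + e" "0 \<le> e" for r r' e :: real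
        using that by (auto simp: indicator_def)
      ultimately show "indicator {..x} (R v \<omega>) * ((1 + F True (x - \<xi> v \<omega>) * F False (x - \<xi> v \<omega>)) / 2)
        \<le> ?S \<omega> + (d - d\<^sup>2 / 2)"
        unfolding w_def by blast
    next
      show "integrable M (\<lambda>\<omega>. indicator {..x} (R v \<omega>) * ((1 + F True (x - \<xi> v \<omega>) * F False (x - \<xi> v \<omega>)) / 2))"
        by (intro integrable_const_bound[where B=1] AE_I2) (use FF F01 in \<open>auto simp: indicator_def\<close>)
    qed (use intS in auto)
    also have "\<dots> = expectation ?S + (d - d\<^sup>2 / 2)" using intS by (simp add: prob_space)
    also have "\<dots> \<le> 1 - h x + ?d (Suc n)" using sub[of x v] by (simp add: d_def)
    finally show ?case .
  qed
  moreover have "prob {\<omega>\<in>space M. x < \<MM> n v \<omega>} = 1 - prob {\<omega>\<in>space M. \<MM> n v \<omega> \<le> x}"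
    by (subst prob_neg[symmetric]) (auto intro!: arg_cong[where f=prob])
  ultimately show ?thesis by simp
qed

end

section \<open>Tails of a symmetric stable process\<close>

text \<open>A tail L * x^-\<alpha> has the fraction 1 - 2^-\<alpha> of its mass in the shell from x
  to 2x. Instead of summing shells, take \<open>m\<close> between \<open>L\<close> and
  \<open>K\<close>: from some point on, \<open>H x = F x - m * x powr (-\<alpha>)\<close> does not
  decrease along x, 2x, 4x, ... and tends to 0, so it is at most 0.\<close>

lemma eventually_less_of_dyadic_differences:
  fixes F :: "real \<Rightarrow> real"
  assumes \<alpha>: "0 < \<alpha>" and less: "L < K" and F0: "(F \<longlongrightarrow> 0) at_top"
    and lim: "((\<lambda>x. x powr \<alpha> * (F x - F (2 * x))) \<longlongrightarrow> (1 - 2 powr (-\<alpha>)) * L) at_top"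
  shows "\<forall>\<^sub>F x in at_top. x powr \<alpha> * F x < K"
proof -
  have 2: "0 < 1 - 2 powr (-\<alpha>)"
    using powr_less_mono[of "-\<alpha>" 0 2] \<alpha> by simp
  have iterate: "H x \<le> 0" if H: "(H \<longlongrightarrow> 0) at_top" and x0: "0 < x0" and x: "x0 \<le> x"
    and step: "\<And>x. x0 \<le> x \<Longrightarrow> H x \<le> H (2 * x)" for H :: "real \<Rightarrow> real" and x0 x
  proof -
    have "x0 \<le> 2 ^ n * x \<and> H x \<le> H (2 ^ n * x)" for n
    proof (induction n)
      case (Suc n)
      then show ?case using step[of "2 ^ n * x"] x0 by (auto simp: algebra_simps)
    qed (use x in simp)
    moreover have "(\<lambda>n. H (2 ^ n * x)) \<longlonglongrightarrow> 0"
    proof (rule filterlim_compose[OF H])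
      have "filterlim (\<lambda>n. 2 ^ n :: real) at_top sequentially"
        by (intro filterlim_at_infinity_imp_filterlim_at_top filterlim_realpow_sequentially_gt1) auto
      then show "filterlim (\<lambda>n. 2 ^ n * x) at_top sequentially"
        using x0 x by (intro filterlim_at_top_mult_tendsto_pos[OF tendsto_const]) auto
    qed
    ultimately show ?thesis by (intro LIMSEQ_le_const) auto
  qed
  have K0: "((\<lambda>x. K * x powr (-\<alpha>)) \<longlongrightarrow> 0) at_top" for K
    using \<alpha> by (auto intro!: tendsto_mult_right_zero tendsto_neg_powr filterlim_ident)
  have powr2: "(2 * x) powr (-\<alpha>) = 2 powr (-\<alpha>) * x powr (-\<alpha>)" if "0 < x" for x
    using that by (simp add: powr_mult)
  have powr_inv: "x powr \<alpha> * x powr (-\<alpha>) = 1" if "0 < x" for x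
    using that by (simp flip: powr_add)
  define m where "m = (L + K) / 2"
  have m: "m < K" "L < m" using less by (auto simp: m_def)
  then have "(1 - 2 powr (-\<alpha>)) * L < (1 - 2 powr (-\<alpha>)) * m"
    using 2 by (intro mult_strict_left_mono) auto
  from order_tendstoD(2)[OF lim this] obtain x0 where x0: "\<And>x. x0 \<le> x \<Longrightarrow>
      x powr \<alpha> * (F x - F (2 * x)) < (1 - 2 powr (-\<alpha>)) * m"
    by (auto simp: eventually_at_top_linorder)
  define x1 where "x1 = max x0 1"
  define H where "H x = F x - m * x powr (-\<alpha>)" for x
  have "H x \<le> H (2 * x)" if "x1 \<le> x" for x
  proof -
    have x: "0 < x" "x0 \<le> x" using that by (auto simp: x1_def)
    have "x powr (-\<alpha>) * (x powr \<alpha> * (F x - F (2 * x))) \<le> x powr (-\<alpha>) * ((1 - 2 powr (-\<alpha>)) * m)"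
      using x0[OF x(2)] by (intro mult_left_mono) auto
    moreover have "x powr (-\<alpha>) * (x powr \<alpha> * y) = y" for y
      using powr_inv[OF x(1)] by (metis mult.assoc mult.commute mult_1)
    ultimately have "F x - F (2 * x) \<le> x powr (-\<alpha>) * ((1 - 2 powr (-\<alpha>)) * m)"
      by simp
    then show ?thesis using powr2[OF x(1)] by (simp add: H_def algebra_simps)
  qed
  moreover have "(H \<longlongrightarrow> 0) at_top"
    unfolding H_def using tendsto_diff[OF F0 K0] by simp
  ultimately have H: "H x \<le> 0" if "x1 \<le> x" for x
    using that iterate[of H x1 x] by (auto simp: x1_def)
  have "x powr \<alpha> * F x < K" if "x1 \<le> x" for x
  proof -
    have x: "0 < x" using that by (auto simp: x1_def)
    have "x powr \<alpha> * F x \<le> x powr \<alpha> * (m * x powr (-\<alpha>))"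
      using H[OF that] by (intro mult_left_mono) (auto simp: H_def)
    also have "\<dots> = (x powr \<alpha> * x powr (-\<alpha>)) * m" by (simp only: mult_ac)
    finally show ?thesis using powr_inv[OF x] m by simp
  qed
  then show ?thesis by (auto simp: eventually_at_top_linorder)
qed

lemma tendsto_of_dyadic_differences:
  fixes F :: "real \<Rightarrow> real"
  assumes "0 < \<alpha>" and F0: "(F \<longlongrightarrow> 0) at_top"
    and lim: "((\<lambda>x. x powr \<alpha> * (F x - F (2 * x))) \<longlongrightarrow> (1 - 2 powr (-\<alpha>)) * L) at_top"
  shows "((\<lambda>x. x powr \<alpha> * F x) \<longlongrightarrow> L) at_top"
proof (rule order_tendstoI)
  fix K assume "K < L"
  moreover have "((\<lambda>x. - F x) \<longlongrightarrow> 0) at_top" using tendsto_minus[OF F0] by simp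
  moreover have "((\<lambda>x. x powr \<alpha> * (- F x - - F (2 * x))) \<longlongrightarrow> (1 - 2 powr (-\<alpha>)) * - L) at_top"
    using tendsto_minus[OF lim] by (simp add: algebra_simps)
  ultimately have "\<forall>\<^sub>F x in at_top. x powr \<alpha> * - F x < - K"
    using assms(1) by (intro eventually_less_of_dyadic_differences[where L="- L"]) simp_all
  then show "\<forall>\<^sub>F x in at_top. K < x powr \<alpha> * F x" by simp
next
  fix K assume "L < K"
  then show "\<forall>\<^sub>F x in at_top. x powr \<alpha> * F x < K"
    using assms by (intro eventually_less_of_dyadic_differences[of \<alpha> L])
qed

text \<open>The continuity theorem concerns probability measures, whereas a jump measure may be
  infinite; a weight of finite integral is therefore normalised away.\<close>

lemma normalized_density:
  fixes N :: "real measure" and w :: "real \<Rightarrow> real"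
  assumes sets: "sets N = sets borel" and w: "w \<in> borel_measurable borel" "\<And>y. 0 \<le> w y"
    and int: "integrable N w" and c: "c = integral\<^sup>L N w" "0 < c"
  defines "D \<equiv> density N (\<lambda>y. ennreal (w y / c))"
  shows real_distribution_normalized_density: "real_distribution D"
    and integral_normalized_density: "\<And>g :: real \<Rightarrow> 'b::{banach, second_countable_topology}.
      g \<in> borel_measurable borel \<Longrightarrow> integral\<^sup>L D g = (integral\<^sup>L N (\<lambda>y. w y *\<^sub>R g y)) /\<^sub>R c"
proof -
  have [measurable_cong]: "sets N = sets borel" by (rule sets)
  have [measurable]: "w \<in> borel_measurable borel" by (rule w)
  have "(\<integral>\<^sup>+y. ennreal (w y / c) \<partial>N) = ennreal (\<integral>y. w y / c \<partial>N)"
    using int w(2) c(2) by (intro nn_integral_eq_integral) auto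
  also have "\<dots> = 1" using c by simp
  finally have "prob_space D"
    unfolding D_def by (intro prob_spaceI) (simp add: emeasure_density cong: nn_integral_cong)
  then show "real_distribution D"
    unfolding D_def real_distribution_def real_distribution_axioms_def by (simp add: sets)
  show "integral\<^sup>L D g = (integral\<^sup>L N (\<lambda>y. w y *\<^sub>R g y)) /\<^sub>R c"
    if [measurable]: "g \<in> borel_measurable borel" for g :: "real \<Rightarrow> 'b"
  proof -
    have "integral\<^sup>L D g = integral\<^sup>L N (\<lambda>y. (w y / c) *\<^sub>R g y)"
      unfolding D_def using w(2) c(2) by (intro integral_density) auto
    also have "\<dots> = integral\<^sup>L N (\<lambda>y. inverse c *\<^sub>R (w y *\<^sub>R g y))"
      by (simp only: scaleR_scaleR divide_inverse mult.commute)
    also have "\<dots> = (integral\<^sup>L N (\<lambda>y. w y *\<^sub>R g y)) /\<^sub>R c"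
      by (simp only: integral_scaleR_right)
    finally show ?thesis .
  qed
qed

lemma one_minus_cos_iexp:
  "(1 - cos y) *\<^sub>R iexp (\<theta> * y) = iexp (\<theta> * y) - (iexp ((\<theta> + 1) * y) + iexp ((\<theta> - 1) * y)) / 2"
proof -
  have c: "complex_of_real (cos y) = (iexp y + iexp (-y)) / 2"
    by (simp add: cos_exp_eq cos_of_real[symmetric] del: cos_of_real)
  have e1: "iexp ((\<theta> + 1) * y) = iexp (\<theta> * y) * iexp y"
    by (simp add: exp_add[symmetric] algebra_simps)
  have e2: "iexp ((\<theta> - 1) * y) = iexp (\<theta> * y) * iexp (-y)"
    by (simp add: exp_add[symmetric] algebra_simps)
  show ?thesis unfolding e1 e2 scaleR_conv_of_real of_real_diff c of_real_1
    by (simp only: field_simps) (simp add: algebra_simps)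
qed

lemma levy_khintchine_integrable:
  assumes sets: "sets \<nu> = sets borel" and int: "integrable \<nu> (\<lambda>y. min 1 (y\<^sup>2))"
  shows "integrable \<nu> (\<lambda>y. iexp (\<theta> * y) - 1 - \<i> * of_real (\<theta> * y * indicator {-1<..<1} y))"
proof (rule Bochner_Integration.integrable_bound)
  have [measurable_cong]: "sets \<nu> = sets borel" by (rule sets)
  show "integrable \<nu> (\<lambda>y. (2 + \<theta>\<^sup>2) * min 1 (y\<^sup>2))" using int by simp
  show "(\<lambda>y. iexp (\<theta> * y) - 1 - \<i> * of_real (\<theta> * y * indicator {-1<..<1} y)) \<in> borel_measurable \<nu>"
    by measurable
  show "AE y in \<nu>. norm (iexp (\<theta> * y) - 1 - \<i> * of_real (\<theta> * y * indicator {-1<..<1} y))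
      \<le> norm ((2 + \<theta>\<^sup>2) * min 1 (y\<^sup>2))"
  proof (intro AE_I2)
    fix y :: real
    show "norm (iexp (\<theta> * y) - 1 - \<i> * of_real (\<theta> * y * indicator {-1<..<1} y))
        \<le> norm ((2 + \<theta>\<^sup>2) * min 1 (y\<^sup>2))"
    proof (cases "\<bar>y\<bar> < 1")
      case True
      have "norm (iexp (\<theta> * y) - (\<Sum>k\<le>1. (\<i> * of_real (\<theta> * y)) ^ k / fact k)) \<le> \<bar>\<theta> * y\<bar> ^ 2 / 2"
        using iexp_approx1[of "\<theta> * y" 1] by (simp add: numeral_2_eq_2)
      also have "\<dots> \<le> (2 + \<theta>\<^sup>2) * y\<^sup>2"
        by (simp add: power_mult_distrib algebra_simps)
      also have "y\<^sup>2 = min 1 (y\<^sup>2)" using True by (simp add: abs_square_le_1)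
      finally show ?thesis using True by (simp add: diff_diff_eq indicator_def abs_less_iff)
    next
      case False
      then have "1 \<le> y\<^sup>2" by (metis abs_square_less_1 not_le)
      then have 1: "min 1 (y\<^sup>2) = 1" by simp
      have "norm (iexp (\<theta> * y) - 1) \<le> 1 + 1"
        by (rule order.trans[OF norm_triangle_ineq4]) (simp only: norm_exp_i_times norm_one)
      also have "\<dots> \<le> 2 + \<theta>\<^sup>2" by simp
      finally have "norm (iexp (\<theta> * y) - 1) \<le> 2 + \<theta>\<^sup>2" .
      moreover have "indicator {-1<..<1} y = (0::real)" using False by (auto simp: indicator_def)
      ultimately show ?thesis unfolding 1 by simp
    qed
  qed
qed

section \<open>Small-time convergence to the jump measure\<close>

context levy_process
begin

definition law :: "real \<Rightarrow> real measure" where "law t = distr M borel (X t)"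

lemma real_distribution_law: "0 \<le> t \<Longrightarrow> real_distribution (law t)"
  unfolding law_def using measurable_process by auto

text \<open>The measures \<open>(1 - cos y) P(X\<^sub>t \<in> dy) / t\<close> converge weakly to \<open>(1 - cos y) \<nu>(dy)\<close>: weighting
  by \<open>1 - cos y\<close> only combines the characteristic function at \<open>\<theta>\<close> and \<open>\<theta> \<plusminus> 1\<close> and cancels the
  compensator, and on the interval of interest it is bounded away from \<open>0\<close>.\<close>

lemma small_time_tail:
  fixes \<nu> :: "real measure" and t :: "nat \<Rightarrow> real"
  assumes triplet: "has_levy_triplet M X 0 0 \<nu>" and t: "\<And>n. 0 < t n" "t \<longlonglongrightarrow> 0"
    and null: "emeasure \<nu> {1, 2} = 0" and positive: "0 < measure \<nu> {1<..2}"
  shows "(\<lambda>n. measure (law (t n)) {1<..2} / t n) \<longlonglongrightarrow> measure \<nu> {1<..2}"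
proof -
  have sets: "sets \<nu> = sets borel" and int: "integrable \<nu> (\<lambda>y. min 1 (y\<^sup>2))"
    using triplet by (auto simp: has_levy_triplet_def)
  have [measurable_cong]: "sets \<nu> = sets borel" by (rule sets)
  define G where "G \<theta> y = iexp (\<theta> * y) - 1 - \<i> * of_real (\<theta> * y * indicator {-1<..<1} y)" for \<theta> y :: real
  define \<eta> where "\<eta> \<theta> = (CLINT y|\<nu>. G \<theta> y)" for \<theta>
  have intG: "integrable \<nu> (G \<theta>)" for \<theta>
    unfolding G_def by (rule levy_khintchine_integrable[OF sets int])
  have char_law: "char (law s) \<theta> = exp (of_real s * \<eta> \<theta>)" if "0 \<le> s" for s \<theta>
    using triplet that by (simp add: has_levy_triplet_def law_def \<eta>_def G_def)
  define N\<eta> where "N\<eta> \<theta> = \<eta> \<theta> - (\<eta> (\<theta> + 1) + \<eta> (\<theta> - 1)) / 2" for \<theta>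
  define N where "N n \<theta> = char (law (t n)) \<theta> - (char (law (t n)) (\<theta> + 1) + char (law (t n)) (\<theta> - 1)) / 2" for n \<theta>
  have int_w\<nu>: "(CLINT y|\<nu>. (1 - cos y) *\<^sub>R iexp (\<theta> * y)) = N\<eta> \<theta>"
    and int_w\<nu>': "integrable \<nu> (\<lambda>y. (1 - cos y) *\<^sub>R iexp (\<theta> * y))" for \<theta>
  proof -
    have *: "(1 - cos y) *\<^sub>R iexp (\<theta> * y) = G \<theta> y - (G (\<theta> + 1) y + G (\<theta> - 1) y) / 2" for y
      unfolding one_minus_cos_iexp G_def by (simp add: field_simps)
    show "(CLINT y|\<nu>. (1 - cos y) *\<^sub>R iexp (\<theta> * y)) = N\<eta> \<theta>"
      unfolding * N\<eta>_def \<eta>_def using intG by simp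
    show "integrable \<nu> (\<lambda>y. (1 - cos y) *\<^sub>R iexp (\<theta> * y))"
      unfolding * using intG by (intro Bochner_Integration.integrable_diff integrable_divide Bochner_Integration.integrable_add)
  qed
  have int_w: "(CLINT y|law (t n). (1 - cos y) *\<^sub>R iexp (\<theta> * y)) = N n \<theta>"
    and int_w': "integrable (law (t n)) (\<lambda>y. (1 - cos y) *\<^sub>R iexp (\<theta> * y))" for n \<theta>
  proof -
    interpret L: real_distribution "law (t n)" by (rule real_distribution_law) (use t(1)[of n] in simp)
    have i: "integrable (law (t n)) (\<lambda>y. iexp (\<theta> * y))" for \<theta>
      by (intro L.integrable_iexp) auto
    show "(CLINT y|law (t n). (1 - cos y) *\<^sub>R iexp (\<theta> * y)) = N n \<theta>"
      unfolding one_minus_cos_iexp N_def char_def using i[of \<theta>] i[of "\<theta> + 1"] i[of "\<theta> - 1"] by simp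
    show "integrable (law (t n)) (\<lambda>y. (1 - cos y) *\<^sub>R iexp (\<theta> * y))"
      unfolding one_minus_cos_iexp using i
      by (intro Bochner_Integration.integrable_diff integrable_divide Bochner_Integration.integrable_add)
  qed
  have w\<nu>: "integrable \<nu> (\<lambda>y. 1 - cos y)" "complex_of_real (\<integral>y. 1 - cos y \<partial>\<nu>) = N\<eta> 0"
    using int_w\<nu>'[of 0] int_w\<nu>[of 0]
    by (simp_all add: scaleR_conv_of_real integral_complex_of_real complex_of_real_integrable_eq del: of_real_diff)
  have w: "integrable (law (t n)) (\<lambda>y. 1 - cos y)" "complex_of_real (\<integral>y. 1 - cos y \<partial>law (t n)) = N n 0" for n
    using int_w'[of n 0] int_w[of n 0]
    by (simp_all add: scaleR_conv_of_real integral_complex_of_real complex_of_real_integrable_eq del: of_real_diff)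
  define c where "c = (\<integral>y. 1 - cos y \<partial>\<nu>)"
  define cn where "cn n = (\<integral>y. 1 - cos y \<partial>law (t n))" for n
  have exp_lim: "(\<lambda>n. (exp (of_real (t n) * z) - 1) / of_real (t n)) \<longlonglongrightarrow> z" for z :: complex
  proof -
    have "((\<lambda>h. exp (h * z)) has_field_derivative z) (at 0)"
      by (auto intro!: derivative_eq_intros)
    then have "((\<lambda>h. (exp (h * z) - 1) / h) \<longlongrightarrow> z) (at 0)"
      by (simp add: has_field_derivative_iff)
    moreover have "filterlim (\<lambda>n. complex_of_real (t n)) (at 0) sequentially"
      using t(1) tendsto_of_real[OF t(2)] by (auto simp: filterlim_at less_imp_neq[symmetric])
    ultimately show ?thesis by (rule filterlim_compose)
  qed
  have N_lim: "(\<lambda>n. N n \<theta> / of_real (t n)) \<longlonglongrightarrow> N\<eta> \<theta>" for \<theta>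
  proof -
    let ?e = "\<lambda>n \<theta>. (exp (of_real (t n) * \<eta> \<theta>) - 1) / of_real (t n)"
    \<comment> \<open>The subtracted ones cancel because the coefficients 1, -1/2, -1/2 sum to 0.
      What remains are difference quotients of exponentials at time 0.\<close>
    have "N n \<theta> / of_real (t n) = ?e n \<theta> - (?e n (\<theta> + 1) + ?e n (\<theta> - 1)) / 2" for n
      using t(1)[of n] unfolding N_def by (simp add: char_law field_simps)
    then show ?thesis unfolding N\<eta>_def by (simp only:) (intro tendsto_intros exp_lim; simp)
  qed
  have cn_lim: "(\<lambda>n. cn n / t n) \<longlonglongrightarrow> c"
  proof -
    have "(\<lambda>n. complex_of_real (cn n / t n)) \<longlonglongrightarrow> complex_of_real c"
      using N_lim[of 0] w(2) w\<nu>(2) by (simp add: cn_def c_def)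
    then show ?thesis by (simp only: tendsto_of_real_iff)
  qed
  \<comment> \<open>The interval from 1 to 2 lies inside (0, \<pi>), where cosine decreases. So the
    weight is at least 1 - cos 1 there, which makes the total mass \<open>c\<close> positive and
    lets the weight be divided out again.\<close>
  have cos_le: "cos y \<le> cos 1" if "1 < y" "y \<le> 2" for y :: real
    using that pi_ge_two by (intro cos_monotone_0_pi_le) auto
  have cos1: "cos 1 < (1::real)" using cos_monotone_0_pi[of 0 1] pi_gt_zero pi_ge_two by simp
  have ind: "(\<integral>y. indicator {1<..2} y \<partial>Q) = measure Q {1<..2}"
    if "sets Q = sets borel" for Q :: "real measure"
    using that by (subst Bochner_Integration.integral_indicator)
       (auto simp: sets_eq_imp_space_eq[OF that])
  have "0 < (1 - cos 1) * measure \<nu> {1<..2}" using positive cos1 by simp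
  also have "\<dots> = (\<integral>y. (1 - cos 1) * indicator {1<..2} y \<partial>\<nu>)" using ind[OF sets] by simp
  also have "\<dots> \<le> c"
    unfolding c_def using w\<nu>(1) cos_le by (intro integral_mono') (auto simp: indicator_def)
  finally have c: "0 < c" .
  have "\<forall>\<^sub>F n in sequentially. 0 < cn n / t n" using cn_lim c by (rule order_tendstoD)
  \<comment> \<open>The normalisers are positive only from some index on; shifting the sequence by
    \<open>k\<close> makes every term a probability measure.\<close>
  then obtain k where k: "\<And>n. k \<le> n \<Longrightarrow> 0 < cn n / t n" by (auto simp: eventually_sequentially)
  have cnk: "0 < cn (n + k)" for n using k[of "n + k"] t(1)[of "n + k"] by (simp add: zero_less_divide_iff)
  define \<rho>n where "\<rho>n n = density (law (t (n + k))) (\<lambda>y. ennreal ((1 - cos y) / cn (n + k)))" for n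
  define \<rho> where "\<rho> = density \<nu> (\<lambda>y. ennreal ((1 - cos y) / c))"
  have sets_law: "sets (law s) = sets borel" for s by (simp add: law_def)
  have \<rho>: "real_distribution \<rho>"
    unfolding \<rho>_def by (rule real_distribution_normalized_density) (use w\<nu> c sets c_def in auto)
  have \<rho>_int: "integral\<^sup>L \<rho> g = (integral\<^sup>L \<nu> (\<lambda>y. (1 - cos y) *\<^sub>R g y)) /\<^sub>R c"
    if "g \<in> borel_measurable borel" for g :: "real \<Rightarrow> 'b::{banach, second_countable_topology}"
    unfolding \<rho>_def by (rule integral_normalized_density) (use w\<nu> c sets c_def that in auto)
  have \<rho>n: "real_distribution (\<rho>n n)" for n
    unfolding \<rho>n_def by (rule real_distribution_normalized_density) (use w cnk sets_law cn_def in auto)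
  have \<rho>n_int: "integral\<^sup>L (\<rho>n n) g = (integral\<^sup>L (law (t (n + k))) (\<lambda>y. (1 - cos y) *\<^sub>R g y)) /\<^sub>R cn (n + k)"
    if "g \<in> borel_measurable borel" for g :: "real \<Rightarrow> 'b::{banach, second_countable_topology}" and n
    unfolding \<rho>n_def by (rule integral_normalized_density) (use w cnk sets_law cn_def that in auto)
  have weak: "weak_conv_m \<rho>n \<rho>"
  proof (rule levy_continuity[OF \<rho>n \<rho>])
    fix \<theta>
    have "(\<lambda>n. (N n \<theta> / of_real (t n)) / of_real (cn n / t n)) \<longlonglongrightarrow> N\<eta> \<theta> / of_real c"
      using c by (intro tendsto_divide N_lim tendsto_of_real cn_lim) auto
    moreover have "(N n \<theta> / of_real (t n)) / of_real (cn n / t n) = N n \<theta> / of_real (cn n)" for n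
      using t(1)[of n] by simp
    ultimately have "(\<lambda>n. N n \<theta> / of_real (cn n)) \<longlonglongrightarrow> N\<eta> \<theta> / of_real c" by (simp only:)
    then have "(\<lambda>n. N (n + k) \<theta> / of_real (cn (n + k))) \<longlonglongrightarrow> N\<eta> \<theta> / of_real c"
      by (rule LIMSEQ_ignore_initial_segment)
    moreover have "char (\<rho>n n) \<theta> = N (n + k) \<theta> / of_real (cn (n + k))" for n
    proof -
      have "char (\<rho>n n) \<theta> = N (n + k) \<theta> /\<^sub>R cn (n + k)"
        unfolding char_def int_w[symmetric] by (rule \<rho>n_int) measurable
      then show ?thesis by (simp add: scaleR_conv_of_real divide_inverse mult.commute)
    qed
    moreover have "char \<rho> \<theta> = N\<eta> \<theta> / of_real c"
    proof -
      have "char \<rho> \<theta> = N\<eta> \<theta> /\<^sub>R c"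
        unfolding char_def int_w\<nu>[symmetric] by (rule \<rho>_int) measurable
      then show ?thesis by (simp add: scaleR_conv_of_real divide_inverse mult.commute)
    qed
    ultimately show "(\<lambda>n. char (\<rho>n n) \<theta>) \<longlonglongrightarrow> char \<rho> \<theta>" by simp
  qed
  \<comment> \<open>This test function undoes the weight on the interval. It is bounded, and it can
    jump only at 1 and 2, which the limit does not charge, so weak convergence applies to
    it.\<close>
  define f :: "real \<Rightarrow> real" where "f y = indicator {1<..2} y / (1 - cos y)" for y
  have wf: "(1 - cos y) *\<^sub>R f y = indicator {1<..2} y" for y
    using cos_le[of y] cos1 by (auto simp: f_def indicator_def)
  have f_meas [measurable]: "f \<in> borel_measurable borel" unfolding f_def[abs_def] by measurable
  have f_bdd: "norm (f y) \<le> 1 / (1 - cos 1)" for y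
    using cos_le[of y] cos1 by (auto simp: f_def indicator_def frac_le)
  have "\<rho> {x. \<not> isCont f x} = 0"
  proof -
    have "isCont f x" if "x \<noteq> 1" "x \<noteq> 2" for x
    proof (cases "1 < x \<and> x < 2")
      case True
      then have "\<forall>\<^sub>F y in nhds x. y \<in> {1<..<2}" by (intro eventually_nhds_in_open) auto
      then have "\<forall>\<^sub>F y in nhds x. f y = 1 / (1 - cos y)" by eventually_elim (auto simp: f_def)
      moreover have "isCont (\<lambda>y. 1 / (1 - cos y)) x"
        using cos_le[of x] True cos1 by (intro continuous_intros) auto
      ultimately show ?thesis by (simp add: isCont_cong)
    next
      case False
      then have "\<forall>\<^sub>F y in nhds x. y \<in> {..<1} \<union> {2<..}" using that by (intro eventually_nhds_in_open) auto
      then have "\<forall>\<^sub>F y in nhds x. f y = 0" by eventually_elim (auto simp: f_def)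
      then show ?thesis using isCont_cong[of f "\<lambda>_. 0" x] by simp
    qed
    then have "{x. \<not> isCont f x} \<subseteq> {1, 2}" by blast
    moreover have "emeasure \<rho> {1, 2} = 0"
    proof -
      have "{1, 2} \<in> null_sets \<nu>" using null by (auto simp: null_sets_def sets)
      moreover have "absolutely_continuous \<nu> \<rho>"
        unfolding \<rho>_def by (intro absolutely_continuousI_density) measurable
      ultimately show ?thesis by (auto simp: absolutely_continuous_def)
    qed
    ultimately show ?thesis
      using emeasure_mono[of "{x. \<not> isCont f x}" "{1,2}" \<rho>] real_distribution.events_eq_borel[OF \<rho>] by auto
  qed
  from weak_conv_imp_bdd_ae_continuous_conv[OF \<rho>n \<rho> weak this f_bdd f_meas]
  have "(\<lambda>n. measure (law (t (n + k))) {1<..2} / cn (n + k)) \<longlonglongrightarrow> measure \<nu> {1<..2} / c"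
    unfolding \<rho>n_int[OF f_meas] \<rho>_int[OF f_meas] wf ind[OF sets] ind[OF sets_law]
    by (simp only: divide_inverse real_scaleR_def mult.commute)
  then have "(\<lambda>n. measure (law (t n)) {1<..2} / cn n) \<longlonglongrightarrow> measure \<nu> {1<..2} / c"
    by (rule LIMSEQ_offset)
  from tendsto_mult[OF this cn_lim]
  have "(\<lambda>n. measure (law (t n)) {1<..2} / cn n * (cn n / t n)) \<longlonglongrightarrow> measure \<nu> {1<..2}"
    using c by simp
  then show ?thesis
  proof (rule Lim_transform_eventually)
    show "\<forall>\<^sub>F n in sequentially. measure (law (t n)) {1<..2} / cn n * (cn n / t n) = measure (law (t n)) {1<..2} / t n"
      using eventually_ge_at_top[of k]
      by eventually_elim (auto dest!: k simp del: zero_less_divide_iff)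
  qed
qed

end

lemma stable_levy_measure_null: "emeasure (stable_levy_measure \<alpha>) {1, 2} = 0"
proof -
  have "{1, 2::real} \<in> null_sets lborel" by (intro finite_imp_null_set_lborel) auto
  moreover have "absolutely_continuous lborel (stable_levy_measure \<alpha>)"
    unfolding stable_levy_measure_def by (intro absolutely_continuousI_density) measurable
  ultimately show ?thesis by (auto simp: absolutely_continuous_def)
qed

lemma stable_levy_measure_interval:
  assumes "0 < \<alpha>"
  shows "measure (stable_levy_measure \<alpha>) {1<..2} = (1 - 2 powr (-\<alpha>)) / \<alpha>"
proof -
  have "emeasure (stable_levy_measure \<alpha>) {1<..2}
      = (\<integral>\<^sup>+y. ennreal (\<bar>y\<bar> powr (-1 - \<alpha>)) * indicator {1<..2} y \<partial>lborel)"
    unfolding stable_levy_measure_def by (intro emeasure_density) auto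
  also have "\<dots> = (\<integral>\<^sup>+y. ennreal (\<bar>y\<bar> powr (-1 - \<alpha>)) * indicator {1..2} y \<partial>lborel)"
    by (intro nn_integral_cong_AE eventually_mono[OF AE_lborel_singleton[of 1]]) (auto simp: indicator_def)
  also have "\<dots> = ennreal ((\<lambda>y. - (y powr (-\<alpha>)) / \<alpha>) 2 - (\<lambda>y. - (y powr (-\<alpha>)) / \<alpha>) 1)"
  proof (rule nn_integral_FTC_Icc)
    fix y :: real assume "y \<in> {1..2}"
    then have y: "1 \<le> y" by simp
    have "((\<lambda>y. - (y powr (-\<alpha>)) / \<alpha>) has_real_derivative - ((-\<alpha>) * y powr (-\<alpha> - 1)) / \<alpha>) (at y)"
      using y by (auto intro!: derivative_eq_intros)
    moreover have "- ((-\<alpha>) * y powr (-\<alpha> - 1)) / \<alpha> = \<bar>y\<bar> powr (-1 - \<alpha>)"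
    proof -
      have "-\<alpha> - 1 = -1 - \<alpha>" "\<bar>y\<bar> = y" using y by auto
      then show ?thesis using assms by (simp only:) simp
    qed
    ultimately show "((\<lambda>y. - (y powr (-\<alpha>)) / \<alpha>) has_real_derivative \<bar>y\<bar> powr (-1 - \<alpha>)) (at y)"
      by (simp only:)
  qed auto
  also have "\<dots> = ennreal ((1 - 2 powr (-\<alpha>)) / \<alpha>)" using assms by (simp add: diff_divide_distrib)
  finally have "emeasure (stable_levy_measure \<alpha>) {1<..2} = ennreal ((1 - 2 powr (-\<alpha>)) / \<alpha>)" .
  moreover have "0 \<le> (1 - 2 powr (-\<alpha>)) / \<alpha>"
    using assms powr_mono[of "-\<alpha>" 0 2] by simp
  ultimately show ?thesis by (rule measure_eq_emeasure_eq_ennreal[rotated])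
qed

section \<open>The one-dimensional tail of a symmetric stable process\<close>

locale stable_motion = symmetric_stable_process M \<alpha> X
  for M :: "'w measure" and \<alpha> :: real and X :: "real \<Rightarrow> 'w \<Rightarrow> real" +
  assumes index: "0 < \<alpha>" "\<alpha> < 2"
begin

lemma sets_law [simp, measurable_cong]: "sets (law t) = sets borel"
  by (simp add: law_def)

definition upper_tail :: "real \<Rightarrow> real" where "upper_tail x = measure (law 1) {x<..}"

lemma upper_tail_bounds: "0 \<le> upper_tail x" "upper_tail x \<le> 1"
  using real_distribution_law[of 1] by (auto simp: upper_tail_def real_distribution_def intro!: prob_space.prob_le_1)

lemma upper_tail_antimono: "x \<le> y \<Longrightarrow> upper_tail y \<le> upper_tail x"
  using real_distribution_law[of 1] unfolding upper_tail_def
  by (intro finite_measure.finite_measure_mono) (auto simp: real_distribution_def prob_space_def)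

lemma upper_tail_measurable [measurable]: "upper_tail \<in> borel_measurable borel"
proof -
  have "(\<lambda>x. - upper_tail x) \<in> borel_measurable borel"
    by (rule borel_measurable_mono) (auto intro!: monoI upper_tail_antimono)
  then have "(\<lambda>x. - (- upper_tail x)) \<in> borel_measurable borel" by measurable
  then show ?thesis by simp
qed

lemma prob_less:
  assumes "0 < t"
  shows "prob {\<omega>\<in>space M. x < X t \<omega>} = upper_tail (x / t powr (1 / \<alpha>))"
proof -
  have [measurable]: "X t \<in> borel_measurable M" "X 1 \<in> borel_measurable M"
    using assms by (auto intro: measurable_process)
  have "prob {\<omega>\<in>space M. x < X t \<omega>} = measure (distr M borel (\<lambda>\<omega>. X t \<omega> / t powr (1 / \<alpha>))) {x / t powr (1 / \<alpha>)<..}"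
    using assms by (subst measure_distr) (auto intro!: arg_cong[where f=prob] simp: divide_less_cancel)
  then show ?thesis using self_similar[OF assms] by (simp add: upper_tail_def law_def)
qed

lemma prob_less_uminus:
  assumes "0 \<le> t"
  shows "prob {\<omega>\<in>space M. X t \<omega> < - x} = prob {\<omega>\<in>space M. x < X t \<omega>}"
proof -
  have [measurable]: "X t \<in> borel_measurable M" using assms by (rule measurable_process)
  have "prob {\<omega>\<in>space M. X t \<omega> < - x} = measure (distr M borel (\<lambda>\<omega>. - X t \<omega>)) {x<..}"
    by (subst measure_distr) (auto intro!: arg_cong[where f=prob])
  also have "\<dots> = prob {\<omega>\<in>space M. x < X t \<omega>}"
    unfolding symmetric[OF assms] by (subst measure_distr) (auto intro!: arg_cong[where f=prob])
  finally show ?thesis .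
qed

text \<open>By symmetry the events beyond x and beyond -x are disjoint and equally likely. The bound
  keeps the denominator in Ottaviani's estimate at least 1/2.\<close>

lemma upper_tail_le_half:
  assumes "0 \<le> x"
  shows "upper_tail x \<le> 1/2"
proof -
  have [measurable]: "X 1 \<in> borel_measurable M" by (rule measurable_process) simp
  have "2 * upper_tail x = prob {\<omega>\<in>space M. X 1 \<omega> < - x} + prob {\<omega>\<in>space M. x < X 1 \<omega>}"
    using prob_less_uminus[of 1 x] prob_less[of 1 x] by simp
  also have "\<dots> = prob ({\<omega>\<in>space M. X 1 \<omega> < - x} \<union> {\<omega>\<in>space M. x < X 1 \<omega>})"
    using assms by (intro finite_measure_Union[symmetric]) auto
  also have "\<dots> \<le> 1" by simp
  finally show ?thesis by simp
qed

lemma upper_tail_tendsto: "(upper_tail \<longlongrightarrow> 0) at_top"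
proof -
  interpret L: real_distribution "law 1" by (rule real_distribution_law) simp
  have "upper_tail = (\<lambda>x. 1 - cdf (law 1) x)"
    using L.prob_compl[of "{.._}"] by (simp add: fun_eq_iff upper_tail_def cdf_def Compl_atMost[symmetric] Compl_eq_Diff_UNIV del: Compl_atMost)
  then show ?thesis
    using tendsto_diff[OF tendsto_const[of 1] L.cdf_lim_at_top_prob] by simp
qed

text \<open>At time t = x^-\<alpha> self-similarity maps the shell from x to 2x at time 1 to the
  interval from 1 to 2, so the small-time limit is exactly the dyadic difference asymptotics. The
  jump measure of that interval supplies the factor 1 - 2^-\<alpha> and the constant
  1/\<alpha>.\<close>

lemma upper_tail_asymp: "((\<lambda>x. x powr \<alpha> * upper_tail x) \<longlongrightarrow> 1 / \<alpha>) at_top"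
proof (rule tendsto_of_dyadic_differences[OF index(1) upper_tail_tendsto], rule tendsto_at_topI_sequentially)
  fix x :: "nat \<Rightarrow> real" assume x: "filterlim x at_top sequentially"
  \<comment> \<open>The cut-off at 1 makes every \<open>t n\<close> positive and well behaved;
    eventually it has no effect.\<close>
  define t where "t n = (max 1 (x n)) powr (-\<alpha>)" for n
  have t0: "0 < t n" for n by (simp add: t_def)
  have ev: "\<forall>\<^sub>F n in sequentially. 1 \<le> x n" using x by (auto simp: filterlim_at_top)
  have "filterlim (\<lambda>n. max 1 (x n)) at_top sequentially"
    using x by (rule filterlim_at_top_mono) auto
  then have t: "t \<longlonglongrightarrow> 0"
    unfolding t_def using index by (intro tendsto_neg_powr) auto
  have "0 < measure (stable_levy_measure \<alpha>) {1<..2}"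
    using stable_levy_measure_interval[OF index(1)] index powr_less_mono[of "-\<alpha>" 0 2] by simp
  from small_time_tail[OF levy_triplet t0 t stable_levy_measure_null this]
  have lim: "(\<lambda>n. measure (law (t n)) {1<..2} / t n) \<longlonglongrightarrow> (1 - 2 powr (-\<alpha>)) * (1 / \<alpha>)"
    using stable_levy_measure_interval[OF index(1)] by simp
  show "(\<lambda>n. x n powr \<alpha> * (upper_tail (x n) - upper_tail (2 * x n))) \<longlonglongrightarrow> (1 - 2 powr (-\<alpha>)) * (1 / \<alpha>)"
  proof (rule Lim_transform_eventually[OF lim])
    show "\<forall>\<^sub>F n in sequentially. measure (law (t n)) {1<..2} / t n
        = x n powr \<alpha> * (upper_tail (x n) - upper_tail (2 * x n))"
      using ev
    proof eventually_elim
      fix n assume n: "1 \<le> x n"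
      have [measurable]: "X (t n) \<in> borel_measurable M" using t0[of n] by (intro measurable_process) simp
      have tn: "t n = x n powr (-\<alpha>)" using n by (simp add: t_def max_def)
      have scale: "t n powr (1 / \<alpha>) = inverse (x n)"
        unfolding tn powr_powr using n index by (simp add: powr_minus)
      have "measure (law (t n)) {1<..2} = prob ({\<omega>\<in>space M. 1 < X (t n) \<omega>} - {\<omega>\<in>space M. 2 < X (t n) \<omega>})"
        unfolding law_def by (subst measure_distr) (auto intro!: arg_cong[where f=prob])
      also have "\<dots> = prob {\<omega>\<in>space M. 1 < X (t n) \<omega>} - prob {\<omega>\<in>space M. 2 < X (t n) \<omega>}"
        by (intro finite_measure_Diff) auto
      also have "\<dots> = upper_tail (x n) - upper_tail (2 * x n)"
        unfolding prob_less[OF t0] scale using n by (simp add: divide_inverse)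
      finally show "measure (law (t n)) {1<..2} / t n = x n powr \<alpha> * (upper_tail (x n) - upper_tail (2 * x n))"
        using n by (simp add: tn powr_minus divide_inverse)
    qed
  qed
qed

text \<open>From 1 - exp (-s) <= s. At \<theta> = 1/y it controls the second moment truncated at y,
  since 1 - cos is bounded below by a multiple of the square there.\<close>

lemma expectation_one_minus_cos:
  obtains \<gamma> where "0 < \<gamma>"
    "\<And>t \<theta>. 0 \<le> t \<Longrightarrow> expectation (\<lambda>\<omega>. 1 - cos (\<theta> * X t \<omega>)) \<le> \<gamma> * t * \<bar>\<theta>\<bar> powr \<alpha>"
proof -
  obtain \<gamma> where \<gamma>: "0 < \<gamma>" "\<And>t \<theta>. 0 \<le> t \<Longrightarrow>
      char (distr M borel (X t)) \<theta> = of_real (exp (- \<gamma> * t * \<bar>\<theta>\<bar> powr \<alpha>))"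
    using stable_char by blast
  have "expectation (\<lambda>\<omega>. 1 - cos (\<theta> * X t \<omega>)) \<le> \<gamma> * t * \<bar>\<theta>\<bar> powr \<alpha>" if t: "0 \<le> t" for t \<theta>
  proof -
    have [measurable]: "X t \<in> borel_measurable M" using t by (rule measurable_process)
    have i: "complex_integrable M (\<lambda>\<omega>. iexp (\<theta> * X t \<omega>))" by (intro integrable_iexp) auto
    have "exp (- \<gamma> * t * \<bar>\<theta>\<bar> powr \<alpha>) = Re (CLINT \<omega>|M. iexp (\<theta> * X t \<omega>))"
      using \<gamma>(2)[OF t, of \<theta>] unfolding char_def by (subst (asm) integral_distr) auto
    also have "\<dots> = expectation (\<lambda>\<omega>. cos (\<theta> * X t \<omega>))"
      using i by (subst integral_Re[symmetric]) (auto simp: Re_exp)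
    finally have "expectation (\<lambda>\<omega>. cos (\<theta> * X t \<omega>)) = exp (- (\<gamma> * t * \<bar>\<theta>\<bar> powr \<alpha>))" by simp
    moreover have "integrable M (\<lambda>\<omega>. cos (\<theta> * X t \<omega>))"
      by (intro integrable_const_bound[where B=1]) auto
    ultimately show ?thesis
      using exp_ge_add_one_self[of "- (\<gamma> * t * \<bar>\<theta>\<bar> powr \<alpha>)"] by (simp add: prob_space)
  qed
  then show ?thesis using \<gamma>(1) that by blast
qed

end

section \<open>Path maxima and independent killing\<close>

text \<open>Decompose by the first index j at which the partial sum exceeds x. Independently of that
  event the remaining increments sum to at least -y with probability at least c, and then the full
  sum is still above x - y.\<close>

lemma (in prob_space) ottaviani:
  fixes D :: "nat \<Rightarrow> 'a \<Rightarrow> real"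
  assumes ind: "indep_vars (\<lambda>_. borel) D {..<n}"
    and c: "\<And>j. j \<le> n \<Longrightarrow> c \<le> prob {\<omega>\<in>space M. - y \<le> (\<Sum>i\<in>{j..<n}. D i \<omega>)}"
  shows "c * prob {\<omega>\<in>space M. \<exists>j\<le>n. x < (\<Sum>i<j. D i \<omega>)} \<le> prob {\<omega>\<in>space M. x - y < (\<Sum>i<n. D i \<omega>)}"
proof -
  have [measurable]: "D i \<in> borel_measurable M" if "i < n" for i
    using ind that by (auto simp: indep_vars_def)
  define A where "A j = {\<omega>\<in>space M. x < (\<Sum>i<j. D i \<omega>) \<and> (\<forall>k<j. (\<Sum>i<k. D i \<omega>) \<le> x)}" for j
  define U where "U j = {\<omega>\<in>space M. - y \<le> (\<Sum>i\<in>{j..<n}. D i \<omega>)}" for j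
  have sum_meas: "(\<lambda>\<omega>. \<Sum>i\<in>I. D i \<omega>) \<in> borel_measurable M" if "I \<subseteq> {..<n}" for I
    using that by (intro borel_measurable_sum) auto
  have A_sets [measurable]: "A j \<in> sets M" if "j \<le> n" for j
  proof -
    have [measurable]: "(\<lambda>\<omega>. \<Sum>i<j. D i \<omega>) \<in> borel_measurable M" using that by (intro sum_meas) auto
    have "{\<omega>\<in>space M. \<forall>k\<in>{..<j}. (\<Sum>i<k. D i \<omega>) \<le> x} \<in> sets M"
    proof (intro sets.sets_Collect_finite_All)
      fix k assume "k \<in> {..<j}"
      then have [measurable]: "(\<lambda>\<omega>. \<Sum>i<k. D i \<omega>) \<in> borel_measurable M" using that by (intro sum_meas) auto
      show "{\<omega>\<in>space M. (\<Sum>i<k. D i \<omega>) \<le> x} \<in> sets M" by measurable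
    qed auto
    moreover have "{\<omega>\<in>space M. x < (\<Sum>i<j. D i \<omega>)} \<in> sets M" by measurable
    ultimately have "{\<omega>\<in>space M. x < (\<Sum>i<j. D i \<omega>)} \<inter> {\<omega>\<in>space M. \<forall>k\<in>{..<j}. (\<Sum>i<k. D i \<omega>) \<le> x} \<in> sets M"
      by (intro sets.Int)
    moreover have "A j = {\<omega>\<in>space M. x < (\<Sum>i<j. D i \<omega>)} \<inter> {\<omega>\<in>space M. \<forall>k\<in>{..<j}. (\<Sum>i<k. D i \<omega>) \<le> x}"
      by (auto simp: A_def)
    ultimately show ?thesis by (simp only:)
  qed
  have U_sets [measurable]: "U j \<in> sets M" if "j \<le> n" for j
  proof -
    have [measurable]: "(\<lambda>\<omega>. \<Sum>i\<in>{j..<n}. D i \<omega>) \<in> borel_measurable M" by (intro sum_meas) auto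
    show ?thesis unfolding U_def by measurable
  qed
  have disj: "A i \<inter> A j = {}" if "i \<noteq> j" for i j
    using that by (cases i j rule: linorder_cases) (force simp: A_def)+
  have union: "{\<omega>\<in>space M. \<exists>j\<le>n. x < (\<Sum>i<j. D i \<omega>)} = (\<Union>j\<in>{..n}. A j)"
  proof (intro equalityI subsetI)
    fix \<omega> assume "\<omega> \<in> {\<omega>\<in>space M. \<exists>j\<le>n. x < (\<Sum>i<j. D i \<omega>)}"
    then obtain j where j: "\<omega> \<in> space M" "j \<le> n" "x < (\<Sum>i<j. D i \<omega>)" by blast
    define k where "k = (LEAST j. x < (\<Sum>i<j. D i \<omega>))"
    have "x < (\<Sum>i<k. D i \<omega>)" "k \<le> j" unfolding k_def using j(3) by (auto intro: LeastI Least_le)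
    moreover have "(\<Sum>i<l. D i \<omega>) \<le> x" if "l < k" for l
      using not_less_Least[of l "\<lambda>j. x < (\<Sum>i<j. D i \<omega>)"] that unfolding k_def by simp
    ultimately have "\<omega> \<in> A k" "k \<le> n" using j by (auto simp: A_def)
    then show "\<omega> \<in> (\<Union>j\<in>{..n}. A j)" by blast
  qed (auto simp: A_def)
  have product: "prob (A j \<inter> U j) = prob (A j) * prob (U j)" if j: "j \<le> n" for j
  proof -
    let ?L = "\<lambda>\<omega>. restrict (\<lambda>i. D i \<omega>) {..<j}" and ?R = "\<lambda>\<omega>. restrict (\<lambda>i. D i \<omega>) {j..<n}"
    let ?P = "\<lambda>I. Pi\<^sub>M I (\<lambda>_. borel) :: (nat \<Rightarrow> real) measure"
    have LR: "indep_var (?P {..<j}) ?L (?P {j..<n}) ?R"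
      using j by (intro indep_var_restrict[OF ind]) auto
    have sum_P: "(\<lambda>f. \<Sum>i\<in>K. f i) \<in> borel_measurable (?P I)" if "K \<subseteq> I" for K I
      using that by (intro borel_measurable_sum measurable_component_singleton) auto
    have 1: "{f\<in>space (?P {..<j}). x < (\<Sum>i<j. f i) \<and> (\<forall>k\<in>{..<j}. (\<Sum>i<k. f i) \<le> x)} \<in> sets (?P {..<j})" (is "?SA \<in> _")
    proof -
      have [measurable]: "(\<lambda>f. \<Sum>i<j. f i) \<in> borel_measurable (?P {..<j})" by (rule sum_P) auto
      have [measurable]: "(\<lambda>f. \<Sum>i<k. f i) \<in> borel_measurable (?P {..<j})" if "k \<in> {..<j}" for k
        using that by (intro sum_P) auto
      have "{f\<in>space (?P {..<j}). \<forall>k\<in>{..<j}. (\<Sum>i<k. f i) \<le> x} \<in> sets (?P {..<j})"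
        by (intro sets.sets_Collect_finite_All) (auto intro!: borel_measurable_le sum_P)
      moreover have "{f\<in>space (?P {..<j}). x < (\<Sum>i<j. f i)} \<in> sets (?P {..<j})" by measurable
      ultimately have "{f\<in>space (?P {..<j}). x < (\<Sum>i<j. f i)} \<inter> {f\<in>space (?P {..<j}). \<forall>k\<in>{..<j}. (\<Sum>i<k. f i) \<le> x} \<in> sets (?P {..<j})"
        by (intro sets.Int)
      also have "{f\<in>space (?P {..<j}). x < (\<Sum>i<j. f i)} \<inter> {f\<in>space (?P {..<j}). \<forall>k\<in>{..<j}. (\<Sum>i<k. f i) \<le> x} = ?SA"
        by auto
      finally show ?thesis .
    qed
    have 2: "{f\<in>space (?P {j..<n}). - y \<le> (\<Sum>i\<in>{j..<n}. f i)} \<in> sets (?P {j..<n})" (is "?SU \<in> _")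
    proof -
      have [measurable]: "(\<lambda>f. \<Sum>i\<in>{j..<n}. f i) \<in> borel_measurable (?P {j..<n})" by (rule sum_P) auto
      show ?thesis by measurable
    qed
    have sp: "restrict (\<lambda>i. D i \<omega>) I \<in> space (?P I)" for I \<omega> by (simp add: space_PiM)
    have sums: "(\<Sum>i<k. restrict (\<lambda>i. D i \<omega>) {..<j} i) = (\<Sum>i<k. D i \<omega>)" if "k \<le> j" for k \<omega>
      using that by (intro sum.cong) auto
    have A: "?L -` ?SA \<inter> space M = A j"
      using sp sums by (auto simp: A_def)
    have U: "?R -` ?SU \<inter> space M = U j"
      using sp by (auto simp: U_def)
    have "(\<lambda>x. (?L x, ?R x)) -` (?SA \<times> ?SU) \<inter> space M = A j \<inter> U j"
      using A U by blast
    with indep_varD[OF LR 1 2] show ?thesis unfolding A U by simp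
  qed
  have "c * prob (\<Union>j\<in>{..n}. A j) = (\<Sum>j\<le>n. c * prob (A j))"
    using disj by (subst finite_measure_finite_Union)
      (auto simp: disjoint_family_on_def sum_distrib_left)
  also have "\<dots> \<le> (\<Sum>j\<le>n. prob (A j \<inter> U j))"
  proof (intro sum_mono)
    fix j assume j: "j \<in> {..n}"
    have "c * prob (A j) \<le> prob (U j) * prob (A j)"
      using c[of j] j unfolding U_def by (intro mult_right_mono) auto
    then show "c * prob (A j) \<le> prob (A j \<inter> U j)" using product[of j] j by (simp add: mult.commute)
  qed
  also have "\<dots> = prob (\<Union>j\<in>{..n}. A j \<inter> U j)"
    using disj by (intro finite_measure_finite_Union[symmetric]) (auto simp: disjoint_family_on_def)
  also have "\<dots> \<le> prob {\<omega>\<in>space M. x - y < (\<Sum>i<n. D i \<omega>)}"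
  proof (rule finite_measure_mono)
    show "(\<Union>j\<in>{..n}. A j \<inter> U j) \<subseteq> {\<omega>\<in>space M. x - y < (\<Sum>i<n. D i \<omega>)}"
    proof (intro UN_least subsetI)
      fix j \<omega> assume "j \<in> {..n}" and w: "\<omega> \<in> A j \<inter> U j"
      then have "(\<Sum>i<n. D i \<omega>) = (\<Sum>i<j. D i \<omega>) + (\<Sum>i\<in>{j..<n}. D i \<omega>)"
        using sum.atLeastLessThan_concat[of 0 j n "\<lambda>i. D i \<omega>"] by (simp add: lessThan_atLeast0)
      then show "\<omega> \<in> {\<omega>\<in>space M. x - y < (\<Sum>i<n. D i \<omega>)}" using w by (auto simp: A_def U_def)
    qed
    have [measurable]: "(\<lambda>\<omega>. \<Sum>i<n. D i \<omega>) \<in> borel_measurable M" by (intro sum_meas) auto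
    show "{\<omega>\<in>space M. x - y < (\<Sum>i<n. D i \<omega>)} \<in> sets M" by measurable
  qed
  finally show ?thesis unfolding union .
qed

lemma right_continuous_jointly_measurable:
  fixes X :: "real \<Rightarrow> 'w \<Rightarrow> real"
  assumes X: "\<And>t. 0 \<le> t \<Longrightarrow> X t \<in> borel_measurable N"
    and cont: "\<And>\<omega> t. \<omega> \<in> space N \<Longrightarrow> 0 \<le> t \<Longrightarrow> ((\<lambda>s. X s \<omega>) \<longlongrightarrow> X t \<omega>) (at_right t)"
  shows "(\<lambda>p. X (max 0 (fst p)) (snd p)) \<in> borel_measurable (borel \<Otimes>\<^sub>M N)"
proof (rule borel_measurable_LIMSEQ_real)
  \<comment> \<open>The dyadic approximation from above. The +1 makes it strictly larger than t, so
    that right continuity applies; each approximant takes countably many values, so the composed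
    path is measurable.\<close>
  let ?d = "\<lambda>k t :: real. (real (nat \<lfloor>2 ^ k * max 0 t\<rfloor>) + 1) / 2 ^ k"
  show "(\<lambda>p. X (?d k (fst p)) (snd p)) \<in> borel_measurable (borel \<Otimes>\<^sub>M N)" for k
  proof (rule measurable_compose_countable[where f="\<lambda>i p. X ((real i + 1) / 2 ^ k) (snd p)"])
    show "(\<lambda>p. X ((real i + 1) / 2 ^ k) (snd p)) \<in> borel_measurable (borel \<Otimes>\<^sub>M N)" for i
      by (intro measurable_compose[OF measurable_snd] X) auto
  qed measurable
  fix p :: "real \<times> 'w" assume "p \<in> space (borel \<Otimes>\<^sub>M N)"
  then have w: "snd p \<in> space N" by (auto simp: space_pair_measure)
  define t where "t = max 0 (fst p)"
  have t0: "0 \<le> t" by (simp add: t_def)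
  have up: "t < ?d k t" "?d k t \<le> t + 1 / 2 ^ k" for k
  proof -
    have r: "real (nat \<lfloor>2 ^ k * t\<rfloor>) = of_int \<lfloor>2 ^ k * t\<rfloor>" using t0 by simp
    have "t * 2 ^ k < real (nat \<lfloor>2 ^ k * t\<rfloor>) + 1" "real (nat \<lfloor>2 ^ k * t\<rfloor>) \<le> t * 2 ^ k"
      unfolding r by (linarith | simp add: mult.commute)+
    then show "t < ?d k t" "?d k t \<le> t + 1 / 2 ^ k"
      using t0 by (auto simp: field_simps max_def)
  qed
  have "(\<lambda>k. t + (1 / 2) ^ k) \<longlonglongrightarrow> t + 0"
    by (intro tendsto_intros LIMSEQ_realpow_zero) auto
  then have "(\<lambda>k. t + (1 / 2) ^ k) \<longlonglongrightarrow> t" by simp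
  then have "(\<lambda>k. ?d k t) \<longlonglongrightarrow> t"
  proof (rule tendsto_sandwich[of "\<lambda>_. t", rotated 3])
    show "\<forall>\<^sub>F k in sequentially. t \<le> ?d k t"
      by (intro always_eventually allI less_imp_le up(1))
    show "\<forall>\<^sub>F k in sequentially. ?d k t \<le> t + (1 / 2) ^ k"
      unfolding power_one_over by (intro always_eventually allI up(2))
  qed simp
  then have "filterlim (\<lambda>k. ?d k t) (at_right t) sequentially"
    using less_imp_neq[OF up(1), THEN not_sym] up(1)
    unfolding filterlim_at by (intro conjI always_eventually allI) simp_all
  from filterlim_compose[OF cont[OF w t0] this]
  show "(\<lambda>k. X (?d k (fst p)) (snd p)) \<longlonglongrightarrow> X (max 0 (fst p)) (snd p)"
    by (simp add: t_def)
qed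

context stable_motion
begin

text \<open>Ottaviani for the increments between grid times. By symmetry and scaling, an increment
  over a time at most t falls below -y with probability at most
  \<open>upper_tail (y / t powr (1 / \<alpha>))\<close>, whatever the mesh.\<close>

lemma prob_grid_max_le:
  assumes t: "0 < t" and N: "0 < N" and y: "0 \<le> y"
  shows "(1 - upper_tail (y / t powr (1 / \<alpha>))) * prob {\<omega>\<in>space M. \<exists>i\<le>N. x < X (t * (real i / real N)) \<omega>}
     \<le> upper_tail ((x - y) / t powr (1 / \<alpha>))"
proof -
  \<comment> \<open>Beyond \<open>N\<close> the grid is frozen at t: the sequence stays monotone on
    all naturals, as \<open>indep_increments\<close> demands, and never leaves [0, t].\<close>
  define s where "s i = t * (min (real i) (real N) / real N)" for i :: nat
  have s: "0 \<le> s i" "s i \<le> t" for i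
    using t N by (auto simp: s_def field_simps mult_left_le min_def)
  have s0: "s 0 = 0" and sN: "s N = t" using N by (auto simp: s_def)
  have si: "s i = t * (real i / real N)" if "i \<le> N" for i using that by (simp add: s_def)
  have mono: "mono s" using t by (auto simp: s_def mono_def intro!: divide_right_mono)
  have [measurable]: "X (s i) \<in> borel_measurable M" for i using s by (intro measurable_process)
  let ?D = "\<lambda>i \<omega>. X (s (Suc i)) \<omega> - X (s i) \<omega>"
  have tele: "(\<Sum>i\<in>{j..<n}. ?D i \<omega>) = X (s n) \<omega> - X (s j) \<omega>" if "j \<le> n" for j n \<omega>
    using that by (rule sum_Suc_diff')
  have tele0: "(\<Sum>i<n. ?D i \<omega>) = X (s n) \<omega> - X 0 \<omega>" for n \<omega>
    using tele[of 0 n \<omega>] s0 by (simp add: lessThan_atLeast0)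
  have c: "1 - upper_tail (y / t powr (1 / \<alpha>)) \<le> prob {\<omega>\<in>space M. - y \<le> (\<Sum>i\<in>{j..<N}. ?D i \<omega>)}"
    if j: "j \<le> N" for j
  proof -
    let ?h = "t - s j"
    have h: "0 \<le> ?h" using s(2)[of j] by simp
    have [measurable]: "X ?h \<in> borel_measurable M" using h by (rule measurable_process)
    have "prob {\<omega>\<in>space M. - y \<le> (\<Sum>i\<in>{j..<N}. ?D i \<omega>)} = measure (distr M borel (\<lambda>\<omega>. X (s j + ?h) \<omega> - X (s j) \<omega>)) {-y..}"
      unfolding tele[OF j] using sN by (subst measure_distr) (auto intro!: arg_cong[where f=prob])
    also have "\<dots> = prob {\<omega>\<in>space M. - y \<le> X ?h \<omega>}"
      unfolding stationary_increments[OF s(1) h] by (subst measure_distr) (auto intro!: arg_cong[where f=prob])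
    also have "\<dots> = 1 - prob {\<omega>\<in>space M. X ?h \<omega> < - y}"
      by (subst prob_neg[symmetric]) (auto intro!: arg_cong[where f=prob])
    also have "\<dots> = 1 - prob {\<omega>\<in>space M. y < X ?h \<omega>}" using prob_less_uminus[OF h] by simp
    also have "\<dots> \<ge> 1 - upper_tail (y / t powr (1 / \<alpha>))"
    \<comment> \<open>At zero remaining time there is no scaling to use; the process starts at 0
      almost surely and y is nonnegative.\<close>
    proof (cases "?h = 0")
      case True
      have "prob {\<omega>\<in>space M. y < X ?h \<omega>} = 0"
        unfolding True using starts_at_0 y measurable_process[of 0] by (subst prob_eq_0) (auto elim!: eventually_mono)
      then show ?thesis using upper_tail_bounds by simp
    next
      case False
      then have "0 < ?h" using h by simp
      moreover have "y / t powr (1 / \<alpha>) \<le> y / ?h powr (1 / \<alpha>)"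
        using y \<open>0 < ?h\<close> s(1)[of j] index t by (intro divide_left_mono powr_mono2) auto
      ultimately show ?thesis by (simp add: prob_less upper_tail_antimono)
    qed
    finally show ?thesis .
  qed
  have ind: "indep_vars (\<lambda>_. borel) ?D {..<N}" by (rule indep_increments) (use s0 mono in auto)
  have [measurable]: "X (t * (real i / real N)) \<in> borel_measurable M" for i
    using t by (intro measurable_process) auto
  have [measurable]: "X t \<in> borel_measurable M" "X 0 \<in> borel_measurable M"
    using t by (auto intro: measurable_process)
  have "prob {\<omega>\<in>space M. \<exists>i\<le>N. x < X (t * (real i / real N)) \<omega>} = prob {\<omega>\<in>space M. \<exists>j\<le>N. x < (\<Sum>i<j. ?D i \<omega>)}"
  proof (rule prob_eq_AE)
    show "AE \<omega> in M. (\<exists>i\<le>N. x < X (t * (real i / real N)) \<omega>) \<longleftrightarrow> (\<exists>j\<le>N. x < (\<Sum>i<j. ?D i \<omega>))"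
      using starts_at_0 by eventually_elim (auto simp: tele0 si)
  qed measurable
  moreover have "prob {\<omega>\<in>space M. x - y < (\<Sum>i<N. ?D i \<omega>)} = prob {\<omega>\<in>space M. x - y < X t \<omega>}"
  proof (rule prob_eq_AE)
    show "AE \<omega> in M. (x - y < (\<Sum>i<N. ?D i \<omega>)) \<longleftrightarrow> x - y < X t \<omega>"
      using starts_at_0 by eventually_elim (auto simp: tele0 sN)
  qed measurable
  ultimately show ?thesis
    using ottaviani[OF ind c, of x] prob_less[OF t, of "x - y"] by simp
qed

end

text \<open>With z = x / T^(1/\<alpha>) one has x^\<alpha> = T * z^\<alpha>, so the scaled integrand
  is T times z^\<alpha> * G z. It tends to T * L pointwise and is dominated by K * T. Thus an
  independent lifetime enters the tail constant only through its mean.\<close>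

lemma (in prob_space) tendsto_scaled_expectation:
  fixes T :: "'a \<Rightarrow> real" and G :: "real \<Rightarrow> real"
  assumes T: "integrable M T" "\<And>\<omega>. \<omega> \<in> space M \<Longrightarrow> 0 < T \<omega>" and \<alpha>: "0 < \<alpha>"
    and [measurable]: "G \<in> borel_measurable borel"
    and bound: "\<And>y. 0 < y \<Longrightarrow> \<bar>G y\<bar> \<le> K * y powr (-\<alpha>)"
    and lim: "((\<lambda>y. y powr \<alpha> * G y) \<longlongrightarrow> L) at_top"
  shows "((\<lambda>x. x powr \<alpha> * expectation (\<lambda>\<omega>. G (x / T \<omega> powr (1 / \<alpha>)))) \<longlongrightarrow> expectation T * L) at_top"
proof -
  have [measurable]: "T \<in> borel_measurable M" using T(1) by simp
  have scale: "x powr \<alpha> = T \<omega> * (x / T \<omega> powr (1 / \<alpha>)) powr \<alpha>" if "0 < x" "\<omega> \<in> space M" for x \<omega>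
    using T(2)[OF that(2)] that(1) \<alpha> by (simp add: powr_divide powr_powr)
  have "((\<lambda>x. expectation (\<lambda>\<omega>. x powr \<alpha> * G (x / T \<omega> powr (1 / \<alpha>)))) \<longlongrightarrow> expectation (\<lambda>\<omega>. T \<omega> * L)) at_top"
  proof (rule integral_dominated_convergence_at_top[where w="\<lambda>\<omega>. K * T \<omega>"])
    show "\<forall>\<^sub>F x in at_top. AE \<omega> in M. norm (x powr \<alpha> * G (x / T \<omega> powr (1 / \<alpha>))) \<le> K * T \<omega>"
    proof (rule eventually_mono[OF eventually_gt_at_top[of 0]], rule AE_I2)
      fix x :: real and \<omega> assume x: "0 < x" and w: "\<omega> \<in> space M"
      define z where "z = x / T \<omega> powr (1 / \<alpha>)"
      have z: "0 < z" using x T(2)[OF w] by (simp add: z_def)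
      have "\<bar>x powr \<alpha> * G z\<bar> = T \<omega> * (z powr \<alpha> * \<bar>G z\<bar>)"
        using scale[OF x w] T(2)[OF w] by (simp add: z_def abs_mult)
      also have "\<dots> \<le> T \<omega> * (z powr \<alpha> * (K * z powr (-\<alpha>)))"
        using bound[OF z] T(2)[OF w] by (intro mult_left_mono) auto
      also have "\<dots> = K * T \<omega>" using z by (simp add: powr_minus field_simps)
      finally show "norm (x powr \<alpha> * G (x / T \<omega> powr (1 / \<alpha>))) \<le> K * T \<omega>" by (simp add: z_def)
    qed
    show "AE \<omega> in M. ((\<lambda>x. x powr \<alpha> * G (x / T \<omega> powr (1 / \<alpha>))) \<longlongrightarrow> T \<omega> * L) at_top"
    proof (rule AE_I2)
      fix \<omega> assume w: "\<omega> \<in> space M"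
      have "filterlim (\<lambda>x. x / T \<omega> powr (1 / \<alpha>)) at_top at_top"
        using T(2)[OF w] filterlim_at_top_mult_tendsto_pos[OF tendsto_const[of "1 / T \<omega> powr (1 / \<alpha>)"] _ filterlim_ident]
        by simp
      from tendsto_mult_left[OF filterlim_compose[OF lim this], of "T \<omega>"]
      show "((\<lambda>x. x powr \<alpha> * G (x / T \<omega> powr (1 / \<alpha>))) \<longlongrightarrow> T \<omega> * L) at_top"
      proof (rule Lim_transform_eventually)
        show "\<forall>\<^sub>F x in at_top. T \<omega> * ((x / T \<omega> powr (1 / \<alpha>)) powr \<alpha> * G (x / T \<omega> powr (1 / \<alpha>)))
            = x powr \<alpha> * G (x / T \<omega> powr (1 / \<alpha>))"
          using eventually_gt_at_top[of 0]
        proof eventually_elim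
          fix x :: real assume "0 < x"
          from scale[OF this w]
          show "T \<omega> * ((x / T \<omega> powr (1 / \<alpha>)) powr \<alpha> * G (x / T \<omega> powr (1 / \<alpha>)))
            = x powr \<alpha> * G (x / T \<omega> powr (1 / \<alpha>))" by simp
        qed
      qed
    qed
  qed (use T in auto)
  then show ?thesis by simp
qed

lemma one_minus_cos_ge:
  fixes u :: real
  assumes "\<bar>u\<bar> \<le> 1"
  shows "cos 1 / 2 * u\<^sup>2 \<le> 1 - cos u"
proof -
  have *: "cos 1 / 2 * u\<^sup>2 \<le> 1 - cos u" if u: "0 < u" "u \<le> 1" for u :: real
  proof -
    obtain t where t: "0 < t" "t < u" and eq: "cos u = (\<Sum>m<2. cos_coeff m * u ^ m) + cos (t + 1/2 * real 2 * pi) / fact 2 * u ^ 2"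
      using Maclaurin_cos_expansion2[OF u(1), of 2] by auto
    have "cos u = 1 - cos t / 2 * u\<^sup>2"
      unfolding eq by (simp add: lessThan_Suc numeral_2_eq_2 cos_coeff_def)
    moreover have "cos 1 \<le> cos t" using t u pi_ge_two by (intro cos_monotone_0_pi_le) auto
    then have "cos 1 / 2 * u\<^sup>2 \<le> cos t / 2 * u\<^sup>2" by (intro mult_right_mono) auto
    ultimately show ?thesis by simp
  qed
  consider "u = 0" | "0 < u" | "u < 0" by linarith
  then show ?thesis
    using *[of u] *[of "-u"] assms by cases auto
qed

section \<open>Power bounds and asymptotics for grid maxima\<close>

context stable_motion
begin

lemma upper_tail_le_power: obtains K where "0 < K" "\<And>y. 0 < y \<Longrightarrow> upper_tail y \<le> K * y powr (-\<alpha>)"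
proof -
  have "\<forall>\<^sub>F y in at_top. y powr \<alpha> * upper_tail y < 1 / \<alpha> + 1"
    by (rule order_tendstoD(2)[OF upper_tail_asymp]) simp
  then obtain y0 where y0: "\<And>y. y0 \<le> y \<Longrightarrow> y powr \<alpha> * upper_tail y < 1 / \<alpha> + 1"
    by (auto simp: eventually_at_top_linorder)
  define K where "K = 1 / \<alpha> + 1 + \<bar>y0\<bar> powr \<alpha>"
  have K: "0 < K" using index by (auto simp: K_def intro!: add_pos_nonneg)
  have "upper_tail y \<le> K * y powr (-\<alpha>)" if y: "0 < y" for y
  proof -
    have "y powr \<alpha> * upper_tail y \<le> K"
    proof (cases "y0 \<le> y")
      case True
      have "y powr \<alpha> * upper_tail y \<le> 1 / \<alpha> + 1" using y0[OF True] by simp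
      also have "\<dots> \<le> K" by (simp add: K_def)
      finally show ?thesis .
    next
      case False
      then have "y powr \<alpha> * upper_tail y \<le> \<bar>y0\<bar> powr \<alpha> * 1"
        using y index upper_tail_bounds by (intro mult_mono powr_mono2) auto
      also have "\<dots> \<le> K" using index by (simp add: K_def)
      finally show ?thesis .
    qed
    then show ?thesis using y by (simp add: powr_minus field_simps)
  qed
  with K show ?thesis using that by blast
qed

text \<open>Ottaviani's bound for the maximum over a grid, at scale \<open>z = x / t\<^sup>1\<^sup>/\<^sup>\<alpha>\<close>.
  It does not depend on the mesh.\<close>

definition grid_tail :: "real \<Rightarrow> real \<Rightarrow> real" where
  "grid_tail \<epsilon> z = upper_tail ((1 - \<epsilon>) * z) / (1 - upper_tail (\<epsilon> * z))"

lemma grid_tail_measurable [measurable]: "grid_tail \<epsilon> \<in> borel_measurable borel"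
  unfolding grid_tail_def[abs_def] by measurable

lemma grid_tail_nonneg: "0 \<le> grid_tail \<epsilon> z"
  unfolding grid_tail_def using upper_tail_bounds by (intro divide_nonneg_nonneg) auto

lemma grid_tail_le:
  assumes K: "\<And>y. 0 < y \<Longrightarrow> upper_tail y \<le> K * y powr (-\<alpha>)" and \<epsilon>: "0 < \<epsilon>" "\<epsilon> < 1" and z: "0 < z"
  shows "\<bar>grid_tail \<epsilon> z\<bar> \<le> 2 * K * (1 - \<epsilon>) powr (-\<alpha>) * z powr (-\<alpha>)"
proof -
  have h: "upper_tail (\<epsilon> * z) \<le> 1/2" using \<epsilon> z by (intro upper_tail_le_half) auto
  have "grid_tail \<epsilon> z \<le> upper_tail ((1 - \<epsilon>) * z) / (1/2)"
    unfolding grid_tail_def using h upper_tail_bounds by (intro divide_left_mono) auto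
  also have "\<dots> \<le> 2 * (K * ((1 - \<epsilon>) * z) powr (-\<alpha>))"
    using K[of "(1 - \<epsilon>) * z"] \<epsilon> z by simp
  also have "\<dots> = 2 * K * (1 - \<epsilon>) powr (-\<alpha>) * z powr (-\<alpha>)"
    using \<epsilon> z by (simp add: powr_mult)
  finally show ?thesis using h upper_tail_bounds by (simp add: grid_tail_def)
qed

lemma upper_tail_scaled_asymp:
  assumes "0 < c"
  shows "((\<lambda>z. z powr \<alpha> * upper_tail (c * z)) \<longlongrightarrow> c powr (-\<alpha>) / \<alpha>) at_top"
proof -
  have "filterlim (\<lambda>z. c * z) at_top at_top"
    using assms by (intro filterlim_tendsto_pos_mult_at_top[OF tendsto_const _ filterlim_ident])
  from tendsto_mult_left[OF filterlim_compose[OF upper_tail_asymp this], of "c powr (-\<alpha>)"]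
  have "((\<lambda>z. c powr (-\<alpha>) * ((c * z) powr \<alpha> * upper_tail (c * z))) \<longlongrightarrow> c powr (-\<alpha>) / \<alpha>) at_top"
    by simp
  then show ?thesis
  proof (rule Lim_transform_eventually)
    show "\<forall>\<^sub>F z in at_top. c powr (-\<alpha>) * ((c * z) powr \<alpha> * upper_tail (c * z)) = z powr \<alpha> * upper_tail (c * z)"
      using eventually_gt_at_top[of 0]
      by eventually_elim (use assms in \<open>simp add: powr_mult powr_minus\<close>)
  qed
qed

lemma grid_tail_asymp:
  assumes \<epsilon>: "0 < \<epsilon>" "\<epsilon> < 1"
  shows "((\<lambda>z. z powr \<alpha> * grid_tail \<epsilon> z) \<longlongrightarrow> (1 - \<epsilon>) powr (-\<alpha>) / \<alpha>) at_top"
proof -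
  have "filterlim (\<lambda>z. \<epsilon> * z) at_top at_top"
    using \<epsilon> by (intro filterlim_tendsto_pos_mult_at_top[OF tendsto_const _ filterlim_ident])
  from filterlim_compose[OF upper_tail_tendsto this]
  have "((\<lambda>z. (z powr \<alpha> * upper_tail ((1 - \<epsilon>) * z)) / (1 - upper_tail (\<epsilon> * z))) \<longlongrightarrow> ((1 - \<epsilon>) powr (-\<alpha>) / \<alpha>) / (1 - 0)) at_top"
    using \<epsilon> by (intro tendsto_divide upper_tail_scaled_asymp tendsto_diff tendsto_const) auto
  then show ?thesis by (simp add: grid_tail_def)
qed

end

text \<open>\<open>N\<close> is the sample space with the sigma-algebra of the motion alone.
  Independence of \<open>T\<close> from the identity map into \<open>N\<close> says that
  \<open>T\<close> is independent of that whole sigma-algebra, so a lifetime can be frozen inside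
  the entire path.\<close>

locale killed_motion = stable_motion M \<alpha> X
  for M :: "'w measure" and \<alpha> :: real and X :: "real \<Rightarrow> 'w \<Rightarrow> real" +
  fixes T :: "'w \<Rightarrow> real" and N :: "'w measure"
  assumes T_pos: "\<And>\<omega>. \<omega> \<in> space M \<Longrightarrow> 0 < T \<omega>"
    and T_exponential: "distributed M lborel T (exponential_density 1)"
    and motion_measurable: "\<And>t. 0 \<le> t \<Longrightarrow> X t \<in> borel_measurable N"
    and space_N: "space N = space M"
    and T_indep: "indep_pair borel T N (\<lambda>\<omega>. \<omega>)"
begin

lemma T_measurable [measurable]: "T \<in> borel_measurable M"
  using distributed_measurable[OF T_exponential] by simp

lemma T_mean: "expectation T = 1" "integrable M T"
proof -
  show 1: "expectation T = 1" using exponential_distributed_expectation[OF _ T_exponential] by simp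
  show "integrable M T" using 1 not_integrable_integral_eq[of M T] by auto
qed

lemma jointly_measurable [measurable]:
  "(\<lambda>p. X (max 0 (fst p)) (snd p)) \<in> borel_measurable (borel \<Otimes>\<^sub>M N)"
  by (rule right_continuous_jointly_measurable[OF motion_measurable])
     (use cadlag_paths space_N in \<open>auto simp: cadlag_def\<close>)

lemma motion_at_measurable:
  assumes "f \<in> borel_measurable borel"
  shows "(\<lambda>p. X (max 0 (f (fst p))) (snd p)) \<in> borel_measurable (borel \<Otimes>\<^sub>M N)"
proof -
  have "(\<lambda>p. (f (fst p), snd p)) \<in> measurable (borel \<Otimes>\<^sub>M N) (borel \<Otimes>\<^sub>M N)"
    using assms by measurable
  from measurable_compose[OF this jointly_measurable] show ?thesis by simp
qed

lemma motion_at_T_measurable: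
  assumes "0 \<le> c"
  shows "(\<lambda>\<omega>. X (c * T \<omega>) \<omega>) \<in> borel_measurable M"
proof -
  have "(\<lambda>\<omega>. (T \<omega>, \<omega>)) \<in> measurable M (borel \<Otimes>\<^sub>M N)"
    using T_indep by (intro measurable_Pair) (auto simp: indep_pair_def)
  from measurable_compose[OF this motion_at_measurable[of "\<lambda>t. c * t"]]
  have "(\<lambda>\<omega>. X (max 0 (c * T \<omega>)) \<omega>) \<in> borel_measurable M" by simp
  then show ?thesis
    by (rule measurable_cong[THEN iffD1, rotated])
       (use assms T_pos in \<open>auto simp: less_imp_le max_def mult_less_0_iff not_less dest!: T_pos\<close>)
qed

lemma nn_integral_motion_at_T:
  assumes "0 \<le> c" and f: "f \<in> borel_measurable borel"
  shows "(\<integral>\<^sup>+\<omega>. f (X (c * T \<omega>) \<omega>) \<partial>M) = (\<integral>\<^sup>+\<omega>. \<integral>\<^sup>+\<omega>'. f (X (c * T \<omega>) \<omega>') \<partial>M \<partial>M)"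
proof -
  have [simp]: "max 0 (c * T \<omega>) = c * T \<omega>" if "\<omega> \<in> space M" for \<omega>
    using T_pos[OF that] assms(1) by simp
  have "(\<lambda>p. f (X (max 0 (c * fst p)) (snd p))) \<in> borel_measurable (borel \<Otimes>\<^sub>M N)"
    using motion_at_measurable[of "\<lambda>t. c * t"] f by (intro measurable_compose[OF _ f]) auto
  from nn_integral_indep_pair[OF T_indep this] show ?thesis
    by (simp cong: nn_integral_cong)
qed

lemma prob_motion_at_T:
  assumes c: "0 < c"
  shows "prob {\<omega>\<in>space M. x < X (c * T \<omega>) \<omega>} = expectation (\<lambda>\<omega>. upper_tail (x / (c * T \<omega>) powr (1 / \<alpha>)))"
proof -
  have [measurable]: "(\<lambda>\<omega>. X (c * T \<omega>) \<omega>) \<in> borel_measurable M"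
    using c by (intro motion_at_T_measurable) simp
  have "ennreal (prob {\<omega>\<in>space M. x < X (c * T \<omega>) \<omega>}) = (\<integral>\<^sup>+\<omega>. indicator {x<..} (X (c * T \<omega>) \<omega>) \<partial>M)"
    by (subst nn_integral_indicator_of) auto
  also have "\<dots> = (\<integral>\<^sup>+\<omega>. \<integral>\<^sup>+\<omega>'. indicator {x<..} (X (c * T \<omega>) \<omega>') \<partial>M \<partial>M)"
    using c by (intro nn_integral_motion_at_T) auto
  also have "\<dots> = (\<integral>\<^sup>+\<omega>. ennreal (upper_tail (x / (c * T \<omega>) powr (1 / \<alpha>))) \<partial>M)"
  proof (rule nn_integral_cong)
    fix \<omega> assume w: "\<omega> \<in> space M"
    have cT: "0 < c * T \<omega>" using c T_pos[OF w] by simp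
    then have [measurable]: "X (c * T \<omega>) \<in> borel_measurable M" by (intro measurable_process) simp
    have "(\<integral>\<^sup>+\<omega>'. indicator {x<..} (X (c * T \<omega>) \<omega>') \<partial>M) = ennreal (prob {\<omega>'\<in>space M. x < X (c * T \<omega>) \<omega>'})"
      by (subst nn_integral_indicator_of) auto
    then show "(\<integral>\<^sup>+\<omega>'. indicator {x<..} (X (c * T \<omega>) \<omega>') \<partial>M) = ennreal (upper_tail (x / (c * T \<omega>) powr (1 / \<alpha>)))"
      by (simp add: prob_less[OF cT])
  qed
  also have "\<dots> = ennreal (expectation (\<lambda>\<omega>. upper_tail (x / (c * T \<omega>) powr (1 / \<alpha>))))"
    by (intro nn_integral_eq_integral integrable_const_bound[where B=1])
       (auto simp: upper_tail_bounds)
  finally show ?thesis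
    by (subst (asm) ennreal_inj) (auto intro!: Bochner_Integration.integral_nonneg upper_tail_bounds)
qed

text \<open>Freeze the lifetime and apply \<open>prob_grid_max_le\<close> with y = \<epsilon> * x.
  The right-hand side is free of n, which later allows one barrier for all meshes.\<close>

lemma prob_grid_max_at_T:
  assumes n: "0 < n" and x: "0 < x" and \<epsilon>: "0 < \<epsilon>" "\<epsilon> < 1"
  shows "prob {\<omega>\<in>space M. \<exists>i\<le>n. x < X (real i / real n * T \<omega>) \<omega>}
    \<le> expectation (\<lambda>\<omega>. grid_tail \<epsilon> (x / T \<omega> powr (1 / \<alpha>)))"
proof -
  let ?A = "{p\<in>space (borel \<Otimes>\<^sub>M N). \<exists>i\<in>{..n}. x < X (max 0 (real i / real n * fst p)) (snd p)}"
  have "?A \<in> sets (borel \<Otimes>\<^sub>M N)"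
  proof (intro sets.sets_Collect_finite_Ex)
    fix i
    have [measurable]: "(\<lambda>p. X (max 0 (real i / real n * fst p)) (snd p)) \<in> borel_measurable (borel \<Otimes>\<^sub>M N)"
      by (rule motion_at_measurable) measurable
    show "{p\<in>space (borel \<Otimes>\<^sub>M N). x < X (max 0 (real i / real n * fst p)) (snd p)} \<in> sets (borel \<Otimes>\<^sub>M N)"
      by measurable
  qed auto
  from prob_indep_pair[OF T_indep this]
  have "prob {\<omega>\<in>space M. (T \<omega>, \<omega>) \<in> ?A} = expectation (\<lambda>\<omega>. prob {\<omega>'\<in>space M. (T \<omega>, \<omega>') \<in> ?A})" (is "_ = expectation ?q") .
  moreover have "{\<omega>\<in>space M. (T \<omega>, \<omega>) \<in> ?A} = {\<omega>\<in>space M. \<exists>i\<le>n. x < X (real i / real n * T \<omega>) \<omega>}"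
    using T_pos by (auto simp: space_pair_measure space_N less_imp_le max_def mult_less_0_iff not_less Bex_def
        divide_less_0_iff dest: T_pos)
  moreover have "expectation ?q \<le> expectation (\<lambda>\<omega>. grid_tail \<epsilon> (x / T \<omega> powr (1 / \<alpha>)))"
  proof (rule integral_mono_AE')
    have "\<bar>grid_tail \<epsilon> (x / T \<omega> powr (1 / \<alpha>))\<bar> \<le> 2" if "\<omega> \<in> space M" for \<omega>
    proof -
      have h: "upper_tail (\<epsilon> * (x / T \<omega> powr (1 / \<alpha>))) \<le> 1/2"
        using \<epsilon> x by (intro upper_tail_le_half) auto
      have "grid_tail \<epsilon> (x / T \<omega> powr (1 / \<alpha>)) \<le> 1 / (1/2)"
        unfolding grid_tail_def using h upper_tail_bounds by (intro frac_le) auto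
      then show ?thesis using h upper_tail_bounds by (simp add: grid_tail_def)
    qed
    then show "integrable M (\<lambda>\<omega>. grid_tail \<epsilon> (x / T \<omega> powr (1 / \<alpha>)))"
      by (intro integrable_const_bound[where B=2]) auto
    show "AE \<omega> in M. ?q \<omega> \<le> grid_tail \<epsilon> (x / T \<omega> powr (1 / \<alpha>))"
    proof (rule AE_I2)
      fix \<omega> assume w: "\<omega> \<in> space M"
      define z where "z = x / T \<omega> powr (1 / \<alpha>)"
      have "{\<omega>'\<in>space M. (T \<omega>, \<omega>') \<in> ?A} = {\<omega>'\<in>space M. \<exists>i\<le>n. x < X (T \<omega> * (real i / real n)) \<omega>'}"
        using T_pos[OF w] by (auto simp: space_pair_measure space_N max_def mult.commute Bex_def)
      then have "(1 - upper_tail (\<epsilon> * z)) * ?q \<omega> \<le> upper_tail ((1 - \<epsilon>) * z)"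
        using prob_grid_max_le[OF T_pos[OF w] n, of "\<epsilon> * x" x] \<epsilon> x by (simp add: z_def algebra_simps diff_divide_distrib)
      moreover have "upper_tail (\<epsilon> * z) \<le> 1/2"
        using \<epsilon> x by (intro upper_tail_le_half) (auto simp: z_def)
      ultimately show "?q \<omega> \<le> grid_tail \<epsilon> (x / T \<omega> powr (1 / \<alpha>))"
        by (simp add: grid_tail_def z_def[symmetric] field_simps)
    qed
  qed (simp add: grid_tail_nonneg)
  ultimately show ?thesis by simp
qed

text \<open>Each bound holds at a frozen time t with a factor t, and the lifetime has mean 1. The
  constant is the sum of what the tail (two sides, hence 2K) and the second moment (through 1 - cos
  at frequency 1/y) require.\<close>

lemma symmetric_step_at_T:
  assumes K: "0 < K" "\<And>y. 0 < y \<Longrightarrow> upper_tail y \<le> K * y powr (-\<alpha>)"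
    and \<gamma>: "0 < \<gamma>" "\<And>t \<theta>. 0 \<le> t \<Longrightarrow> expectation (\<lambda>\<omega>. 1 - cos (\<theta> * X t \<omega>)) \<le> \<gamma> * t * \<bar>\<theta>\<bar> powr \<alpha>"
  shows "symmetric_step M (\<lambda>\<omega>. X (T \<omega>) \<omega>) \<alpha> (2 * K + 2 / cos 1 * \<gamma>)"
proof -
  have \<xi> [measurable]: "(\<lambda>\<omega>. X (T \<omega>) \<omega>) \<in> borel_measurable M"
    using motion_at_T_measurable[of 1] by simp
  have Xt [measurable]: "X (T \<omega>) \<in> borel_measurable M" if "\<omega> \<in> space M" for \<omega>
    using T_pos[OF that] by (intro measurable_process) simp
  have freeze: "(\<integral>\<^sup>+\<omega>. f (X (T \<omega>) \<omega>) \<partial>M) = (\<integral>\<^sup>+\<omega>. \<integral>\<^sup>+\<omega>'. f (X (T \<omega>) \<omega>') \<partial>M \<partial>M)"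
    if "f \<in> borel_measurable borel" for f :: "real \<Rightarrow> ennreal"
    using nn_integral_motion_at_T[of 1 f] that by simp
  have cos1: "0 < cos (1::real)" using pi_gt3 by (intro cos_gt_zero_pi) auto
  show ?thesis
  proof (intro symmetric_step.intro symmetric_step_axioms.intro prob_space_axioms index \<xi>)
    fix y :: real assume y: "0 < y"
    show "expectation (\<lambda>\<omega>. X (T \<omega>) \<omega> * indicator {-y..y} (X (T \<omega>) \<omega>)) = 0"
    proof -
      \<comment> \<open>Freezing is available for nonnegative integrands, so the odd function is
        split as f x - f (-x); symmetry at each frozen time equates the two means.\<close>
      define f where "f x = x * indicator {0..y} x" for x :: real
      have [measurable]: "f \<in> borel_measurable borel" unfolding f_def by measurable
      have f: "0 \<le> f x" "f x \<le> y" for x using y by (auto simp: f_def indicator_def)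
      have "(\<integral>\<^sup>+\<omega>. ennreal (f (X (T \<omega>) \<omega>)) \<partial>M) = (\<integral>\<^sup>+\<omega>. \<integral>\<^sup>+\<omega>'. ennreal (f (X (T \<omega>) \<omega>')) \<partial>M \<partial>M)"
        by (rule freeze) simp
      also have "\<dots> = (\<integral>\<^sup>+\<omega>. \<integral>\<^sup>+\<omega>'. ennreal (f (- X (T \<omega>) \<omega>')) \<partial>M \<partial>M)"
      proof (rule nn_integral_cong)
        fix \<omega> assume w: "\<omega> \<in> space M"
        have "(\<integral>\<^sup>+\<omega>'. ennreal (f (- X (T \<omega>) \<omega>')) \<partial>M) = (\<integral>\<^sup>+x. ennreal (f x) \<partial>distr M borel (\<lambda>\<omega>'. - X (T \<omega>) \<omega>'))"
          using w by (subst nn_integral_distr) auto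
        also have "\<dots> = (\<integral>\<^sup>+\<omega>'. ennreal (f (X (T \<omega>) \<omega>')) \<partial>M)"
          using w T_pos[OF w] by (subst symmetric) (auto simp: nn_integral_distr)
        finally show "(\<integral>\<^sup>+\<omega>'. ennreal (f (X (T \<omega>) \<omega>')) \<partial>M) = (\<integral>\<^sup>+\<omega>'. ennreal (f (- X (T \<omega>) \<omega>')) \<partial>M)" by simp
      qed
      also have "\<dots> = (\<integral>\<^sup>+\<omega>. ennreal (f (- X (T \<omega>) \<omega>)) \<partial>M)"
        by (rule freeze[of "\<lambda>x. ennreal (f (- x))", symmetric]) simp
      finally have "expectation (\<lambda>\<omega>. f (X (T \<omega>) \<omega>)) = expectation (\<lambda>\<omega>. f (- X (T \<omega>) \<omega>))"
        using f by (simp add: integral_eq_nn_integral)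
      moreover have "integrable M (\<lambda>\<omega>. f (X (T \<omega>) \<omega>))" "integrable M (\<lambda>\<omega>. f (- X (T \<omega>) \<omega>))"
        using f by (auto intro!: integrable_const_bound[where B=y])
      ultimately have "expectation (\<lambda>\<omega>. f (X (T \<omega>) \<omega>) - f (- X (T \<omega>) \<omega>)) = 0" by simp
      also have "(\<lambda>\<omega>. f (X (T \<omega>) \<omega>) - f (- X (T \<omega>) \<omega>)) = (\<lambda>\<omega>. X (T \<omega>) \<omega> * indicator {-y..y} (X (T \<omega>) \<omega>))"
        using y by (auto simp: f_def indicator_def fun_eq_iff)
      finally show ?thesis .
    qed
    show "expectation (\<lambda>\<omega>. (X (T \<omega>) \<omega>)\<^sup>2 * indicator {-y..y} (X (T \<omega>) \<omega>)) \<le> (2 * K + 2 / cos 1 * \<gamma>) * y powr (2 - \<alpha>)"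
    proof -
      have "(\<integral>\<^sup>+\<omega>. ennreal (1 - cos (1 / y * X (T \<omega>) \<omega>)) \<partial>M) = (\<integral>\<^sup>+\<omega>. \<integral>\<^sup>+\<omega>'. ennreal (1 - cos (1 / y * X (T \<omega>) \<omega>')) \<partial>M \<partial>M)"
        by (rule freeze) measurable
      also have "\<dots> \<le> (\<integral>\<^sup>+\<omega>. ennreal (\<gamma> * \<bar>1 / y\<bar> powr \<alpha> * T \<omega>) \<partial>M)"
      proof (rule nn_integral_mono)
        fix \<omega> assume w: "\<omega> \<in> space M"
        have "integrable M (\<lambda>\<omega>'. 1 - cos (1 / y * X (T \<omega>) \<omega>'))"
          using w by (intro Bochner_Integration.integrable_diff integrable_const integrable_const_bound[where B=1]) auto
        then have "(\<integral>\<^sup>+\<omega>'. ennreal (1 - cos (1 / y * X (T \<omega>) \<omega>')) \<partial>M) = ennreal (expectation (\<lambda>\<omega>'. 1 - cos (1 / y * X (T \<omega>) \<omega>')))"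
          by (intro nn_integral_eq_integral) auto
        also have "\<dots> \<le> ennreal (\<gamma> * \<bar>1 / y\<bar> powr \<alpha> * T \<omega>)"
          using \<gamma>(2)[of "T \<omega>" "1 / y"] T_pos[OF w] by (intro ennreal_leI) (simp add: mult_ac)
        finally show "(\<integral>\<^sup>+\<omega>'. ennreal (1 - cos (1 / y * X (T \<omega>) \<omega>')) \<partial>M) \<le> ennreal (\<gamma> * \<bar>1 / y\<bar> powr \<alpha> * T \<omega>)" .
      qed
      also have "\<dots> = ennreal (\<gamma> * \<bar>1 / y\<bar> powr \<alpha>)"
        using T_mean less_imp_le[OF T_pos] less_imp_le[OF \<gamma>(1)] by (subst nn_integral_eq_integral) (auto intro!: AE_I2)
      finally have "(\<integral>\<^sup>+\<omega>. ennreal (1 - cos (1 / y * X (T \<omega>) \<omega>)) \<partial>M) \<le> ennreal (\<gamma> * \<bar>1 / y\<bar> powr \<alpha>)" .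
      moreover have int: "integrable M (\<lambda>\<omega>. 1 - cos (1 / y * X (T \<omega>) \<omega>))"
        by (intro Bochner_Integration.integrable_diff integrable_const integrable_const_bound[where B=1]) auto
      ultimately have E: "expectation (\<lambda>\<omega>. 1 - cos (1 / y * X (T \<omega>) \<omega>)) \<le> \<gamma> * \<bar>1 / y\<bar> powr \<alpha>"
        using \<gamma>(1) by (subst (asm) nn_integral_eq_integral) auto
      have "expectation (\<lambda>\<omega>. (X (T \<omega>) \<omega>)\<^sup>2 * indicator {-y..y} (X (T \<omega>) \<omega>))
         \<le> expectation (\<lambda>\<omega>. 2 / cos 1 * y\<^sup>2 * (1 - cos (1 / y * X (T \<omega>) \<omega>)))"
      proof (rule integral_mono')
        fix \<omega> show "(X (T \<omega>) \<omega>)\<^sup>2 * indicator {-y..y} (X (T \<omega>) \<omega>) \<le> 2 / cos 1 * y\<^sup>2 * (1 - cos (1 / y * X (T \<omega>) \<omega>))"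
        proof (cases "\<bar>X (T \<omega>) \<omega>\<bar> \<le> y")
          case True
          then have "cos 1 / 2 * (1 / y * X (T \<omega>) \<omega>)\<^sup>2 \<le> 1 - cos (1 / y * X (T \<omega>) \<omega>)"
            using y by (intro one_minus_cos_ge) (simp add: abs_mult)
          then have "2 / cos 1 * y\<^sup>2 * (cos 1 / 2 * (1 / y * X (T \<omega>) \<omega>)\<^sup>2) \<le> 2 / cos 1 * y\<^sup>2 * (1 - cos (1 / y * X (T \<omega>) \<omega>))"
            using cos1 by (intro mult_left_mono) auto
          moreover have "2 / cos 1 * y\<^sup>2 * (cos 1 / 2 * (1 / y * X (T \<omega>) \<omega>)\<^sup>2) = (X (T \<omega>) \<omega>)\<^sup>2"
            using cos1 y by (simp add: power_mult_distrib power_divide)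
          moreover have "indicator {-y..y} (X (T \<omega>) \<omega>) = (1::real)"
            using True by (auto simp: abs_le_iff)
          ultimately show ?thesis by (simp only: mult_1_right)
        next
          case False
          then show ?thesis using cos1 by (auto simp: indicator_def)
        qed
      qed (use int cos1 in auto)
      also have "\<dots> = 2 / cos 1 * y\<^sup>2 * expectation (\<lambda>\<omega>. 1 - cos (1 / y * X (T \<omega>) \<omega>))" by simp
      also have "\<dots> \<le> 2 / cos 1 * y\<^sup>2 * (\<gamma> * \<bar>1 / y\<bar> powr \<alpha>)"
        using E cos1 by (intro mult_left_mono) auto
      also have "\<dots> = 2 / cos 1 * \<gamma> * y powr (2 - \<alpha>)"
        using y by (simp add: powr_diff powr_divide powr_numeral)
      also have "\<dots> \<le> (2 * K + 2 / cos 1 * \<gamma>) * y powr (2 - \<alpha>)"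
        using K(1) by (intro mult_right_mono) auto
      finally show ?thesis .
    qed
    show "prob {\<omega>\<in>space M. y < \<bar>X (T \<omega>) \<omega>\<bar>} \<le> (2 * K + 2 / cos 1 * \<gamma>) * y powr (-\<alpha>)"
    proof -
      have "ennreal (prob {\<omega>\<in>space M. y < \<bar>X (T \<omega>) \<omega>\<bar>}) = (\<integral>\<^sup>+\<omega>. indicator {x. y < \<bar>x\<bar>} (X (T \<omega>) \<omega>) \<partial>M)"
        by (subst nn_integral_indicator_of) auto
      also have "\<dots> = (\<integral>\<^sup>+\<omega>. \<integral>\<^sup>+\<omega>'. indicator {x. y < \<bar>x\<bar>} (X (T \<omega>) \<omega>') \<partial>M \<partial>M)"
        by (rule freeze) measurable
      also have "\<dots> \<le> (\<integral>\<^sup>+\<omega>. ennreal (2 * K * y powr (-\<alpha>) * T \<omega>) \<partial>M)"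
      proof (rule nn_integral_mono)
        fix \<omega> assume w: "\<omega> \<in> space M"
        let ?t = "T \<omega>"
        have t: "0 < ?t" by (rule T_pos[OF w])
        have [measurable]: "X ?t \<in> borel_measurable M" using w by (rule Xt)
        have "prob {\<omega>'\<in>space M. y < \<bar>X ?t \<omega>'\<bar>} = prob ({\<omega>'\<in>space M. y < X ?t \<omega>'} \<union> {\<omega>'\<in>space M. X ?t \<omega>' < - y})"
          by (auto intro!: arg_cong[where f=prob])
        also have "\<dots> \<le> prob {\<omega>'\<in>space M. y < X ?t \<omega>'} + prob {\<omega>'\<in>space M. X ?t \<omega>' < - y}"
          by (rule measure_Un_le) measurable
        also have "\<dots> = 2 * upper_tail (y / ?t powr (1 / \<alpha>))"
          using t by (simp add: prob_less_uminus prob_less)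
        also have "\<dots> \<le> 2 * (K * (y / ?t powr (1 / \<alpha>)) powr (-\<alpha>))"
          using K(2)[of "y / ?t powr (1 / \<alpha>)"] y t by simp
        also have "(y / ?t powr (1 / \<alpha>)) powr (-\<alpha>) = y powr (-\<alpha>) * ?t"
          using y t index by (simp add: powr_divide powr_powr powr_minus_divide)
        finally have "prob {\<omega>'\<in>space M. y < \<bar>X ?t \<omega>'\<bar>} \<le> 2 * K * y powr (-\<alpha>) * ?t" by (simp add: mult_ac)
        moreover have "(\<integral>\<^sup>+\<omega>'. indicator {x. y < \<bar>x\<bar>} (X ?t \<omega>') \<partial>M) = ennreal (prob {\<omega>'\<in>space M. y < \<bar>X ?t \<omega>'\<bar>})"
          by (subst nn_integral_indicator_of) auto
        ultimately show "(\<integral>\<^sup>+\<omega>'. indicator {x. y < \<bar>x\<bar>} (X ?t \<omega>') \<partial>M) \<le> ennreal (2 * K * y powr (-\<alpha>) * ?t)"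
          by (simp add: ennreal_leI)
      qed
      also have "\<dots> = ennreal (2 * K * y powr (-\<alpha>))"
        using T_mean less_imp_le[OF T_pos] less_imp_le[OF K(1)] by (subst nn_integral_eq_integral) (auto intro!: AE_I2)
      finally have "prob {\<omega>\<in>space M. y < \<bar>X (T \<omega>) \<omega>\<bar>} \<le> 2 * K * y powr (-\<alpha>)"
        using K(1) by (subst (asm) ennreal_le_iff) auto
      also have "\<dots> \<le> (2 * K + 2 / cos 1 * \<gamma>) * y powr (-\<alpha>)"
        using \<gamma>(1) cos1 by (intro mult_right_mono) auto
      finally show ?thesis .
    qed
  qed
qed

end

section \<open>The branching process\<close>

lemma dyadic_between:
  fixes a b :: real
  assumes "0 \<le> a" "a < b" "b \<le> 1"
  obtains k i :: nat where "i < 2 ^ k" "a < real i / 2 ^ k" "real i / 2 ^ k < b"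
proof -
  obtain k where k: "(1/2) ^ k < b - a" using real_arch_pow_inv[of "b - a" "1/2"] assms by auto
  define i where "i = nat \<lfloor>2 ^ k * a\<rfloor> + 1"
  have r: "real i = of_int \<lfloor>2 ^ k * a\<rfloor> + 1" using assms by (simp add: i_def)
  have 1: "2 ^ k * a < real i" and 2: "real i \<le> 2 ^ k * a + 1" unfolding r by linarith+
  have low: "a < real i / 2 ^ k" using 1 by (simp add: field_simps)
  have "real i / 2 ^ k \<le> a + (1/2) ^ k" using 2 by (simp add: field_simps power_one_over)
  also have "\<dots> < b" using k by simp
  finally have up: "real i / 2 ^ k < b" .
  then have "real i / 2 ^ k < 1" using assms(3) by (rule less_le_trans)
  then have "real i < 2 ^ k" by (simp add: divide_less_eq)
  then have "i < 2 ^ k" by (metis of_nat_less_iff of_nat_numeral of_nat_power)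
  then show thesis using low up that by blast
qed

lemma tree_max_mono:
  assumes "\<And>v. R v \<omega> \<le> R' v \<omega>" "n \<le> m"
  shows "tree_max B R \<xi> n v \<omega> \<le> tree_max B R' \<xi> m v \<omega>"
  using assms(2)
proof (induction n arbitrary: m v)
  case 0
  show ?case using assms(1)[of v] by (cases m) auto
next
  case (Suc n)
  then obtain m' where m: "m = Suc m'" "n \<le> m'" by (cases m) auto
  have "tree_max B R \<xi> n (b # v) \<omega> \<le> tree_max B R' \<xi> m' (b # v) \<omega>" for b
    using Suc.IH m by simp
  from this[of True] this[of False] assms(1)[of v] show ?case by (auto simp: m max_def)
qed

text \<open>Passing to a child moves the birth place by the displacement that
  \<open>tree_max\<close> adds at that node, so the inequality descends along the ancestral line.
  With its counterpart \<open>less_tree_maxD\<close> it ties the recursion to actual particle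
  positions.\<close>

lemma birth_place_le_tree_max:
  assumes "born B \<omega> u" "length u \<le> n"
  shows "birth_place T X \<omega> u + tree_max B R (\<lambda>v \<omega>. X v (T v \<omega>) \<omega>) (n - length u) u \<omega>
    \<le> tree_max B R (\<lambda>v \<omega>. X v (T v \<omega>) \<omega>) n [] \<omega>"
  using assms
proof (induction u)
  case (Cons b u)
  then have "B u \<omega>" and n: "n - length u = Suc (n - length (b # u))" by auto
  then have "X u (T u \<omega>) \<omega> + tree_max B R (\<lambda>v \<omega>. X v (T v \<omega>) \<omega>) (n - length (b # u)) (b # u) \<omega>
     \<le> tree_max B R (\<lambda>v \<omega>. X v (T v \<omega>) \<omega>) (n - length u) u \<omega>"
    unfolding n by (cases b) auto
  moreover have "birth_place T X \<omega> u + tree_max B R (\<lambda>v \<omega>. X v (T v \<omega>) \<omega>) (n - length u) u \<omega>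
    \<le> tree_max B R (\<lambda>v \<omega>. X v (T v \<omega>) \<omega>) n [] \<omega>"
    using Cons by simp
  ultimately show ?case by simp
qed simp

lemma less_tree_maxD:
  assumes "born B \<omega> v" "x < birth_place T X \<omega> v + tree_max B R (\<lambda>v \<omega>. X v (T v \<omega>) \<omega>) n v \<omega>"
  shows "\<exists>u. born B \<omega> u \<and> x < birth_place T X \<omega> u + R u \<omega>"
  using assms
proof (induction n arbitrary: v)
  case (Suc n)
  let ?m = "\<lambda>b. tree_max B R (\<lambda>v \<omega>. X v (T v \<omega>) \<omega>) n (b # v) \<omega>"
  have "x < birth_place T X \<omega> v + R v \<omega> \<or> (B v \<omega> \<and> (\<exists>b. x < birth_place T X \<omega> v + (X v (T v \<omega>) \<omega> + ?m b)))"
    using Suc.prems(2) by (auto simp: max_def split: if_splits)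
  then show ?case
  proof (elim disjE conjE exE)
    fix b assume "B v \<omega>" "x < birth_place T X \<omega> v + (X v (T v \<omega>) \<omega> + ?m b)"
    then show ?case using Suc.IH[of "b # v"] Suc.prems(1) by (simp add: add.assoc)
  qed (use Suc.prems in blast)
qed auto

lemma Int_stable_vimages: "Int_stable {f -` A \<inter> \<Omega> |A. A \<in> sets N}"
proof (rule Int_stableI)
  fix a b assume "a \<in> {f -` A \<inter> \<Omega> |A. A \<in> sets N}" "b \<in> {f -` A \<inter> \<Omega> |A. A \<in> sets N}"
  then obtain A B where "A \<in> sets N" "B \<in> sets N" "a = f -` A \<inter> \<Omega>" "b = f -` B \<inter> \<Omega>" by auto
  then have "A \<inter> B \<in> sets N" "a \<inter> b = f -` (A \<inter> B) \<inter> \<Omega>" by auto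
  then show "a \<inter> b \<in> {f -` A \<inter> \<Omega> |A. A \<in> sets N}" by blast
qed

lemma eventually_at_right_0D:
  assumes "\<forall>\<^sub>F x in at_right 0. P x" "0 < (c::real)"
  obtains x where "0 < x" "x < c" "P x"
proof -
  have "\<forall>\<^sub>F x in at_right 0. x \<in> {0<..<c} \<and> P x"
    using assms by (intro eventually_conj eventually_at_right_real)
  from eventually_happens'[OF _ this] show thesis using that by auto
qed

section \<open>Particles as independent motions with exponential lifetimes\<close>

locale stable_cbss = cbss_process M \<alpha> T B X
  for M :: "'w measure" and \<alpha> :: real
    and T :: "bool list \<Rightarrow> 'w \<Rightarrow> real" and B :: "bool list \<Rightarrow> 'w \<Rightarrow> bool"
    and X :: "bool list \<Rightarrow> real \<Rightarrow> 'w \<Rightarrow> real" +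
  assumes index: "0 < \<alpha>" "\<alpha> < 2"
begin

abbreviation "\<E> \<equiv> generated_events M T B X"

abbreviation "\<S> I \<equiv> sources_algebra (space M) \<E> I"

lemma Int_stable_generated_events: "Int_stable (\<E> i)"
  by (cases i) (simp_all only: generated_events.simps Int_stable_vimages)

lemma measurable_generated:
  assumes "\<And>A. A \<in> sets S \<Longrightarrow> Z -` A \<inter> space M \<in> \<E> i" "Z \<in> space M \<rightarrow> space S"
  shows "Z \<in> measurable (\<S> {i}) S"
proof (rule measurableI)
  fix A assume "A \<in> sets S"
  then have "Z -` A \<inter> space M \<in> sigma_sets (space M) (\<Union>i\<in>{i}. \<E> i)"
    using assms(1) by (intro sigma_sets.Basic) auto
  then show "Z -` A \<inter> space (\<S> {i}) \<in> sets (\<S> {i})"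
    by (simp only: sets_sources_algebra[OF independence] space_sources_algebra)
qed (use assms(2) in auto)

lemma lifetime_sources: "T u \<in> borel_measurable (\<S> {Lifetime u})"
  by (rule measurable_generated) auto

lemma branching_sources: "B u \<in> measurable (\<S> {Branching u}) (count_space UNIV)"
  by (rule measurable_generated) auto

lemma motion_sources:
  assumes "0 \<le> t"
  shows "X u t \<in> borel_measurable (\<S> {Motion u})"
proof (rule measurable_generated)
  fix A :: "real set" assume "A \<in> sets borel"
  moreover have "(\<lambda>f. f t) \<in> borel_measurable (\<Pi>\<^sub>M t\<in>{0..}. borel :: real measure)"
    using assms by (intro measurable_component_singleton) simp
  ultimately have "(\<lambda>f. f t) -` A \<inter> space (\<Pi>\<^sub>M t\<in>{0..}. borel) \<in> sets (\<Pi>\<^sub>M t\<in>{0..}. borel :: real measure)"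
    by (rule measurable_sets[rotated])
  moreover have "X u t -` A \<inter> space M =
      (\<lambda>\<omega>. \<lambda>t\<in>{0..}. X u t \<omega>) -` ((\<lambda>f. f t) -` A \<inter> space (\<Pi>\<^sub>M t\<in>{0..}. borel)) \<inter> space M"
    using assms by (auto simp: space_PiM)
  ultimately show "X u t -` A \<inter> space M \<in> \<E> (Motion u)"
    unfolding generated_events.simps by blast
qed simp

lemma killed_motion: "killed_motion M \<alpha> (X u) (T u) (\<S> {Motion u})"
proof -
  interpret S: symmetric_stable_process M \<alpha> "X u" by (rule motion)
  have "(\<lambda>\<omega>. \<omega>) \<in> measurable (\<S> {Motion u}) (\<S> {Motion u})" by simp
  then have "indep_pair borel (T u) (\<S> {Motion u}) (\<lambda>\<omega>. \<omega>)"
    by (intro indep_pair_sources[OF independence Int_stable_generated_events _ lifetime_sources, where J="{Motion u}"]) simp_all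
  then show ?thesis
    by unfold_locales (use index lifetime_pos lifetime motion_sources in auto)
qed

interpretation killed: killed_motion M \<alpha> "X u" "T u" "\<S> {Motion u}" for u
  by (rule killed_motion)

text \<open>The constant in \<open>stable_char\<close> is given separately for each particle. The
  common jump measure fixes the characteristic function, so the laws agree and all tail estimates
  can be made uniform in the label.\<close>

lemma law_eq:
  assumes "0 \<le> t"
  shows "distr M borel (X u t) = distr M borel (X v t)"
proof (rule Levy_uniqueness)
  show "char (distr M borel (X u t)) = char (distr M borel (X v t))"
    using killed.levy_triplet[of u] killed.levy_triplet[of v] assms by (auto simp: has_levy_triplet_def fun_eq_iff)
qed (use killed.measurable_process assms in auto)

lemma lifetime_law_eq: "distr M borel (T u) = distr M borel (T v)"
  using lifetime[of u] lifetime[of v] by (simp add: distributed_def cong: distr_cong)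

abbreviation "\<tau> \<equiv> killed.upper_tail []"

lemma upper_tail_eq: "killed.upper_tail u = \<tau>"
  using law_eq[of 1 u "[]"] by (simp add: killed.upper_tail_def killed.law_def fun_eq_iff)

lemma grid_tail_eq: "killed.grid_tail u = killed.grid_tail []"
  by (simp add: killed.grid_tail_def upper_tail_eq[of u] fun_eq_iff)

lemma expectation_lifetime_eq:
  assumes "f \<in> borel_measurable borel"
  shows "expectation (\<lambda>\<omega>. f (T u \<omega>) :: real) = expectation (\<lambda>\<omega>. f (T v \<omega>))"
  using lifetime_law_eq[of u v] integral_distr[OF killed.T_measurable assms, of u] integral_distr[OF killed.T_measurable assms, of v]
  by simp

lemma motion_at_lifetime_sources:
  assumes "0 \<le> c"
  shows "(\<lambda>\<omega>. X u (c * T u \<omega>) \<omega>) \<in> borel_measurable (\<S> {Lifetime u, Motion u})"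
proof -
  have "(\<lambda>\<omega>. \<omega>) \<in> measurable (\<S> {Motion u}) (\<S> {Motion u})" by simp
  then have "(\<lambda>\<omega>. \<omega>) \<in> measurable (\<S> {Lifetime u, Motion u}) (\<S> {Motion u})"
    by (rule measurable_sources_mono[OF independence]) auto
  moreover have "T u \<in> borel_measurable (\<S> {Lifetime u, Motion u})"
    by (rule measurable_sources_mono[OF independence lifetime_sources]) auto
  ultimately have "(\<lambda>\<omega>. (T u \<omega>, \<omega>)) \<in> measurable (\<S> {Lifetime u, Motion u}) (borel \<Otimes>\<^sub>M \<S> {Motion u})"
    by (intro measurable_Pair)
  from measurable_compose[OF this killed.motion_at_measurable[of "\<lambda>t. c * t"]]
  have "(\<lambda>\<omega>. X u (max 0 (c * T u \<omega>)) \<omega>) \<in> borel_measurable (\<S> {Lifetime u, Motion u})" by simp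
  moreover have "max 0 (c * T u \<omega>) = c * T u \<omega>" if "\<omega> \<in> space M" for \<omega>
    using lifetime_pos[OF that, of u] assms by simp
  ultimately show ?thesis
    by (subst measurable_cong[where g="\<lambda>\<omega>. X u (max 0 (c * T u \<omega>)) \<omega>"]) auto
qed

abbreviation \<xi> where "\<xi> u \<omega> \<equiv> X u (T u \<omega>) \<omega>"

text \<open>The grid includes the endpoint i = n, the position at age \<open>T u\<close>, although
  the particle is no longer alive then: \<open>supersolution\<close> needs \<xi> <= R, and
  overcounting is harmless for an upper bound.\<close>

definition grid_max :: "nat \<Rightarrow> bool list \<Rightarrow> 'w \<Rightarrow> real" where
  "grid_max n u \<omega> = Max ((\<lambda>i. X u (real i / real n * T u \<omega>) \<omega>) ` {..n})"

lemma less_grid_max_iff: "x < grid_max n u \<omega> \<longleftrightarrow> (\<exists>i\<le>n. x < X u (real i / real n * T u \<omega>) \<omega>)"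
  unfolding grid_max_def by (subst Max_gr_iff) auto

lemma branching_tree:
  assumes "\<And>v. R v \<in> borel_measurable (\<S> {Lifetime v, Motion v})"
  shows "branching_tree M \<E> B R \<xi>"
proof (intro branching_tree.intro branching_tree_axioms.intro prob_space_axioms independence
    Int_stable_generated_events assms branching_sources)
  show "\<xi> v \<in> borel_measurable (\<S> {Lifetime v, Motion v})" for v
    using motion_at_lifetime_sources[of 1 v] by simp
  show "prob {\<omega>\<in>space M. B v \<omega>} = 1/2" for v
  proof -
    have "prob {\<omega>\<in>space M. B v \<omega>} = measure (distr M (count_space UNIV) (B v)) {True}"
      using branching_measurable[of v] by (subst measure_distr) (auto intro!: arg_cong[where f=prob])
    then show ?thesis by (simp add: branching measure_pmf_single)
  qed
qed

lemma grid_max_sources: "grid_max n v \<in> borel_measurable (\<S> {Lifetime v, Motion v})"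
  unfolding grid_max_def[abs_def]
  by (intro borel_measurable_Max motion_at_lifetime_sources) auto

lemma birth_time_nonneg: "\<omega> \<in> space M \<Longrightarrow> 0 \<le> birth_time T \<omega> u"
  by (induction u) (auto intro: add_nonneg_nonneg less_imp_le[OF lifetime_pos])

text \<open>Age c * T with c < 1 is an age at which u is still alive; the lifetime interval in
  \<open>alive\<close> is open on the right.\<close>

lemma less_maximal_displacementI:
  assumes w: "\<omega> \<in> space M" and c: "0 \<le> c" "c < 1" and u: "born B \<omega> u"
    and y: "y < birth_place T X \<omega> u + X u (c * T u \<omega>) \<omega>"
  shows "ereal y < maximal_displacement T B X \<omega>"
proof -
  let ?t = "birth_time T \<omega> u + c * T u \<omega>"
  have T0: "0 < T u \<omega>" by (rule lifetime_pos[OF w])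
  have "0 \<le> ?t" using birth_time_nonneg[OF w] c T0 by (intro add_nonneg_nonneg) auto
  moreover have "c * T u \<omega> < T u \<omega>" using c T0 by simp
  then have "u \<in> alive T B ?t \<omega>" using u c T0 by (simp add: alive_def)
  moreover have "ereal y < ereal (location T X ?t \<omega> u)" using y by (simp add: location_def)
  ultimately show ?thesis
    unfolding maximal_displacement_def rightmost_def less_SUP_iff by (meson atLeast_iff)
qed

text \<open>Right continuity moves any exceedance to a dyadic fraction of the lifetime, still before
  death. The supremum over uncountably many times becomes countable, which yields measurability and
  the link to \<open>grid_max\<close>.\<close>

lemma less_maximal_displacement_iff:
  assumes w: "\<omega> \<in> space M"
  shows "ereal y < maximal_displacement T B X \<omega> \<longleftrightarrow>
    (\<exists>u k i. i < 2 ^ k \<and> born B \<omega> u \<and> y < birth_place T X \<omega> u + X u (real i / 2 ^ k * T u \<omega>) \<omega>)"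
proof
  assume "ereal y < maximal_displacement T B X \<omega>"
  then obtain t u where t: "0 \<le> t" "u \<in> alive T B t \<omega>" "y < location T X t \<omega> u"
    by (auto simp: maximal_displacement_def rightmost_def less_SUP_iff)
  define s where "s = t - birth_time T \<omega> u"
  have s: "0 \<le> s" "s < T u \<omega>" "born B \<omega> u" "y - birth_place T X \<omega> u < X u s \<omega>"
    using t by (auto simp: s_def alive_def location_def)
  have "((\<lambda>r. X u r \<omega>) \<longlongrightarrow> X u s \<omega>) (at_right s)"
    using killed.cadlag_paths[OF w] s(1) by (auto simp: cadlag_def)
  from order_tendstoD(1)[OF this s(4)] obtain b where b: "s < b" "\<And>r. s < r \<Longrightarrow> r < b \<Longrightarrow> y - birth_place T X \<omega> u < X u r \<omega>"
    by (auto simp: eventually_at_right_field)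
  have T0: "0 < T u \<omega>" by (rule lifetime_pos[OF w])
  obtain k i :: nat where ki: "i < 2 ^ k" "s / T u \<omega> < real i / 2 ^ k" "real i / 2 ^ k < min 1 (b / T u \<omega>)"
    by (rule dyadic_between[of "s / T u \<omega>" "min 1 (b / T u \<omega>)"])
       (use s b T0 in \<open>auto simp: divide_strict_right_mono\<close>)
  have "s < real i / 2 ^ k * T u \<omega>" "real i / 2 ^ k * T u \<omega> < b"
    using ki T0 by (simp_all add: pos_divide_less_eq pos_less_divide_eq)
  from b(2)[OF this] show "\<exists>u k i. i < 2 ^ k \<and> born B \<omega> u \<and> y < birth_place T X \<omega> u + X u (real i / 2 ^ k * T u \<omega>) \<omega>"
    using ki(1) s(3) by (intro exI[of _ u] exI[of _ k] exI[of _ i]) auto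
next
  assume "\<exists>u k i. i < 2 ^ k \<and> born B \<omega> u \<and> y < birth_place T X \<omega> u + X u (real i / 2 ^ k * T u \<omega>) \<omega>"
  then obtain u k and i :: nat where i: "i < 2 ^ k" "born B \<omega> u" "y < birth_place T X \<omega> u + X u (real i / 2 ^ k * T u \<omega>) \<omega>"
    by auto
  have "real i < 2 ^ k" using i(1) by (metis of_nat_less_iff of_nat_numeral of_nat_power)
  then show "ereal y < maximal_displacement T B X \<omega>"
    using less_maximal_displacementI[OF w _ _ i(2,3)] by simp
qed

lemma [measurable]:
  shows T_measurable: "T u \<in> borel_measurable M"
    and B_measurable: "B u \<in> measurable M (count_space UNIV)"
  using killed.T_measurable branching_measurable by auto

lemma motion_at_lifetime_measurable: "0 \<le> c \<Longrightarrow> (\<lambda>\<omega>. X u (c * T u \<omega>) \<omega>) \<in> borel_measurable M"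
  by (rule killed.motion_at_T_measurable)

lemma born_measurable [measurable]: "Measurable.pred M (\<lambda>\<omega>. born B \<omega> u)"
  by (induction u) auto

lemma birth_place_measurable [measurable]: "(\<lambda>\<omega>. birth_place T X \<omega> u) \<in> borel_measurable M"
proof (induction u)
  case (Cons b u)
  have [measurable]: "(\<lambda>\<omega>. birth_place T X \<omega> u) \<in> borel_measurable M" by (rule Cons)
  have [measurable]: "(\<lambda>\<omega>. X u (T u \<omega>) \<omega>) \<in> borel_measurable M"
    using motion_at_lifetime_measurable[of 1 u] by simp
  show ?case by simp
qed simp

lemma less_maximal_displacement_sets:
  "{\<omega>\<in>space M. ereal y < maximal_displacement T B X \<omega>} \<in> sets M"
proof -
  have [measurable]: "(\<lambda>\<omega>. X u (real i / 2 ^ k * T u \<omega>) \<omega>) \<in> borel_measurable M" for u and i k :: nat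
    by (rule motion_at_lifetime_measurable) simp
  have "{\<omega>\<in>space M. \<exists>u k i. i < (2::nat) ^ k \<and> born B \<omega> u \<and> y < birth_place T X \<omega> u + X u (real i / 2 ^ k * T u \<omega>) \<omega>} \<in> sets M"
    by measurable
  also have "{\<omega>\<in>space M. \<exists>u k i. i < (2::nat) ^ k \<and> born B \<omega> u \<and> y < birth_place T X \<omega> u + X u (real i / 2 ^ k * T u \<omega>) \<omega>}
     = {\<omega>\<in>space M. ereal y < maximal_displacement T B X \<omega>}"
    by (intro Collect_cong conj_cong refl less_maximal_displacement_iff[symmetric])
  finally show ?thesis .
qed

lemma le_maximal_displacement_sets:
  "{\<omega>\<in>space M. ereal x \<le> maximal_displacement T B X \<omega>} \<in> sets M"
proof -
  have "ereal x \<le> m \<longleftrightarrow> (\<forall>n. ereal (x - 1 / real (Suc n)) < m)" for m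
  proof
    assume x: "ereal x \<le> m"
    show "\<forall>n. ereal (x - 1 / real (Suc n)) < m"
    proof
      fix n
      have "ereal (x - 1 / real (Suc n)) < ereal x" by simp
      then show "ereal (x - 1 / real (Suc n)) < m" using x by (rule less_le_trans)
    qed
  next
    assume *: "\<forall>n. ereal (x - 1 / real (Suc n)) < m"
    show "ereal x \<le> m"
    proof (rule ccontr)
      assume "\<not> ereal x \<le> m"
      then obtain r where r: "m < ereal r" "ereal r < ereal x" using ereal_dense2[of m "ereal x"] by (auto simp: not_le)
      then obtain n where "1 / real (Suc n) < x - r" using nat_approx_posE[of "x - r"] by auto
      then have "ereal r < ereal (x - 1 / real (Suc n))" by simp
      with * r(1) show False by (meson less_trans less_irrefl)
    qed
  qed
  then have "{\<omega>\<in>space M. ereal x \<le> maximal_displacement T B X \<omega>}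
      = (\<Inter>n. {\<omega>\<in>space M. ereal (x - 1 / real (Suc n)) < maximal_displacement T B X \<omega>})"
    by auto
  also have "\<dots> \<in> sets M" using less_maximal_displacement_sets by (intro sets.countable_INT) auto
  finally show ?thesis .
qed

section \<open>Choice of constants for the two barriers\<close>

lemma step_bounds: obtains C where "\<And>u. symmetric_step M (\<xi> u) \<alpha> C"
proof -
  obtain K where K: "0 < K" "\<And>y. 0 < y \<Longrightarrow> \<tau> y \<le> K * y powr (-\<alpha>)"
    using killed.upper_tail_le_power by blast
  obtain \<gamma> where \<gamma>: "0 < \<gamma>" "\<And>t \<theta>. 0 \<le> t \<Longrightarrow> expectation (\<lambda>\<omega>. 1 - cos (\<theta> * X [] t \<omega>)) \<le> \<gamma> * t * \<bar>\<theta>\<bar> powr \<alpha>"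
    using killed.expectation_one_minus_cos by blast
  have "expectation (\<lambda>\<omega>. 1 - cos (\<theta> * X u t \<omega>)) \<le> \<gamma> * t * \<bar>\<theta>\<bar> powr \<alpha>" if t: "0 \<le> t" for u t \<theta>
  proof -
    have "expectation (\<lambda>\<omega>. 1 - cos (\<theta> * X u t \<omega>)) = (\<integral>y. 1 - cos (\<theta> * y) \<partial>distr M borel (X u t))" for u
      using killed.measurable_process[OF t] by (subst integral_distr) auto
    then show ?thesis using \<gamma>(2)[OF t, of \<theta>] law_eq[OF t, of u "[]"] by simp
  qed
  then have "symmetric_step M (\<xi> u) \<alpha> (2 * K + 2 / cos 1 * \<gamma>)" for u
    by (intro killed.symmetric_step_at_T K(1) \<gamma>(1)) (use K(2) upper_tail_eq[of u] in auto)
  then show thesis using that by blast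
qed

text \<open>The gap between 1/\<alpha> and \<open>a\<^sup>2 / 2\<close> is spent in order:
  \<open>L\<close> inside it, then \<epsilon> for Ottaviani's loss, then a threshold beyond which
  the tail bound holds, then \<delta>, and finally \<open>b\<close>. None of these depends on
  \<open>k\<close>, which counts both mesh refinements and generations.\<close>

lemma upper_bound:
  assumes a: "0 < a" "1 / \<alpha> < a\<^sup>2 / 2"
  shows "\<exists>b>0. \<forall>k x. prob {\<omega>\<in>space M. x < tree_max B (grid_max (2 ^ k)) \<xi> k [] \<omega>} \<le> upper_barrier \<alpha> a b x"
proof -
  obtain C where C: "\<And>u. symmetric_step M (\<xi> u) \<alpha> C" using step_bounds by blast
  obtain K where K: "0 < K" "\<And>y. 0 < y \<Longrightarrow> \<tau> y \<le> K * y powr (-\<alpha>)"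
    using killed.upper_tail_le_power by blast
  define L where "L = (1 / \<alpha> + a\<^sup>2 / 2) / 2"
  have L: "1 / \<alpha> < L" "L < a\<^sup>2 / 2" using a by (auto simp: L_def field_simps)
  have "((\<lambda>\<epsilon>. (1 - \<epsilon>) powr (-\<alpha>) / \<alpha>) \<longlongrightarrow> (1 - 0) powr (-\<alpha>) / \<alpha>) (at_right 0)"
    using index by (intro tendsto_intros) auto
  then have "\<forall>\<^sub>F \<epsilon> in at_right 0. (1 - \<epsilon>) powr (-\<alpha>) / \<alpha> < L"
    using L by (intro order_tendstoD(2)[where y="(1 - 0) powr (-\<alpha>) / \<alpha>"]) auto
  then obtain \<epsilon> where \<epsilon>: "0 < \<epsilon>" "\<epsilon> < 1" "(1 - \<epsilon>) powr (-\<alpha>) / \<alpha> < L"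
    by (rule eventually_at_right_0D[of _ "1"]) auto
  let ?H = "\<lambda>x. expectation (\<lambda>\<omega>. killed.grid_tail [] \<epsilon> (x / T [] \<omega> powr (1 / \<alpha>)))"
  have "((\<lambda>x. x powr \<alpha> * ?H x) \<longlongrightarrow> expectation (T []) * ((1 - \<epsilon>) powr (-\<alpha>) / \<alpha>)) at_top"
    by (rule tendsto_scaled_expectation[OF killed.T_mean(2) killed.T_pos index(1) killed.grid_tail_measurable
          killed.grid_tail_le[OF K(2) \<epsilon>(1,2)] killed.grid_tail_asymp[OF \<epsilon>(1,2)]])
  then have "\<forall>\<^sub>F x in at_top. x powr \<alpha> * ?H x < L"
    using \<epsilon>(3) killed.T_mean(1)[of "[]"] by (intro order_tendstoD(2)) auto
  then obtain y0 where y0: "\<And>x. y0 \<le> x \<Longrightarrow> x powr \<alpha> * ?H x < L" by (auto simp: eventually_at_top_linorder)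
  define x0 where "x0 = max 1 y0"
  have x0: "0 < x0" by (simp add: x0_def)
  have tail: "prob {\<omega>\<in>space M. y < grid_max (2 ^ k) u \<omega>} \<le> L * y powr (-\<alpha>)" if y: "x0 \<le> y" for k u y
  proof -
    have y1: "0 < y" "y0 \<le> y" using y by (auto simp: x0_def)
    have "prob {\<omega>\<in>space M. y < grid_max (2 ^ k) u \<omega>} \<le> expectation (\<lambda>\<omega>. killed.grid_tail u \<epsilon> (y / T u \<omega> powr (1 / \<alpha>)))"
      unfolding less_grid_max_iff using y1 \<epsilon> by (intro killed.prob_grid_max_at_T) auto
    also have "\<dots> = ?H y"
      unfolding grid_tail_eq[of u] by (rule expectation_lifetime_eq) (use killed.grid_tail_measurable in measurable)
    also have "\<dots> \<le> L * y powr (-\<alpha>)"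
      using y0[OF y1(2)] y1(1) by (simp add: powr_minus field_simps)
    finally show ?thesis .
  qed
  have "((\<lambda>\<delta>. (1 - \<delta>) * (1 + \<delta>) powr (-2*\<alpha>) * (a\<^sup>2 / 2) - L * (1 - \<delta>) powr (-\<alpha>))
      \<longlongrightarrow> (1 - 0) * (1 + 0) powr (-2*\<alpha>) * (a\<^sup>2 / 2) - L * (1 - 0) powr (-\<alpha>)) (at_right 0)"
    by (intro tendsto_intros) auto
  then have "\<forall>\<^sub>F \<delta> in at_right 0. 0 < (1 - \<delta>) * (1 + \<delta>) powr (-2*\<alpha>) * (a\<^sup>2 / 2) - L * (1 - \<delta>) powr (-\<alpha>)"
    using L by (intro order_tendstoD(1)[where y="(1 - 0) * (1 + 0) powr (-2*\<alpha>) * (a\<^sup>2 / 2) - L * (1 - 0) powr (-\<alpha>)"]) auto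
  then obtain \<delta> where \<delta>: "0 < \<delta>" "\<delta> < 1/2"
      "L * (1 - \<delta>) powr (-\<alpha>) \<le> (1 - \<delta>) * (1 + \<delta>) powr (-2*\<alpha>) * (a\<^sup>2 / 2)"
    by (rule eventually_at_right_0D[of _ "1/2"]) auto
  define c where "c = \<delta> * (1 + \<delta>) powr (-2*\<alpha>) / 2"
  have c: "0 < c" using \<delta> by (auto simp: c_def)
  define b where "b = max ((2 * x0) powr \<alpha>) ((48 * C + \<delta> powr (-2*\<alpha>) * C + \<delta> powr (-\<alpha>) * C / 2) / c)"
  have b: "0 < b" "(2 * x0) powr \<alpha> \<le> b" using x0 by (auto simp: b_def less_max_iff_disj)
  have "(48 * C + \<delta> powr (-2*\<alpha>) * C + \<delta> powr (-\<alpha>) * C / 2) / c \<le> b" by (simp add: b_def)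
  then have "48 * C + \<delta> powr (-2*\<alpha>) * C + \<delta> powr (-\<alpha>) * C / 2 \<le> b * c" using c by (simp add: pos_divide_le_eq)
  then have b2: "48 * C + \<delta> powr (-2*\<alpha>) * C + \<delta> powr (-\<alpha>) * C / 2 \<le> \<delta> * (1 + \<delta>) powr (-2*\<alpha>) * (b / 2)"
    by (simp add: c_def mult_ac)
  have "prob {\<omega>\<in>space M. x < tree_max B (grid_max (2 ^ k)) \<xi> k [] \<omega>} \<le> upper_barrier \<alpha> a b x" for k x
  proof -
    interpret tree: branching_tree M \<E> B "grid_max (2 ^ k)" \<xi>
      by (rule branching_tree[OF grid_max_sources])
    show ?thesis
    proof (rule tree.tree_max_le_supersolution)
      fix u y
      interpret step: symmetric_step M "\<xi> u" \<alpha> C by (rule C)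
      show "1 - upper_barrier \<alpha> a b y \<le> expectation (\<lambda>\<omega>. indicator {..y} (grid_max (2 ^ k) u \<omega>) *
          ((1 + (1 - upper_barrier \<alpha> a b (y - \<xi> u \<omega>))\<^sup>2) / 2))"
      proof (rule step.supersolution[OF _ _ tail x0 a(1) b(1) \<delta>(1) _ \<delta>(3) b2 b(2)])
        show "grid_max (2 ^ k) u \<in> borel_measurable M" by (rule tree.R_measurable)
        show "\<xi> u \<omega> \<le> grid_max (2 ^ k) u \<omega>" for \<omega>
          unfolding grid_max_def by (intro Max_ge) (auto intro!: image_eqI[of _ _ "2 ^ k"])
      qed (use \<delta> in auto)
    qed (use upper_barrier_bounds a b in auto)
  qed
  then show ?thesis using b(1) by blast
qed

lemma lower_bound:
  assumes a: "0 < a" "a\<^sup>2 / 2 < 1 / \<alpha>"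
  shows "\<exists>\<rho> b. 0 < \<rho> \<and> \<rho> < 1 \<and> 0 < b \<and>
    (\<forall>n x. lower_barrier \<alpha> a b x - quadratic_iterate n
       \<le> prob {\<omega>\<in>space M. x < tree_max B (\<lambda>u \<omega>. X u (\<rho> * T u \<omega>) \<omega>) \<xi> n [] \<omega>})"
proof -
  obtain C where C: "\<And>u. symmetric_step M (\<xi> u) \<alpha> C" using step_bounds by blast
  have C0: "0 \<le> C" using symmetric_step.C_nonneg[OF C] .
  obtain K where K: "0 < K" "\<And>y. 0 < y \<Longrightarrow> \<tau> y \<le> K * y powr (-\<alpha>)"
    using killed.upper_tail_le_power by blast
  define L where "L = (1 / \<alpha> + a\<^sup>2 / 2) / 2"
  have L: "L < 1 / \<alpha>" "a\<^sup>2 / 2 < L" using a by (auto simp: L_def field_simps)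
  have L0: "0 < L" using L(2) zero_le_power2[of a] by linarith
  \<comment> \<open>The midpoint of \<open>L * \<alpha>\<close> and 1: below 1 for the particle to
    be alive, above \<open>L * \<alpha>\<close> for the tail.\<close>
  define \<rho> where "\<rho> = (1 + L * \<alpha>) / 2"
  have L\<alpha>: "0 < L * \<alpha>" "L * \<alpha> < 1" using L(1) L0 index by (auto simp: field_simps)
  have \<rho>: "0 < \<rho>" "\<rho> < 1" "L < \<rho> / \<alpha>" using L\<alpha> index by (auto simp: \<rho>_def field_simps)
  \<comment> \<open>Moves the time factor \<rho> into the argument of the tail, where it returns as
    \<open>c powr (-\<alpha>) = \<rho>\<close>.\<close>
  define c where "c = \<rho> powr (-1/\<alpha>)"
  have c: "0 < c" using \<rho> by (simp add: c_def)
  have cp: "c powr (-\<alpha>) = \<rho>" using \<rho> index by (simp add: c_def powr_powr)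
  let ?H = "\<lambda>x. expectation (\<lambda>\<omega>. \<tau> (c * (x / T [] \<omega> powr (1 / \<alpha>))))"
  have "((\<lambda>x. x powr \<alpha> * ?H x) \<longlongrightarrow> expectation (T []) * (c powr (-\<alpha>) / \<alpha>)) at_top"
  proof (rule tendsto_scaled_expectation[OF killed.T_mean(2) killed.T_pos index(1) _ _ killed.upper_tail_scaled_asymp[OF c]])
    show "(\<lambda>z. \<tau> (c * z)) \<in> borel_measurable borel" using killed.upper_tail_measurable by measurable
    show "\<bar>\<tau> (c * z)\<bar> \<le> K * c powr (-\<alpha>) * z powr (-\<alpha>)" if "0 < z" for z
      using K(2)[of "c * z"] c that killed.upper_tail_bounds by (simp add: powr_mult mult_ac)
  qed
  then have "\<forall>\<^sub>F x in at_top. L < x powr \<alpha> * ?H x"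
    using \<rho>(3) killed.T_mean(1)[of "[]"] by (intro order_tendstoD(1)) (auto simp: cp)
  then obtain y0 where y0: "\<And>x. y0 \<le> x \<Longrightarrow> L < x powr \<alpha> * ?H x" by (auto simp: eventually_at_top_linorder)
  define x0 where "x0 = max 1 y0"
  have x0: "0 < x0" by (simp add: x0_def)
  have tail: "L * y powr (-\<alpha>) \<le> prob {\<omega>\<in>space M. y < X u (\<rho> * T u \<omega>) \<omega>}" if y: "x0 \<le> y" for u y
  proof -
    have y1: "0 < y" "y0 \<le> y" using y by (auto simp: x0_def)
    have "L * y powr (-\<alpha>) \<le> ?H y"
      using y0[OF y1(2)] y1(1) by (simp add: powr_minus field_simps)
    also have "\<dots> = expectation (\<lambda>\<omega>. \<tau> (c * (y / T u \<omega> powr (1 / \<alpha>))))"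
      by (rule expectation_lifetime_eq) (use killed.upper_tail_measurable in measurable)
    also have "\<dots> = expectation (\<lambda>\<omega>. \<tau> (y / (\<rho> * T u \<omega>) powr (1 / \<alpha>)))"
    proof (rule Bochner_Integration.integral_cong)
      fix \<omega> assume "\<omega> \<in> space M"
      then have "0 < T u \<omega>" by (rule lifetime_pos)
      then have "c * (y / T u \<omega> powr (1 / \<alpha>)) = y / (\<rho> * T u \<omega>) powr (1 / \<alpha>)"
        using \<rho> by (simp add: c_def powr_mult powr_minus divide_inverse mult_ac)
      then show "\<tau> (c * (y / T u \<omega> powr (1 / \<alpha>))) = \<tau> (y / (\<rho> * T u \<omega>) powr (1 / \<alpha>))" by simp
    qed simp
    also have "\<dots> = prob {\<omega>\<in>space M. y < X u (\<rho> * T u \<omega>) \<omega>}"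
      using killed.prob_motion_at_T[OF \<rho>(1), of y u] by (simp add: upper_tail_eq[of u])
    finally show ?thesis .
  qed
  have "((\<lambda>\<delta>. a\<^sup>2 * (1 - \<delta>) powr (-\<alpha>) / 2) \<longlongrightarrow> a\<^sup>2 * (1 - 0) powr (-\<alpha>) / 2) (at_right 0)"
    by (intro tendsto_intros) auto
  then have "\<forall>\<^sub>F \<delta> in at_right 0. a\<^sup>2 * (1 - \<delta>) powr (-\<alpha>) / 2 < L"
    using L by (intro order_tendstoD(2)[where y="a\<^sup>2 * (1 - 0) powr (-\<alpha>) / 2"]) auto
  then obtain \<delta> where \<delta>: "0 < \<delta>" "\<delta> < 1/2" "a\<^sup>2 * (1 - \<delta>) powr (-\<alpha>) / 2 < L"
    by (rule eventually_at_right_0D[of _ "1/2"]) auto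
  define d where "d = L - a\<^sup>2 * (1 - \<delta>) powr (-\<alpha>) / 2"
  have d: "0 < d" using \<delta> by (simp add: d_def)
  define b where "b = max (a * x0 powr (\<alpha>/2)) (max (2 * a\<^sup>2) (a\<^sup>2 * (2 * L + \<delta> powr (-\<alpha>) * C + 96 * C) / d))"
  have b: "0 < b" "a * x0 powr (\<alpha>/2) \<le> b" "2 * a\<^sup>2 \<le> b" using a x0 by (auto simp: b_def less_max_iff_disj)
  have "a\<^sup>2 * (2 * L + \<delta> powr (-\<alpha>) * C + 96 * C) / d \<le> b" by (simp add: b_def)
  then have "a\<^sup>2 / b * (2 * L + \<delta> powr (-\<alpha>) * C + 96 * C) \<le> d"
    using d b(1) by (simp add: pos_divide_le_eq mult.commute)
  then have b2: "a\<^sup>2 * (1 - \<delta>) powr (-\<alpha>) / 2 + a\<^sup>2 / b * (2 * L + \<delta> powr (-\<alpha>) * C + 96 * C) \<le> L"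
    by (simp add: d_def)
  have "lower_barrier \<alpha> a b x - quadratic_iterate n
       \<le> prob {\<omega>\<in>space M. x < tree_max B (\<lambda>u \<omega>. X u (\<rho> * T u \<omega>) \<omega>) \<xi> n [] \<omega>}" for n x
  proof -
    interpret tree: branching_tree M \<E> B "\<lambda>u \<omega>. X u (\<rho> * T u \<omega>) \<omega>" \<xi>
      using \<rho> by (intro branching_tree motion_at_lifetime_sources) simp
    show ?thesis
    proof (rule tree.tree_max_ge_subsolution)
      fix u y
      interpret step: symmetric_step M "\<xi> u" \<alpha> C by (rule C)
      show "expectation (\<lambda>\<omega>. indicator {..y} (X u (\<rho> * T u \<omega>) \<omega>) *
          ((1 + (1 - lower_barrier \<alpha> a b (y - \<xi> u \<omega>))\<^sup>2) / 2)) \<le> 1 - lower_barrier \<alpha> a b y"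
        by (rule step.subsolution[OF tree.R_measurable tail x0 a(1) b(1) _ \<delta>(1) _ b2 b(2,3)])
           (use \<delta> L0 in auto)
    qed (use lower_barrier_bounds a b in auto)
  qed
  then have "\<forall>n x. lower_barrier \<alpha> a b x - quadratic_iterate n
       \<le> prob {\<omega>\<in>space M. x < tree_max B (\<lambda>u \<omega>. X u (\<rho> * T u \<omega>) \<omega>) \<xi> n [] \<omega>}" by simp
  with \<rho> b(1) show ?thesis by (intro exI[of _ \<rho>] exI[of _ b] conjI)
qed

section \<open>The tail of the maximal displacement\<close>

abbreviation tail where "tail x \<equiv> prob {\<omega>\<in>space M. ereal x \<le> maximal_displacement T B X \<omega>}"

text \<open>As mesh and depth grow together, the events that the truncated tree exceeds y increase,
  and for y < x their union contains M >= x. Continuity from below transfers the barrier; letting y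
  tend to x from the left restores x, by continuity of the powers.\<close>

lemma tail_le:
  assumes a: "0 < a" "1 / \<alpha> < a\<^sup>2 / 2"
  obtains b where "\<And>x. 0 < x \<Longrightarrow> tail x \<le> a * x powr (-\<alpha>/2) + b * x powr (-\<alpha>)"
proof -
  obtain b where b: "0 < b"
    "\<And>k x. prob {\<omega>\<in>space M. x < tree_max B (grid_max (2 ^ k)) \<xi> k [] \<omega>} \<le> upper_barrier \<alpha> a b x"
    using upper_bound[OF a] by (elim exE conjE) simp
  let ?A = "\<lambda>y k. {\<omega>\<in>space M. y < tree_max B (grid_max (2 ^ k)) \<xi> k [] \<omega>}"
  have grid_mono: "grid_max (2 ^ k) u \<omega> \<le> grid_max (2 ^ m) u \<omega>" if "k \<le> m" for k m u \<omega>
  proof (rule ccontr)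
    assume "\<not> grid_max (2 ^ k) u \<omega> \<le> grid_max (2 ^ m) u \<omega>"
    then obtain i where i: "i \<le> 2 ^ k" "grid_max (2 ^ m) u \<omega> < X u (real i / real (2 ^ k) * T u \<omega>) \<omega>"
      by (auto simp: not_le less_grid_max_iff)
    \<comment> \<open>Dyadic grids are nested: the point i of level k is the point
      \<open>2 ^ (m - k) * i\<close> of level m.\<close>
    have pow: "(2::nat) ^ m = 2 ^ (m - k) * 2 ^ k" using that by (simp flip: power_add)
    have "real i / real (2 ^ k) = real (2 ^ (m - k) * i) / real (2 ^ m)" unfolding pow by simp
    moreover have "2 ^ (m - k) * i \<le> 2 ^ m" unfolding pow using i(1) by (intro mult_left_mono) auto
    ultimately have "X u (real i / real (2 ^ k) * T u \<omega>) \<omega> \<le> grid_max (2 ^ m) u \<omega>"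
      unfolding grid_max_def by (intro Max_ge) (auto intro!: image_eqI[of _ _ "2 ^ (m - k) * i"])
    with i(2) show False by simp
  qed
  have A_sets: "?A y k \<in> sets M" for y k
  proof -
    interpret tree: branching_tree M \<E> B "grid_max (2 ^ k)" \<xi>
      by (rule branching_tree[OF grid_max_sources])
    show ?thesis by measurable
  qed
  have A_mono: "incseq (?A y)" for y
  proof (rule incseq_SucI, rule Collect_mono, rule impI)
    fix k \<omega> assume w: "\<omega> \<in> space M \<and> y < tree_max B (grid_max (2 ^ k)) \<xi> k [] \<omega>"
    have "tree_max B (grid_max (2 ^ k)) \<xi> k [] \<omega> \<le> tree_max B (grid_max (2 ^ Suc k)) \<xi> (Suc k) [] \<omega>"
      using grid_mono[of k "Suc k"] by (intro tree_max_mono) auto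
    with w show "\<omega> \<in> space M \<and> y < tree_max B (grid_max (2 ^ Suc k)) \<xi> (Suc k) [] \<omega>" by auto
  qed
  have strict: "tail x \<le> upper_barrier \<alpha> a b y" if "y < x" for x y
  proof -
    have "{\<omega>\<in>space M. ereal x \<le> maximal_displacement T B X \<omega>} \<subseteq> (\<Union>k. ?A y k)"
    proof
      fix \<omega> assume "\<omega> \<in> {\<omega>\<in>space M. ereal x \<le> maximal_displacement T B X \<omega>}"
      then have w: "\<omega> \<in> space M" and "ereal x \<le> maximal_displacement T B X \<omega>" by auto
      moreover have "ereal y < ereal x" using that by simp
      ultimately have "ereal y < maximal_displacement T B X \<omega>" by (meson less_le_trans)
      then obtain u k i where i: "i < (2::nat) ^ k" "born B \<omega> u"
          "y < birth_place T X \<omega> u + X u (real i / 2 ^ k * T u \<omega>) \<omega>"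
        unfolding less_maximal_displacement_iff[OF w] by blast
      define n where "n = max k (length u)"
      have "X u (real i / 2 ^ k * T u \<omega>) \<omega> \<le> grid_max (2 ^ k) u \<omega>"
        unfolding grid_max_def using i(1) by (intro Max_ge) (auto intro!: image_eqI[of _ _ i])
      also have "\<dots> \<le> grid_max (2 ^ n) u \<omega>" by (rule grid_mono) (simp add: n_def)
      also have "\<dots> \<le> tree_max B (grid_max (2 ^ n)) \<xi> (n - length u) u \<omega>"
        by (cases "n - length u") auto
      finally have "y < birth_place T X \<omega> u + tree_max B (grid_max (2 ^ n)) \<xi> (n - length u) u \<omega>"
        using i(3) by simp
      also have "\<dots> \<le> tree_max B (grid_max (2 ^ n)) \<xi> n [] \<omega>"
        using i(2) by (intro birth_place_le_tree_max) (auto simp: n_def)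
      finally show "\<omega> \<in> (\<Union>k. ?A y k)" using w by blast
    qed
    then have "tail x \<le> prob (\<Union>k. ?A y k)"
      using A_sets by (intro finite_measure_mono sets.countable_UN) auto
    also have "\<dots> \<le> upper_barrier \<alpha> a b y"
    proof (rule LIMSEQ_le_const2)
      show "(\<lambda>k. prob (?A y k)) \<longlonglongrightarrow> prob (\<Union>k. ?A y k)"
        using A_sets A_mono by (intro finite_Lim_measure_incseq) auto
    qed (use b(2) in blast)
    finally show ?thesis .
  qed
  have "tail x \<le> a * x powr (-\<alpha>/2) + b * x powr (-\<alpha>)" if x: "0 < x" for x
  proof (rule tendsto_lowerbound)
    show "((\<lambda>y. a * y powr (-\<alpha>/2) + b * y powr (-\<alpha>)) \<longlongrightarrow> a * x powr (-\<alpha>/2) + b * x powr (-\<alpha>)) (at_left x)"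
      using x by (intro tendsto_intros) auto
    have "\<forall>\<^sub>F y in at_left x. y \<in> {0<..<x}" using x by (rule eventually_at_left_real)
    then show "\<forall>\<^sub>F y in at_left x. tail x \<le> a * y powr (-\<alpha>/2) + b * y powr (-\<alpha>)"
    proof eventually_elim
      fix y assume y: "y \<in> {0<..<x}"
      have "upper_barrier \<alpha> a b y \<le> a * y powr (-\<alpha>/2) + b * y powr (-\<alpha>)"
        using y by (auto simp: upper_barrier_def)
      then show "tail x \<le> a * y powr (-\<alpha>/2) + b * y powr (-\<alpha>)" using strict[of y x] y by auto
    qed
  qed simp
  then show thesis using that by blast
qed

text \<open>Every exceedance in the truncated tree belongs to a particle alive at age
  \<open>\<rho> * T u \<omega>\<close>, so each n gives a lower bound for the same probability; the
  slack \<open>quadratic_iterate n\<close> vanishes in the limit.\<close>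

lemma tail_ge:
  assumes a: "0 < a" "a\<^sup>2 / 2 < 1 / \<alpha>"
  obtains b where "\<And>x. 0 < x \<Longrightarrow> a * x powr (-\<alpha>/2) - b * x powr (-\<alpha>) \<le> tail x"
proof -
  obtain b \<rho> where \<rho>: "0 < \<rho>" "\<rho> < 1" and b: "0 < b"
    "\<And>n x. lower_barrier \<alpha> a b x - quadratic_iterate n
       \<le> prob {\<omega>\<in>space M. x < tree_max B (\<lambda>u \<omega>. X u (\<rho> * T u \<omega>) \<omega>) \<xi> n [] \<omega>}"
    using lower_bound[OF a] by (elim exE conjE) simp
  have "lower_barrier \<alpha> a b x \<le> tail x" for x
  proof (rule LIMSEQ_le_const2)
    show "(\<lambda>n. lower_barrier \<alpha> a b x - quadratic_iterate n) \<longlonglongrightarrow> lower_barrier \<alpha> a b x"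
      using tendsto_diff[OF tendsto_const quadratic_iterate_tendsto] by simp
    have "lower_barrier \<alpha> a b x - quadratic_iterate n \<le> tail x" for n
    proof -
      have "{\<omega>\<in>space M. x < tree_max B (\<lambda>u \<omega>. X u (\<rho> * T u \<omega>) \<omega>) \<xi> n [] \<omega>}
          \<subseteq> {\<omega>\<in>space M. ereal x \<le> maximal_displacement T B X \<omega>}"
      proof safe
        fix \<omega> assume w: "\<omega> \<in> space M" and x: "x < tree_max B (\<lambda>u \<omega>. X u (\<rho> * T u \<omega>) \<omega>) \<xi> n [] \<omega>"
        obtain u where "born B \<omega> u" "x < birth_place T X \<omega> u + X u (\<rho> * T u \<omega>) \<omega>"
          using less_tree_maxD[of B \<omega> "[]" x T X "\<lambda>u \<omega>. X u (\<rho> * T u \<omega>) \<omega>" n] x by auto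
        then show "ereal x \<le> maximal_displacement T B X \<omega>"
          using \<rho> by (intro less_imp_le less_maximal_displacementI[OF w]) auto
      qed
      then have "prob {\<omega>\<in>space M. x < tree_max B (\<lambda>u \<omega>. X u (\<rho> * T u \<omega>) \<omega>) \<xi> n [] \<omega>} \<le> tail x"
        by (intro finite_measure_mono le_maximal_displacement_sets)
      with b(2)[of x n] show ?thesis by (rule order.trans)
    qed
    then show "\<exists>N. \<forall>n\<ge>N. lower_barrier \<alpha> a b x - quadratic_iterate n \<le> tail x" by blast
  qed
  moreover have "a * x powr (-\<alpha>/2) - b * x powr (-\<alpha>) \<le> lower_barrier \<alpha> a b x" if "0 < x" for x
    using that by (simp add: lower_barrier_def)
  ultimately have "a * x powr (-\<alpha>/2) - b * x powr (-\<alpha>) \<le> tail x" if "0 < x" for x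
    using that order.trans by blast
  then show thesis using that by blast
qed

lemma tail_tendsto: "((\<lambda>x. x powr (\<alpha>/2) * tail x) \<longlongrightarrow> sqrt (2 / \<alpha>)) at_top"
proof -
  define s where "s = sqrt (2 / \<alpha>)"
  have sq: "s\<^sup>2 / 2 = 1 / \<alpha>" "0 < s" using index by (auto simp: s_def)
  have split: "x powr (\<alpha>/2) * (a * x powr (-\<alpha>/2) + b * x powr (-\<alpha>)) = a + b * x powr (-\<alpha>/2)"
    if "0 < x" for x a b :: real
    using that by (simp add: distrib_left mult.left_commute flip: powr_add)
  have lim: "((\<lambda>x. a + b * x powr (-\<alpha>/2)) \<longlongrightarrow> a) at_top" for a b :: real
  proof -
    have "((\<lambda>x. a + b * x powr (-(\<alpha>/2))) \<longlongrightarrow> a + b * 0) at_top"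
      using index by (intro tendsto_intros tendsto_neg_powr filterlim_ident) auto
    then show ?thesis by simp
  qed
  have "((\<lambda>x. x powr (\<alpha>/2) * tail x) \<longlongrightarrow> s) at_top"
  proof (rule order_tendstoI)
    fix K assume K: "s < K"
    define a where "a = (s + K) / 2"
    have a: "s < a" "a < K" "0 < a" using K sq(2) by (simp_all add: a_def)
    then have "s\<^sup>2 < a\<^sup>2" using sq(2) by (intro power_strict_mono) auto
    then have "1 / \<alpha> < a\<^sup>2 / 2" using sq(1) by linarith
    then obtain b where b: "\<And>x. 0 < x \<Longrightarrow> tail x \<le> a * x powr (-\<alpha>/2) + b * x powr (-\<alpha>)"
      using tail_le[OF a(3)] by blast
    have "\<forall>\<^sub>F x in at_top. a + b * x powr (-\<alpha>/2) < K" using lim a(2) by (rule order_tendstoD)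
    then show "\<forall>\<^sub>F x in at_top. x powr (\<alpha>/2) * tail x < K"
      using eventually_gt_at_top[of 0]
    proof eventually_elim
      fix x :: real assume x: "a + b * x powr (-\<alpha>/2) < K" "0 < x"
      have "x powr (\<alpha>/2) * tail x \<le> x powr (\<alpha>/2) * (a * x powr (-\<alpha>/2) + b * x powr (-\<alpha>))"
        using b[OF x(2)] by (intro mult_left_mono) auto
      with x split[OF x(2), of a b] show "x powr (\<alpha>/2) * tail x < K" by linarith
    qed
  next
    fix K assume K: "K < s"
    \<comment> \<open>The maximum with 0 keeps \<open>a\<close> positive even for negative
      \<open>K\<close>, as the barrier requires.\<close>
    define a where "a = (s + max K 0) / 2"
    have "max K 0 < s" using K sq(2) by (simp only: max_less_iff_conj)
    then have a: "a < s" "K < a" "0 < a"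
      using max.cobounded1[of K 0] max.cobounded2[of 0 K] sq(2) by (simp_all add: a_def)
    then have "a\<^sup>2 < s\<^sup>2" by (intro power_strict_mono) auto
    then have "a\<^sup>2 / 2 < 1 / \<alpha>" using sq(1) by linarith
    then obtain b where b: "\<And>x. 0 < x \<Longrightarrow> a * x powr (-\<alpha>/2) - b * x powr (-\<alpha>) \<le> tail x"
      using tail_ge[OF a(3)] by blast
    have "\<forall>\<^sub>F x in at_top. K < a + (-b) * x powr (-\<alpha>/2)" using lim a(2) by (rule order_tendstoD)
    then show "\<forall>\<^sub>F x in at_top. K < x powr (\<alpha>/2) * tail x"
      using eventually_gt_at_top[of 0]
    proof eventually_elim
      fix x :: real assume x: "K < a + (-b) * x powr (-\<alpha>/2)" "0 < x"
      have "x powr (\<alpha>/2) * (a * x powr (-\<alpha>/2) + (-b) * x powr (-\<alpha>)) \<le> x powr (\<alpha>/2) * tail x"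
        using b[OF x(2)] by (intro mult_left_mono) auto
      with x split[OF x(2), of a "-b"] show "K < x powr (\<alpha>/2) * tail x" by linarith
    qed
  qed
  then show ?thesis by (simp only: s_def)
qed

end

theorem theorem1:
  fixes M :: "'w measure" and \<alpha> :: real
    and T :: "bool list \<Rightarrow> 'w \<Rightarrow> real"
    and B :: "bool list \<Rightarrow> 'w \<Rightarrow> bool"
    and X :: "bool list \<Rightarrow> real \<Rightarrow> 'w \<Rightarrow> real"
  assumes "0 < \<alpha>" and "\<alpha> < 2"
    and "cbss_process M \<alpha> T B X"
  shows "(\<lambda>x::real. measure M {\<omega> \<in> space M. maximal_displacement T B X \<omega> \<ge> ereal x})
           \<sim>[at_top] (\<lambda>x. sqrt (2 / \<alpha>) * (1 / x powr (\<alpha> / 2)))"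
proof (rule asymp_equivI')
  interpret stable_cbss M \<alpha> T B X
    using assms by (simp add: stable_cbss_def stable_cbss_axioms_def)
  have "((\<lambda>x. x powr (\<alpha>/2) * tail x / sqrt (2 / \<alpha>)) \<longlongrightarrow> sqrt (2 / \<alpha>) / sqrt (2 / \<alpha>)) at_top"
    using index by (intro tendsto_divide tail_tendsto tendsto_const) auto
  then show "((\<lambda>x. tail x / (sqrt (2 / \<alpha>) * (1 / x powr (\<alpha> / 2)))) \<longlongrightarrow> 1) at_top"
    using index by (simp add: field_simps)
qed

end
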